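(* Let $P_{n,k}$ be the one-sided $k$-transposition shuffle on $S_n$ and let $U$ be the uniform measure on $S_n$. (i) There exists a universal constant $A$ such that for odd $k\ge 1$ and $c>0$, when $t=n\log n+cn$, for all $n$ sufficiently large, $$4\|P_{n,k}^t-U\|_{\mathrm{T.V.}}^2\le \left\|\frac{P_{n,k}^t}{U}-1\right\|_2^2<Ae^{-c}.$$ (ii) There exists a universal constant $B$ such that for even $k\ge 4$ and $c>1$, when $t=n\log n+cn$, for all $n$ sufficiently large, $$4\|P_{n,k}^t-U\|_{\mathrm{T.V.}}^2\le \left\|\frac{P_{n,k}^t}{U}-1\right\|_2^2<Be^{-c}.$$ (iii) There exists a universal constant $C$ such that for $k=2$ and $c>1$, when $t=\frac32 n\log n+cn$, for all $n$ sufficiently large, $$4\|P_{n,k}^t-U\|_{\mathrm{T.V.}}^2\le \left\|\frac{P_{n,k}^t}{U}-1\right\|_2^2<Ce^{-c}.$$ (iv) For odd $k=n^\gamma$ with $\gamma\in(0,1)$ and $c>3$, when $t=\left(1-\frac{\gamma}{2}\right)n\log n+cn$, for all $n$ sufficiently large (such that $n^\gamma$ is an odd integer), $$4\|P_{n,k}^t-U\|_{\mathrm{T.V.}}^2\le \left\|\frac{P_{n,k}^t}{U}-1\right\|_2^2<10e^{-c}.$$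
   Context: For $1\le i_1,\dots,i_k\le j\le n$ write $(j;i_1,\dots,i_k):=(j\,i_k)\cdots(j\,i_1)\in S_n$, where $(j\,j)$ is the identity. The one-sided $k$-transposition shuffle is the random walk on $S_n$ driven by the probability distribution $$P_{n,k}(\tau)=\sum_{\substack{1\le i_1,\dots,i_k\le j\le n\\ \tau=(j;i_1,\dots,i_k)}}\frac{1}{nj^k};$$ its transition matrix, also denoted $P_{n,k}$, is $P_{n,k}(x,x\tau)=P_{n,k}(\tau)$. $P_{n,k}^t(x,y)$ is the probability of moving from $x$ to $y$ in $t$ steps. $U(y)=1/n!$. Distances are from the identity start: $$\|P_{n,k}^t-U\|_{\mathrm{T.V.}}=\frac12\sum_{y\in S_n}|P_{n,k}^t(\mathrm{id},y)-U(y)|,\qquad \left\|\frac{P_{n,k}^t}{U}-1\right\|_2^2=\sum_{y\in S_n}\left|\frac{P_{n,k}^t(\mathrm{id},y)}{U(y)}-1\right|^2U(y).$$ The squared $\ell^2$ distance equals $\sum_{i\ne1}\beta_i^{2t}$, where $1=\beta_1>\beta_2\ge\cdots\ge\beta_{n!}$ are the eigenvalues of the transition matrix. $\log$ is the natural logarithm. Non-integer values of $t$ are rounded up to an integer. *)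

theory Defs
  imports Complex_Main "HOL-Combinatorics.Permutations"
begin

abbreviation Sym :: "nat \<Rightarrow> (nat \<Rightarrow> nat) set" where
  "Sym n \<equiv> {p. p permutes {1..n}}"

text \<open>The permutation \<open>(j; i\<^sub>1, \<dots>, i\<^sub>k) = (j i\<^sub>k) \<cdots> (j i\<^sub>1)\<close>, with products read as composition
  of functions (rightmost factor first). Reading products in the opposite order
  only reverses the list, so it changes neither the distribution below nor its powers.\<close>

primrec star_word :: "nat \<Rightarrow> nat list \<Rightarrow> nat \<Rightarrow> nat" where
  "star_word j [] = id"
| "star_word j (i # is) = star_word j is \<circ> transpose j i"

definition shuffle_prob :: "nat \<Rightarrow> nat \<Rightarrow> (nat \<Rightarrow> nat) \<Rightarrow> real" where
  "shuffle_prob n k \<tau> =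
     (\<Sum>(j, is) \<in> {(j, is). j \<in> {1..n} \<and> length is = k \<and> set is \<subseteq> {1..j} \<and> star_word j is = \<tau>}.
        1 / (real n * real j ^ k))"

text \<open>For permutations \<open>x\<close>, \<open>y\<close>, the unique \<open>\<tau>\<close> with \<open>y = x \<circ> \<tau>\<close> is \<open>inv x \<circ> y\<close>.\<close>

definition shuffle_kernel :: "nat \<Rightarrow> nat \<Rightarrow> (nat \<Rightarrow> nat) \<Rightarrow> (nat \<Rightarrow> nat) \<Rightarrow> real" where
  "shuffle_kernel n k x y = shuffle_prob n k (inv x \<circ> y)"

primrec shuffle_steps :: "nat \<Rightarrow> nat \<Rightarrow> nat \<Rightarrow> (nat \<Rightarrow> nat) \<Rightarrow> (nat \<Rightarrow> nat) \<Rightarrow> real" where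
  "shuffle_steps n k 0 x y = (if x = y then 1 else 0)"
| "shuffle_steps n k (Suc t) x y =
     (\<Sum>z \<in> Sym n. shuffle_steps n k t x z * shuffle_kernel n k z y)"

definition uniform :: "nat \<Rightarrow> (nat \<Rightarrow> nat) \<Rightarrow> real" where
  "uniform n y = 1 / fact n"

definition tv_dist :: "nat \<Rightarrow> ((nat \<Rightarrow> nat) \<Rightarrow> real) \<Rightarrow> ((nat \<Rightarrow> nat) \<Rightarrow> real) \<Rightarrow> real" where
  "tv_dist n \<mu> \<nu> = 1 / 2 * (\<Sum>y \<in> Sym n. \<bar>\<mu> y - \<nu> y\<bar>)"

text \<open>The norm of \<open>\<mu> / \<nu> - 1\<close> in \<open>\<ell>\<^sup>2(\<nu>)\<close>.\<close>

definition l2_dist :: "nat \<Rightarrow> ((nat \<Rightarrow> nat) \<Rightarrow> real) \<Rightarrow> ((nat \<Rightarrow> nat) \<Rightarrow> real) \<Rightarrow> real" where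
  "l2_dist n \<mu> \<nu> = sqrt (\<Sum>y \<in> Sym n. \<bar>\<mu> y / \<nu> y - 1\<bar>\<^sup>2 * \<nu> y)"

end

theory Submission
  imports Defs
    "HOL-Library.Poly_Mapping"
    "HOL-Computational_Algebra.Polynomial"
    "HOL-Analysis.Convex"
    "HOL-Real_Asymp.Real_Asymp"
begin

text \<open>
  In the group algebra the shuffle is \<open>1/n \<Sum>\<^sub>j ((1 + J\<^sub>j) / j)\<^sup>k\<close>, where
  \<open>J\<^sub>j = \<Sum>\<^sub>i\<^sub><\<^sub>j (i j)\<close> are the commuting Jucys--Murphy elements. Their joint law with respect to the
  trace is the Plancherel growth measure on standard tableaux, read off through the contents of the
  boxes; no representation theory is needed, because the conditional expectation of
  \<open>1 / (z - J\<^sub>n\<^sub>+\<^sub>1)\<close> onto the algebra of \<open>S\<^sub>n\<close> satisfies the recursion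
  \<open>E\<^sub>n = E\<^sub>n\<^sub>-\<^sub>1 (z - J\<^sub>n)\<^sup>2 / ((z - J\<^sub>n)\<^sup>2 - 1)\<close>, and the transition weights of Plancherel growth
  are the residues of the resulting rational function.

  Deleting the first row of a tableau bounds its Plancherel weight by \<open>1 / \<lambda>\<^sub>1!\<close> times that of the
  remaining rows, so the squared \<open>\<ell>\<^sup>2\<close> distance is at most \<open>2 \<Sum>\<^sub>S n! / (n - |S|)! b(S)\<^sup>2\<^sup>t\<close>, up to the
  contribution of the sign representation, where \<open>S\<close> is the set of times at which a box is added
  below the first row and \<open>b(S)\<close> bounds the eigenvalue. The factor 2 comes from the sign twist,
  which negates all contents and so lets long columns be traded for long rows. For fixed \<open>k\<close> a bound
  on \<open>b(S)\<close> depending on \<open>|S|\<close> only is enough. For \<open>k = n\<^sup>\<gamma>\<close> the sum over \<open>S\<close> is evaluated through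
  the gaps between consecutive elements of \<open>S\<close>, which gains the factor \<open>n\<^sup>-\<^sup>\<gamma>\<close>.
\<close>

section \<open>The group algebra and the Jucys--Murphy elements\<close>

text \<open>The functional calculus in the J_j covers polynomials only, whereas the eigenvalue
  bounds use positive parts, absolute values and a comparison of first row and first column.
  Interpolation on the finite set of possible contents bridges the two
  (\<open>repr_all_functions\<close>). At time n log n + c n the sum over m = |S| leaves little
  room: the choice of S costs up to n^m / m! and the ratio n! / (n - m)! up to n^m, so the
  eigenvalue must lose m / n up to an error that 1 / m! can absorb. When m is comparable with n, the
  linear estimate of the logarithm only just balances these factors in the worst case, and the gain
  comes from its quadratic term; this is the origin of the large numerical thresholds. For even k
  negative contents cannot be discarded. There absolute values are taken, the exponent is lowered to
  2, and of a tableau and its transpose the one with the longer first row is kept. The resulting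
  bound is the same for all fixed k, including k = 2, where the stated time is later.\<close>

typedef nperm = "{p :: nat \<Rightarrow> nat. \<exists>n. p permutes {..n}}"
  morphisms perm_fun Nperm
  by (rule exI[of _ id]) (auto intro: permutes_id)

setup_lifting type_definition_nperm

lemma ex_permutes_comp:
  assumes "\<exists>n::nat. p permutes {..n}" "\<exists>n. q permutes {..n}"
  shows "\<exists>n. (p \<circ> q) permutes {..n}"
proof -
  obtain m n where "p permutes {..m}" "q permutes {..n}" using assms by blast
  then have "p permutes {..max m n}" "q permutes {..max m n}"
    by (auto intro: permutes_subset)
  then show ?thesis using permutes_compose by blast
qed

lemma ex_permutes_inv:
  assumes "\<exists>n::nat. p permutes {..n}"
  shows "\<exists>n. inv p permutes {..n}"
  using assms permutes_inv by blast

lemma ex_permutes_bij: "\<exists>n::nat. p permutes {..n} \<Longrightarrow> bij p"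
  using permutes_bij by blast

text \<open>Convolution of finitely supported functions is formulated over additive monoids. With
  \<open>+\<close> read as composition it becomes the product of the group algebra.\<close>

instantiation nperm :: group_add
begin
lift_definition zero_nperm :: nperm is id by (auto intro: permutes_id)
lift_definition plus_nperm :: "nperm \<Rightarrow> nperm \<Rightarrow> nperm" is "(\<circ>)" by (rule ex_permutes_comp)
lift_definition uminus_nperm :: "nperm \<Rightarrow> nperm" is inv by (rule ex_permutes_inv)
lift_definition minus_nperm :: "nperm \<Rightarrow> nperm \<Rightarrow> nperm" is "\<lambda>p q. p \<circ> inv q"
  by (intro ex_permutes_comp ex_permutes_inv)
instance
proof
  fix a b c :: nperm
  show "a + b + c = a + (b + c)" by transfer (simp add: o_assoc)
  show "0 + a = a" by transfer simp
  show "a + 0 = a" by transfer simp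
  show "- a + a = 0" by transfer (auto dest!: ex_permutes_bij intro!: inv_o_cancel simp: bij_is_inj)
  show "a + - b = a - b" by transfer simp
qed
end

lift_definition tswap :: "nat \<Rightarrow> nat \<Rightarrow> nperm" is "\<lambda>i j. transpose i j"
  subgoal for i j
    by (rule exI[of _ "max i j"]) (auto intro: permutes_swap_id)
  done

definition perms_le :: "nat \<Rightarrow> nperm set" where "perms_le n = {p. perm_fun p permutes {1..n}}"

lemma perm_fun_inject': "perm_fun p = perm_fun q \<longleftrightarrow> p = q"
  by (rule perm_fun_inject)

lemma finite_perms_le: "finite (perms_le n)"
proof -
  have "perm_fun ` perms_le n \<subseteq> {p. p permutes {1..n}}" unfolding perms_le_def by auto
  then have "finite (perm_fun ` perms_le n)" by (rule finite_subset) (simp add: finite_permutations)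
  then show ?thesis by (rule finite_imageD) (auto simp: inj_on_def perm_fun_inject')
qed

lemma perms_le_zero: "0 \<in> perms_le n" unfolding perms_le_def by (simp add: zero_nperm.rep_eq permutes_id)
lemma perms_le_plus: "p \<in> perms_le n \<Longrightarrow> q \<in> perms_le n \<Longrightarrow> p + q \<in> perms_le n"
  unfolding perms_le_def by (simp add: plus_nperm.rep_eq permutes_compose)
lemma perms_le_uminus: "p \<in> perms_le n \<Longrightarrow> - p \<in> perms_le n"
  unfolding perms_le_def by (simp add: uminus_nperm.rep_eq permutes_inv)
lemma perms_le_plus_iff1: "q \<in> perms_le n \<Longrightarrow> p + q \<in> perms_le n \<longleftrightarrow> p \<in> perms_le n"
  by (metis perms_le_plus perms_le_uminus add.assoc add.right_inverse add.right_neutral)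
lemma perms_le_plus_iff2: "q \<in> perms_le n \<Longrightarrow> q + p \<in> perms_le n \<longleftrightarrow> p \<in> perms_le n"
  by (metis perms_le_plus perms_le_uminus add.assoc left_minus add.left_neutral)
lemma perms_le_mono: "m \<le> n \<Longrightarrow> perms_le m \<subseteq> perms_le n"
  unfolding perms_le_def by (auto intro: permutes_subset)
lemma perms_le_tswap: "1 \<le> i \<Longrightarrow> i \<le> n \<Longrightarrow> 1 \<le> j \<Longrightarrow> j \<le> n \<Longrightarrow> tswap i j \<in> perms_le n"
  unfolding perms_le_def by (simp add: tswap.rep_eq permutes_swap_id)
lemma perms_le_Suc_iff: "p \<in> perms_le (Suc n) \<Longrightarrow> perm_fun p (Suc n) = Suc n \<Longrightarrow> p \<in> perms_le n"
  unfolding perms_le_def mem_Collect_eq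
  by (rule permutes_superset[where S="{1..Suc n}"]) (auto simp: le_Suc_eq)
lemma perms_le_fix: "p \<in> perms_le n \<Longrightarrow> i > n \<Longrightarrow> perm_fun p i = i"
  unfolding perms_le_def by (auto simp: permutes_def)
lemma tswap_tswap [simp]: "tswap i j + tswap i j = 0"
  by transfer (simp add: fun_eq_iff)
lemma tswap_self [simp]: "tswap i i = 0" by transfer simp

section \<open>The group algebra and its conditional expectations\<close>

type_synonym galg = "nperm \<Rightarrow>\<^sub>0 real"

abbreviation sg :: "nperm \<Rightarrow> real \<Rightarrow> galg" where "sg \<equiv> Poly_Mapping.single"
abbreviation coef :: "galg \<Rightarrow> nperm \<Rightarrow> real" where "coef \<equiv> Poly_Mapping.lookup"

definition perm_elt :: "nperm \<Rightarrow> galg" where "perm_elt p = sg p 1"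
definition scal :: "real \<Rightarrow> galg" where "scal c = sg 0 c"

lemma perm_elt_mult: "perm_elt p * perm_elt q = perm_elt (p + q)" unfolding perm_elt_def by (simp add: mult_single)
lemma perm_elt_zero [simp]: "perm_elt 0 = 1" unfolding perm_elt_def by simp
lemma scal_mult: "scal a * scal b = scal (a * b)" unfolding scal_def by (simp add: mult_single)
lemma scal_add: "scal a + scal b = scal (a + b)" unfolding scal_def by (simp add: single_add)
lemma scal_0 [simp]: "scal 0 = 0" unfolding scal_def by simp
lemma scal_1 [simp]: "scal 1 = 1" unfolding scal_def by simp

lemma galg_expand: "x = (\<Sum>p\<in>Poly_Mapping.keys x. sg p (coef x p))"
  by (rule poly_mapping_eqI)
    (auto simp: lookup_sum lookup_single when_def sum.delta[OF finite_keys] in_keys_iff)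

text \<open>Both sides of the identities below are additive in each argument, so it is enough to
  test multiples of single permutations.\<close>

lemma galg_induct [case_names zero sg add]:
  assumes "P 0" "\<And>p c. P (sg p c)" "\<And>x y. P x \<Longrightarrow> P y \<Longrightarrow> P (x + y)"
  shows "P (x :: galg)"
proof -
  have "P (\<Sum>p\<in>A. sg p (coef x p))" if "finite A" for A
    using that by (induction A) (auto intro: assms)
  then show ?thesis using galg_expand[of x] finite_keys by metis
qed

definition supported :: "nat \<Rightarrow> galg set" where "supported n = {x. \<forall>p. p \<notin> perms_le n \<longrightarrow> coef x p = 0}"

lemma supported_expand: "x \<in> supported n \<Longrightarrow> x = (\<Sum>p\<in>perms_le n. sg p (coef x p))"
  by (rule poly_mapping_eqI)
    (auto simp: lookup_sum lookup_single when_def sum.delta[OF finite_perms_le] supported_def)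

lemma supported_add: "x \<in> supported n \<Longrightarrow> y \<in> supported n \<Longrightarrow> x + y \<in> supported n"
  unfolding supported_def by (simp add: lookup_add)
lemma supported_diff: "x \<in> supported n \<Longrightarrow> y \<in> supported n \<Longrightarrow> x - y \<in> supported n"
  unfolding supported_def by (simp add: lookup_minus)
lemma supported_zero: "0 \<in> supported n" unfolding supported_def by simp
lemma supported_sg: "p \<in> perms_le n \<Longrightarrow> sg p c \<in> supported n"
  unfolding supported_def by (auto simp: lookup_single when_def)
lemma supported_perm_elt: "p \<in> perms_le n \<Longrightarrow> perm_elt p \<in> supported n" unfolding perm_elt_def by (rule supported_sg)
lemma supported_scal: "scal c \<in> supported n" unfolding scal_def by (rule supported_sg[OF perms_le_zero])
lemma supported_one: "1 \<in> supported n" using supported_scal[of 1] by simp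
lemma supported_sum: "(\<And>i. i \<in> I \<Longrightarrow> f i \<in> supported n) \<Longrightarrow> sum f I \<in> supported n"
  by (induction I rule: infinite_finite_induct) (auto intro: supported_add supported_zero)

lemma supported_induct [consumes 1, case_names zero sg add]:
  assumes "x \<in> supported n" and "P 0" "\<And>p c. p \<in> perms_le n \<Longrightarrow> P (sg p c)"
    "\<And>x y. P x \<Longrightarrow> P y \<Longrightarrow> P (x + y)"
  shows "P x"
proof -
  have "P (\<Sum>p\<in>A. sg p (coef x p))" if "finite A" "A \<subseteq> perms_le n" for A
    using that by (induction A) (auto intro: assms)
  then show ?thesis using supported_expand[OF assms(1)] finite_perms_le by (metis order_refl)
qed

lemma supported_mult: "x \<in> supported n \<Longrightarrow> y \<in> supported n \<Longrightarrow> x * y \<in> supported n"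
proof (induction x rule: supported_induct)
  case (sg p c)
  from sg(2) show ?case
    by (induction y rule: supported_induct)
      (use sg(1) in \<open>auto simp: mult_single distrib_left intro: supported_add supported_zero supported_sg perms_le_plus\<close>)
qed (auto simp: distrib_right intro: supported_add supported_zero)

lemma supported_power: "x \<in> supported n \<Longrightarrow> x ^ k \<in> supported n"
  by (induction k) (auto intro: supported_one supported_mult)

lemma supported_mono: "m \<le> n \<Longrightarrow> x \<in> supported m \<Longrightarrow> x \<in> supported n"
  unfolding supported_def using perms_le_mono by blast

text \<open>The conditional expectation onto the algebra of S_n. It keeps the coefficient at the
  identity, that is the normalised trace, and by \<open>restr_mult_right\<close> it is linear over
  that algebra.\<close>

lift_definition restr :: "nat \<Rightarrow> galg \<Rightarrow> galg" is "\<lambda>n x p. if p \<in> perms_le n then x p else 0"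
  by (erule rev_finite_subset) auto

lemma restr_add: "restr n (x + y) = restr n x + restr n y"
  by (rule poly_mapping_eqI) (simp add: restr.rep_eq lookup_add)
lemma restr_diff: "restr n (x - y) = restr n x - restr n y"
  by (rule poly_mapping_eqI) (simp add: restr.rep_eq lookup_minus)
lemma restr_zero [simp]: "restr n 0 = 0"
  by (rule poly_mapping_eqI) (simp add: restr.rep_eq)
lemma restr_sg: "restr n (sg p c) = (if p \<in> perms_le n then sg p c else 0)"
  by (rule poly_mapping_eqI) (auto simp: restr.rep_eq lookup_single when_def)
lemma restr_id: "x \<in> supported n \<Longrightarrow> restr n x = x"
  by (rule poly_mapping_eqI) (auto simp: restr.rep_eq supported_def)

lemma restr_mult_right: "u \<in> supported n \<Longrightarrow> restr n (x * u) = restr n x * u"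
proof (induction x rule: galg_induct)
  case (sg p c)
  then show ?case
    by (induction u rule: supported_induct)
      (auto simp: mult_single distrib_left restr_add restr_sg perms_le_plus_iff1)
qed (auto simp: restr_add distrib_right)

section \<open>Commutation relations of the Jucys--Murphy elements\<close>

definition jm :: "nat \<Rightarrow> galg" where "jm n = (\<Sum>i\<in>{1..<n}. perm_elt (tswap i n))"

lemma jm_supported: "jm n \<in> supported n"
  unfolding jm_def by (intro supported_sum supported_perm_elt perms_le_tswap) auto

lemma conj_tswap: "q + tswap i j = tswap (perm_fun q i) (perm_fun q j) + q"
proof (rule perm_fun_inject[THEN iffD1], rule ext)
  fix x
  have b: "bij (perm_fun q)" using perm_fun[of q] ex_permutes_bij by auto
  then have "inj (perm_fun q)" by (rule bij_is_inj)
  then show "perm_fun (q + tswap i j) x = perm_fun (tswap (perm_fun q i) (perm_fun q j) + q) x"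
    by (auto simp: plus_nperm.rep_eq tswap.rep_eq transpose_def inj_eq)
qed

text \<open>Conjugation by q \<in> S_n permutes the transpositions (i n+1), i \<le> n, among
  themselves, because q fixes n+1.\<close>

lemma jm_comm: "u \<in> supported n \<Longrightarrow> u * jm (Suc n) = jm (Suc n) * u"
proof (induction u rule: supported_induct)
  case (sg q c)
  then have q: "perm_fun q permutes {1..<Suc n}" by (simp add: perms_le_def atLeastLessThanSuc_atLeastAtMost)
  have f: "perm_fun q (Suc n) = Suc n" using sg by (intro perms_le_fix) auto
  have "sg q c * jm (Suc n) = (\<Sum>i\<in>{1..<Suc n}. sg (q + tswap i (Suc n)) c)"
    unfolding jm_def perm_elt_def by (simp add: sum_distrib_left mult_single del: sum.op_ivl_Suc)
  also have "\<dots> = (\<Sum>i\<in>{1..<Suc n}. sg (tswap (perm_fun q i) (Suc n) + q) c)"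
    by (simp add: conj_tswap f del: sum.op_ivl_Suc)
  also have "\<dots> = (\<Sum>i\<in>{1..<Suc n}. sg (tswap i (Suc n) + q) c)"
    using sum.permute[OF q, of "\<lambda>i. sg (tswap i (Suc n) + q) c"] by (simp add: o_def del: sum.op_ivl_Suc)
  also have "\<dots> = jm (Suc n) * sg q c"
    unfolding jm_def perm_elt_def by (simp add: sum_distrib_right mult_single del: sum.op_ivl_Suc)
  finally show ?case .
qed (auto simp: distrib_left distrib_right)

lemma scal_comm: "scal c * x = x * scal c"
  by (induction x rule: galg_induct) (auto simp: scal_def mult_single algebra_simps)

text \<open>The relation of the degenerate affine Hecke algebra. Conjugation by s = (n n+1) carries
  (i n+1) to (i n), and the remaining summand of J_(n+1) is s itself, which gives s s = 1.\<close>

lemma jm_Suc_swap: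
  assumes "n \<ge> 1"
  shows "jm (Suc n) * perm_elt (tswap n (Suc n)) = perm_elt (tswap n (Suc n)) * jm n + 1"
proof -
  let ?s = "tswap n (Suc n)"
  have "jm (Suc n) = (\<Sum>i\<in>{1..<n}. perm_elt (tswap i (Suc n))) + perm_elt ?s"
    unfolding jm_def using assms by simp
  moreover have "tswap i (Suc n) + ?s = ?s + tswap i n" if "i \<in> {1..<n}" for i
    using that conj_tswap[of ?s i n] by (simp add: tswap.rep_eq transpose_def)
  ultimately show ?thesis
    unfolding jm_def by (simp add: distrib_right sum_distrib_right sum_distrib_left perm_elt_mult)
qed

text \<open>The transposition moves n+1 and the outer factors come from S_n, so no permutation in
  the product lies in S_n.\<close>

lemma restr_swap_zero:
  assumes "u \<in> supported n" "v \<in> supported n" "n \<ge> 1"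
  shows "restr n (u * perm_elt (tswap n (Suc n)) * v) = 0"
  using assms(1)
proof (induction u rule: supported_induct)
  case (sg p c)
  from assms(2) show ?case
  proof (induction v rule: supported_induct)
    case (sg q d)
    have "p + tswap n (Suc n) + q \<notin> perms_le n"
    proof -
      have "tswap n (Suc n) \<notin> perms_le n"
        using perms_le_fix[of "tswap n (Suc n)" n "Suc n"] by (auto simp: tswap.rep_eq)
      then show ?thesis using sg \<open>p \<in> perms_le n\<close> by (simp add: perms_le_plus_iff1 perms_le_plus_iff2)
    qed
    then show ?case by (simp add: perm_elt_def mult_single restr_sg)
  qed (auto simp: distrib_left restr_add)
qed (auto simp: distrib_right restr_add)

text \<open>With s = (n+1 n+2), the permutation s q s fixes n+2 exactly when q fixes n+1, and in
  that case q commutes with s.\<close>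

lemma restr_swap_conj:
  assumes "w \<in> supported (Suc n)"
  shows "restr (Suc n) (perm_elt (tswap (Suc n) (Suc (Suc n))) * w * perm_elt (tswap (Suc n) (Suc (Suc n)))) = restr n w"
  using assms
proof (induction w rule: supported_induct)
  case (sg q c)
  let ?s = "tswap (Suc n) (Suc (Suc n))"
  have *: "?s + q + ?s \<in> perms_le (Suc n) \<longleftrightarrow> q \<in> perms_le n"
  proof
    assume "?s + q + ?s \<in> perms_le (Suc n)"
    then have "perm_fun (?s + q + ?s) (Suc (Suc n)) = Suc (Suc n)" by (rule perms_le_fix) simp
    then have "perm_fun q (Suc n) = Suc n"
      by (auto simp: plus_nperm.rep_eq tswap.rep_eq transpose_def split: if_splits)
    then show "q \<in> perms_le n" using sg perms_le_Suc_iff by blast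
  next
    assume "q \<in> perms_le n"
    then have "?s + q + ?s = q"
      using conj_tswap[of q "Suc n" "Suc (Suc n)"] perms_le_fix[of q n] by (simp add: add.assoc) (metis add.assoc tswap_tswap add.left_neutral)
    then show "?s + q + ?s \<in> perms_le (Suc n)" using sg by simp
  qed
  have "?s + q + ?s = q" if "q \<in> perms_le n"
      using that conj_tswap[of q "Suc n" "Suc (Suc n)"] perms_le_fix[of q n] by (simp add: add.assoc) (metis add.assoc tswap_tswap add.left_neutral)
  then show ?case using * by (auto simp: perm_elt_def mult_single restr_sg)
qed (auto simp: distrib_left distrib_right restr_add)

text \<open>Coefficientwise form of \<open>R (1 - A\<^sup>2) = s A s + A s A\<close> for the resolvents \<open>A = 1 / (z - a)\<close> and
  \<open>R = 1 / (z - b)\<close>, multiplied by \<open>(z - a)\<^sup>2\<close>.\<close>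

lemma hecke_identity:
  fixes a b s :: "'a :: ring_1"
  assumes bs: "b * s = s * a + 1" and ss: "s * s = 1" and ab: "a * b = b * a"
  shows "b ^ (k+2) - 2 * b ^ (k+1) * a + b ^ k * (a * a - 1) =
    s * a ^ (k+2) * s - 2 * (s * a ^ (k+1) * s * a) + s * a ^ k * s * (a * a)
     + a ^ (k+1) * s - a ^ k * s * a"
proof (induction k)
  case 0
  have sb: "s * b = a * s + 1"
  proof -
    have "s * b = s * (b * s) * s" using ss by (simp add: mult.assoc)
    also have "\<dots> = (s * s) * a * s + s * s" by (simp add: bs algebra_simps)
    finally show ?thesis by (simp add: ss)
  qed
  have b: "b = s * a * s + s"
    using bs ss by (metis distrib_right mult.assoc mult.left_neutral mult.right_neutral)
  have bb: "b * b = s * a * a * s + s * a + a * s + 1"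
  proof -
    have "b * b = s * a * (s * b) + s * b" by (subst b) (simp add: algebra_simps)
    also have "\<dots> = s * a * a * s + s * a + a * s + 1" by (simp add: sb algebra_simps)
    finally show ?thesis .
  qed
  have ba: "b * a = s * a * s * a + s * a" by (subst b) (simp add: algebra_simps)
  have ssx: "s * (s * x) = x" for x by (metis ss mult.assoc mult.left_neutral)
  show ?case by (simp add: power2_eq_square bb ba algebra_simps mult_2 mult_2_right ssx)
next
  case (Suc k)
  define A where "A = a ^ k"
  have Aa: "a * A = A * a" unfolding A_def by (rule power_commutes[symmetric])
  have Ab: "b * A = A * b" unfolding A_def by (metis ab power_commuting_commutes)
  have assoc: "a * (A * x) = A * (a * x)" "b * (A * x) = A * (b * x)" "b * (a * x) = a * (b * x)"
    "b * (s * x) = s * (a * x) + x" for x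
    using Aa Ab ab bs by (metis mult.assoc distrib_right mult.left_neutral)+
  have pow: "a ^ (k+2) = A * (a * a)" "a ^ (k+1) = A * a" "a ^ (Suc k + 2) = A * (a * (a * a))"
    "a ^ (Suc k + 1) = A * (a * a)" "a ^ Suc k = A * a" "a ^ k = A"
    unfolding A_def by (simp_all add: mult.assoc power_Suc2 del: power_Suc)
  \<comment> \<open>All powers of b stand on the left, so the step is multiplication by b from the
    left. Moving b past s by \<open>bs\<close> creates extra terms in which s occurs at most once;
    they cancel except for those that restore the last two summands.\<close>
  have "b ^ (Suc k+2) - 2 * b ^ (Suc k+1) * a + b ^ Suc k * (a * a - 1) =
    b * (b ^ (k+2) - 2 * b ^ (k+1) * a + b ^ k * (a * a - 1))"
    by (simp add: algebra_simps mult_2 mult_2_right)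
  also have "\<dots> = b * (s * a ^ (k+2) * s - 2 * (s * a ^ (k+1) * s * a) + s * a ^ k * s * (a * a)
     + a ^ (k+1) * s - a ^ k * s * a)" by (simp only: Suc.IH)
  also have "\<dots> = s * a ^ (Suc k+2) * s - 2 * (s * a ^ (Suc k+1) * s * a) + s * a ^ Suc k * s * (a * a)
     + a ^ (Suc k+1) * s - a ^ Suc k * s * a"
    unfolding pow
    by (simp add: mult.assoc distrib_left right_diff_distrib mult_2 assoc bs Aa Ab ab[symmetric])
  finally show ?case .
qed

section \<open>Plancherel growth of standard tableaux\<close>

lemma linear_factors_coeff:
  fixes c :: "'b \<Rightarrow> real"
  assumes "finite A"
  shows "degree (\<Prod>k\<in>A. [:c k, 1:]) = card A"
    and "coeff (\<Prod>k\<in>A. [:c k, 1:]) (card A) = 1"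
    and "A \<noteq> {} \<Longrightarrow> coeff (\<Prod>k\<in>A. [:c k, 1:]) (card A - 1) = (\<Sum>k\<in>A. c k)"
proof -
  have d: "degree (\<Prod>k\<in>A. [:c k, 1:]) = card A" if "finite A" for A
    by (subst degree_prod_eq_sum_degree) auto
  show "degree (\<Prod>k\<in>A. [:c k, 1:]) = card A" using d assms .
  have l: "coeff (\<Prod>k\<in>A. [:c k, 1:]) (card A) = 1" if "finite A" for A
    using lead_coeff_prod[of "\<lambda>k. [:c k, 1:]" A] d[OF that] by simp
  show "coeff (\<Prod>k\<in>A. [:c k, 1:]) (card A) = 1" using l assms .
  show "A \<noteq> {} \<Longrightarrow> coeff (\<Prod>k\<in>A. [:c k, 1:]) (card A - 1) = (\<Sum>k\<in>A. c k)"
    using assms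
  proof (induction A rule: finite_induct)
    case (insert a A)
    show ?case
    proof (cases "A = {}")
      case False
      then obtain m where m: "card A = Suc m" using insert by (metis card_0_eq not0_implies_Suc)
      show ?thesis
        using insert False l[of A] by (simp add: m)
    qed (use insert in auto)
  qed auto
qed

text \<open>The top coefficient of the interpolation formula. Equivalently, the residues of q(z)
  divided by the product of the z - x_k add up to the coefficient of 1/z at infinity.\<close>

lemma lagrange_top_coeff:
  fixes x :: "nat \<Rightarrow> real"
  assumes inj: "inj_on x {..N}" and deg: "degree q \<le> N"
  shows "(\<Sum>i\<le>N. poly q (x i) / (\<Prod>k\<in>{..N}-{i}. x i - x k)) = coeff q N"
proof -
  define P where "P i = (\<Prod>k\<in>{..N}-{i}. [:- x k, 1:])" for i
  define a where "a i = poly q (x i) / (\<Prod>k\<in>{..N}-{i}. x i - x k)" for i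
  have dP: "degree (P i) = N" "coeff (P i) N = 1" if "i \<le> N" for i
    using linear_factors_coeff(1,2)[of "{..N}-{i}" "\<lambda>k. - x k"] that by (auto simp: P_def)
  have pP: "poly (P i) (x j) = (if i = j then (\<Prod>k\<in>{..N}-{i}. x i - x k) else 0)"
    if "i \<le> N" "j \<le> N" for i j
    unfolding P_def using that by (auto simp: poly_prod intro!: prod_zero)
  have nz: "(\<Prod>k\<in>{..N}-{i}. x i - x k) \<noteq> 0" if "i \<le> N" for i
    using that inj by (auto simp: inj_on_def)
  have "q = (\<Sum>i\<le>N. smult (a i) (P i))"
  proof (rule poly_eqI_degree[where A = "x ` {..N}"])
    have c: "card (x ` {..N}) = Suc N" using card_image[OF inj] by simp
    show "degree q < card (x ` {..N})" using c deg by simp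
    have "degree (\<Sum>i\<le>N. smult (a i) (P i)) \<le> N"
      by (rule degree_sum_le) (use dP in \<open>auto intro!: order_trans[OF degree_smult_le]\<close>)
    then show "degree (\<Sum>i\<le>N. smult (a i) (P i)) < card (x ` {..N})" using c by simp
    fix z assume "z \<in> x ` {..N}"
    then obtain j where j: "j \<le> N" "z = x j" by auto
    have "poly (\<Sum>i\<le>N. smult (a i) (P i)) (x j) = (\<Sum>i\<le>N. if i = j then a i * (\<Prod>k\<in>{..N}-{i}. x i - x k) else 0)"
      unfolding poly_sum by (rule sum.cong) (use j pP in auto)
    also have "\<dots> = poly q (x j)" using j nz[of j] by (simp add: a_def)
    finally show "poly q z = poly (\<Sum>i\<le>N. smult (a i) (P i)) z" using j by simp
  qed
  then have "coeff q N = (\<Sum>i\<le>N. a i * coeff (P i) N)" by (metis (no_types, lifting) coeff_smult coeff_sum sum.cong)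
  also have "\<dots> = (\<Sum>i\<le>N. a i)" by (rule sum.cong) (use dP in auto)
  finally show ?thesis by (simp add: a_def)
qed

text \<open>Standard tableaux are encoded as words of row indices, most recent box first.\<close>

definition addable :: "nat list \<Rightarrow> nat \<Rightarrow> bool" where
  "addable T i \<longleftrightarrow> i = 0 \<or> count_list T i < count_list T (i - 1)"

primrec is_tableau :: "nat list \<Rightarrow> bool" where
  "is_tableau [] = True"
| "is_tableau (i # T) = (is_tableau T \<and> addable T i)"

definition tableaux :: "nat \<Rightarrow> nat list set" where "tableaux n = {T. length T = n \<and> is_tableau T}"

text \<open>The content of the next box of row i. For a tableau these numbers decrease strictly in
  i, and they are the only possible poles of the rational function behind the transition
  weights.\<close>

definition rowc :: "nat list \<Rightarrow> nat \<Rightarrow> real" where "rowc T i = real (count_list T i) - real i"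

text \<open>The factor \<open>rowc T i + N\<close> accounts for all rows from \<open>N\<close> on; for this it is needed that they
  are empty.\<close>

definition trans_wt :: "nat \<Rightarrow> nat list \<Rightarrow> nat \<Rightarrow> real" where
  "trans_wt N T i = (\<Prod>k\<in>{..<N}-{i}. (rowc T i + 1 - rowc T k) / (rowc T i - rowc T k)) / (rowc T i + real N)"

text \<open>For N at least the number n of boxes, this is the dimension of the shape divided by n!,
  the reciprocal of the hook product, and so the same for all tableaux of one shape.\<close>

primrec planch :: "nat \<Rightarrow> nat list \<Rightarrow> real" where
  "planch N [] = 1"
| "planch N (i # T) = planch N T * trans_wt N T i"

lemma is_tableau_antimono: "is_tableau T \<Longrightarrow> count_list T (Suc i) \<le> count_list T i"
  by (induction T) (auto simp: addable_def le_Suc_eq)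

lemma is_tableau_antimono_le: "is_tableau T \<Longrightarrow> i \<le> k \<Longrightarrow> count_list T k \<le> count_list T i"
  by (induction k) (auto simp: le_Suc_eq intro: order_trans is_tableau_antimono)

lemma rowc_less: "is_tableau T \<Longrightarrow> i < k \<Longrightarrow> rowc T k < rowc T i"
  using is_tableau_antimono_le[of T i k] by (simp add: rowc_def)

lemma rowc_inj: "is_tableau T \<Longrightarrow> rowc T i = rowc T k \<longleftrightarrow> i = k"
  using rowc_less[of T i k] rowc_less[of T k i] by (cases i k rule: linorder_cases) auto

lemma addable_le_length: "addable T i \<Longrightarrow> \<forall>j\<in>set T. j < length T \<Longrightarrow> i \<le> length T"
proof (cases i)
  case (Suc j)
  assume "addable T i" "\<forall>j\<in>set T. j < length T"
  then have "j \<in> set T" using Suc count_notin[of j T] by (cases "j \<in> set T") (auto simp: addable_def)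
  then show ?thesis using Suc \<open>\<forall>j\<in>set T. j < length T\<close> by auto
qed simp

lemma is_tableau_less_length: "is_tableau T \<Longrightarrow> i \<in> set T \<Longrightarrow> i < length T"
  by (induction T arbitrary: i) (auto dest!: addable_le_length simp: less_Suc_eq_le less_imp_le)

lemma tableaux_0: "tableaux 0 = {[]}" unfolding tableaux_def by auto

lemma tableaux_Suc_addable_le: "T \<in> tableaux n \<Longrightarrow> addable T i \<Longrightarrow> i \<le> n"
  unfolding tableaux_def using addable_le_length[of T i] is_tableau_less_length by blast

lemma tableaux_Suc: "tableaux (Suc n) = (\<lambda>(T, i). i # T) ` (SIGMA T:tableaux n. {i. i \<le> n \<and> addable T i})"
proof -
  have "U \<in> tableaux (Suc n) \<longleftrightarrow> (\<exists>T i. U = i # T \<and> T \<in> tableaux n \<and> addable T i)" for U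
    by (cases U) (auto simp: tableaux_def)
  then show ?thesis using tableaux_Suc_addable_le by (auto simp: image_def)
qed

lemma finite_tableaux: "finite (tableaux n)"
  by (induction n) (auto simp: tableaux_0 tableaux_Suc)

lemma sum_tableaux_Suc:
  "(\<Sum>U\<in>tableaux (Suc n). F U) = (\<Sum>T\<in>tableaux n. \<Sum>i\<in>{i. i \<le> n \<and> addable T i}. F (i # T))"
  unfolding tableaux_Suc
  by (subst sum.reindex) (auto simp: inj_on_def sum.Sigma[OF finite_tableaux] split_def)

text \<open>If row i is as long as row i - 1, the numerator for k = i - 1 vanishes. Sums over
  addable rows may therefore run over all i < N.\<close>

lemma trans_wt_not_addable:
  assumes "is_tableau T" "\<not> addable T i" "i < N"
  shows "trans_wt N T i = 0"
proof -
  from assms obtain j where j: "i = Suc j" by (cases i) (auto simp: addable_def)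
  with assms have "count_list T i = count_list T j"
    using is_tableau_antimono[of T j] by (auto simp: addable_def)
  then have "rowc T i + 1 - rowc T j = 0" using j by (simp add: rowc_def)
  then have "(\<Prod>k\<in>{..<N}-{i}. (rowc T i + 1 - rowc T k) / (rowc T i - rowc T k)) = 0"
    using j assms by (intro prod_zero) auto
  then show ?thesis by (simp add: trans_wt_def)
qed

lemma sum_tableaux_Suc_trans_wt:
  assumes "n < N"
  shows "(\<Sum>U\<in>tableaux (Suc n). planch N U * F U) = (\<Sum>T\<in>tableaux n. planch N T * (\<Sum>i<N. trans_wt N T i * F (i # T)))"
proof -
  have "(\<Sum>i\<in>{i. i \<le> n \<and> addable T i}. planch N (i # T) * F (i # T)) = planch N T * (\<Sum>i<N. trans_wt N T i * F (i # T))"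
    if "T \<in> tableaux n" for T
  proof -
    have "(\<Sum>i<N. trans_wt N T i * F (i # T)) = (\<Sum>i\<in>{i. i \<le> n \<and> addable T i}. trans_wt N T i * F (i # T))"
    proof (rule sum.mono_neutral_right)
      show "{i. i \<le> n \<and> addable T i} \<subseteq> {..<N}" using assms by auto
      have "trans_wt N T i = 0" if "i < N" "\<not> (i \<le> n \<and> addable T i)" for i
        using that tableaux_Suc_addable_le[OF \<open>T \<in> tableaux n\<close>, of i] trans_wt_not_addable[of T i N] \<open>T \<in> tableaux n\<close>
        by (auto simp: tableaux_def)
      then show "\<forall>i\<in>{..<N} - {i. i \<le> n \<and> addable T i}. trans_wt N T i * F (i # T) = 0" by auto
    qed simp
    then show ?thesis by (simp add: sum_distrib_left mult.assoc)
  qed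
  then show ?thesis by (simp add: sum_tableaux_Suc)
qed

text \<open>The weights are residues of q / D with the polynomials defined below. The expansion of q
  / D at infinity starts with 1/z and has no z^-2 term; this gives both sums, which are the initial
  values of the two-step recursion for the moments.\<close>

lemma trans_wt_moments:
  assumes T: "T \<in> tableaux n" and nN: "n < N"
  shows "(\<Sum>i<N. trans_wt N T i) = 1" "(\<Sum>i<N. trans_wt N T i * rowc T i) = 0"
proof -
  have is_tableau: "is_tableau T" and len: "length T = n" using T by (auto simp: tableaux_def)
  have z: "count_list T i = 0" if "i \<ge> n" for i
    using is_tableau_less_length[OF is_tableau, of i] that len by (auto simp: count_list_0_iff)
  define x where "x = rowc T"
  have xN: "x N = - real N" using z[of N] nN by (simp add: x_def rowc_def)
  obtain M where M: "N = Suc M" using nN by (cases N) auto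
  have xM: "x M = - real M" using z[of M] nN M by (simp add: x_def rowc_def)
  have inj: "inj_on x {..N}" using rowc_inj[OF is_tableau] by (auto simp: inj_on_def x_def)
  define q where "q = (\<Prod>k<N. [:1 - x k, 1:])"
  define D where "D = (\<Prod>k\<le>N. [:- x k, 1:])"
  have q: "degree q = N" "coeff q N = 1" "coeff q M = (\<Sum>k<N. 1 - x k)"
    using linear_factors_coeff[of "{..<N}" "\<lambda>k. 1 - x k"] M by (auto simp: q_def lessThan_empty_iff)
  have D: "degree D = Suc N" "coeff D (Suc N) = 1" "coeff D N = (\<Sum>k\<le>N. - x k)"
    using linear_factors_coeff[of "{..N}" "\<lambda>k. - x k"] by (auto simp: D_def)
  have pq: "poly q z = (\<Prod>k<N. z + 1 - x k)" for z
    by (simp add: q_def poly_prod algebra_simps)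
  have pD: "poly D (x i) = 0" if "i \<le> N" for i
    using that by (auto simp: D_def poly_prod intro!: prod_zero)
  \<comment> \<open>Row N - 1 is empty because n < N, so its factor of \<open>q\<close> vanishes at
    \<open>x N\<close>. The extra node has residue 0, and only the rows with index below N
    contribute.\<close>
  have qN: "poly q (x N) = 0"
    unfolding pq using M xM xN by (intro prod_zero bexI[of _ M]) auto
  have trans_wt: "poly q (x i) / (\<Prod>k\<in>{..N}-{i}. x i - x k) = trans_wt N T i" if "i < N" for i
  proof -
    have "{..N}-{i} = insert N ({..<N}-{i})" using that by auto
    then have "(\<Prod>k\<in>{..N}-{i}. x i - x k) = (x i - x N) * (\<Prod>k\<in>{..<N}-{i}. x i - x k)" by simp
    moreover have "poly q (x i) = (\<Prod>k\<in>{..<N}-{i}. x i + 1 - x k)"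
      unfolding pq using that by (subst prod.remove[of _ i]) auto
    ultimately show ?thesis using xN by (simp add: trans_wt_def prod_dividef x_def)
  qed
  \<comment> \<open>\<open>D\<close> vanishes at every node, so subtracting a multiple of it leaves
    the left side unchanged; its purpose is to lower the degree of \<open>q * r\<close> to
    N.\<close>
  have key: "(\<Sum>i<N. trans_wt N T i * poly r (x i)) = coeff (q * r - smult c D) N"
    if "degree (q * r - smult c D) \<le> N" for r c
  proof -
    have "coeff (q * r - smult c D) N =
      (\<Sum>i\<le>N. poly (q * r - smult c D) (x i) / (\<Prod>k\<in>{..N}-{i}. x i - x k))"
      using lagrange_top_coeff[OF inj that] by simp
    also have "\<dots> = (\<Sum>i<Suc N. poly (q * r - smult c D) (x i) / (\<Prod>k\<in>{..N}-{i}. x i - x k))"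
      by (simp only: lessThan_Suc_atMost)
    also have "\<dots> = (\<Sum>i<N. poly (q * r - smult c D) (x i) / (\<Prod>k\<in>{..N}-{i}. x i - x k))"
      using qN pD[of N] by simp
    also have "\<dots> = (\<Sum>i<N. trans_wt N T i * poly r (x i))"
    proof (rule sum.cong)
      fix i assume "i \<in> {..<N}"
      then have i: "i < N" by simp
      show "poly (q * r - smult c D) (x i) / (\<Prod>k\<in>{..N}-{i}. x i - x k) = trans_wt N T i * poly r (x i)"
        unfolding trans_wt[OF i, symmetric] using pD[of i] i by simp
    qed simp
    finally show ?thesis by simp
  qed
  show "(\<Sum>i<N. trans_wt N T i) = 1" using key[of 1 0] q by simp
  have "degree (q * [:0, 1:] - smult 1 D) \<le> N"
  proof (rule degree_le, intro allI impI)
    fix j assume j: "N < j"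
    then obtain j' where j': "j = Suc j'" "N \<le> j'" by (cases j) auto
    show "coeff (q * [:0, 1:] - smult 1 D) j = 0"
    proof (cases "j' = N")
      case False
      then show ?thesis using j' q(1) D(1) by (simp add: coeff_eq_0)
    qed (use q D j' in simp)
  qed
  from key[OF this] have "(\<Sum>i<N. trans_wt N T i * x i) = coeff q M - coeff D N" by (simp add: M)
  also have "\<dots> = 0"
  proof -
    have "(\<Sum>k\<le>N. - x k) = (\<Sum>k<N. - x k) - x N" by (simp add: lessThan_Suc_atMost[symmetric])
    then show ?thesis using q D xN by (simp add: sum_subtractf sum_negf)
  qed
  finally show "(\<Sum>i<N. trans_wt N T i * rowc T i) = 0" by (simp add: x_def)
qed

text \<open>A new box of content c multiplies the rational function by (z - c)^2 / ((z - c)^2 - 1),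
  and residues are compared row by row. At i = r, where the node moves from c to c + 1, both sides
  are 0.\<close>

lemma trans_wt_Cons_recursion:
  assumes "is_tableau T" "addable T r" "r < N" "i < N"
  defines "c \<equiv> rowc T r"
  shows "trans_wt N (r # T) i * ((rowc (r # T) i - c)\<^sup>2 - 1) * rowc (r # T) i ^ k
       = trans_wt N T i * (rowc T i - c)\<^sup>2 * rowc T i ^ k"
proof (cases "i = r")
  case False
  define R where "R = (\<Prod>k\<in>{..<N}-{i}-{r}. (rowc T i + 1 - rowc T k) / (rowc T i - rowc T k)) / (rowc T i + real N)"
  have ys: "rowc (r # T) k = (if k = r then c + 1 else rowc T k)" for k
    by (auto simp: rowc_def c_def)
  have r: "r \<in> {..<N}-{i}" using False assms by auto
  have "(\<Prod>k\<in>{..<N}-{i}-{r}. (rowc (r # T) i + 1 - rowc (r # T) k) / (rowc (r # T) i - rowc (r # T) k)) =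
        (\<Prod>k\<in>{..<N}-{i}-{r}. (rowc T i + 1 - rowc T k) / (rowc T i - rowc T k))"
    by (rule prod.cong) (use False in \<open>auto simp: ys\<close>)
  then have 1: "trans_wt N (r # T) i = R * ((rowc T i - c) / (rowc T i - c - 1))"
    unfolding trans_wt_def R_def prod.remove[OF finite_Diff[OF finite_lessThan] r]
    using False by (simp add: ys diff_diff_eq ac_simps)
  have 2: "trans_wt N T i = R * ((rowc T i + 1 - c) / (rowc T i - c))"
    unfolding trans_wt_def R_def prod.remove[OF finite_Diff[OF finite_lessThan] r]
    by (simp add: c_def mult.commute)
  have d: "rowc T i - c \<noteq> 0" using rowc_inj[OF assms(1), of i r] False by (simp add: c_def)
  have "is_tableau (r # T)" using assms by simp
  then have d1: "rowc T i - c - 1 \<noteq> 0" using rowc_inj[of "r # T" i r] False by (simp add: ys)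
  define d where "d = rowc T i - c"
  have "R * (d / (d - 1)) * (d\<^sup>2 - 1) = R * ((d + 1) / d) * d\<^sup>2"
  proof -
    have "d \<noteq> 0" "d - 1 \<noteq> 0" using d d1 by (auto simp: d_def)
    then show ?thesis by (simp add: field_simps power2_eq_square)
  qed
  then show ?thesis unfolding 1 2 using False by (simp add: ys d_def algebra_simps)
qed (auto simp: rowc_def c_def)

section \<open>Deleting the first row\<close>

definition lower_rows :: "nat list \<Rightarrow> nat list" where "lower_rows T = map (\<lambda>i. i - 1) (filter (\<lambda>i. i \<noteq> 0) T)"

lemma lower_rows_simps [simp]: "lower_rows [] = []" "lower_rows (0 # T) = lower_rows T" "lower_rows (Suc i # T) = i # lower_rows T"
  by (auto simp: lower_rows_def)

lemma count_lower_rows: "count_list (lower_rows T) i = count_list T (Suc i)"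
proof (induction T)
  case (Cons a T)
  then show ?case by (cases a) auto
qed auto

lemma is_tableau_lower_rows: "is_tableau T \<Longrightarrow> is_tableau (lower_rows T)"
proof (induction T)
  case (Cons a T)
  then show ?case
    by (cases a; cases "a - 1") (auto simp: addable_def count_lower_rows)
qed auto

lemma length_lower_rows: "count_list T 0 + length (lower_rows T) = length T"
proof (induction T)
  case (Cons a T)
  then show ?case by (cases a) auto
qed auto

lemma cancel_ratio: "P \<noteq> 0 \<Longrightarrow> A * P / F * (P' / P / d) = A * P' / (d * F)"
  for A P P' F d :: real
  by (cases "F = 0"; cases "d = 0") (simp_all add: divide_simps)

text \<open>One row of Frobenius' formula: with l_i = \<open>rowc T i\<close> + M the weight is the
  product of l_i - l_k over i < k, divided by the product of the l_i!. A step in the first row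
  changes only the factors that contain l_0. A lower step keeps the differences among lower rows;
  deleting the first row shifts their contents by one, and the passage from \<open>Suc M\<close> to
  \<open>M\<close> compensates for this.\<close>

lemma planch_lower_rows:
  assumes "is_tableau T" "length T \<le> Suc M"
  shows "planch (Suc M) T = planch M (lower_rows T) *
    (\<Prod>k\<in>{1..M}. rowc T 0 - rowc T k) / fact (count_list T 0 + M)"
  using assms
proof (induction T)
  case Nil
  have "(\<Prod>k\<in>{1..M}. real k) = fact M" by (simp add: fact_prod)
  then show ?case by (simp add: rowc_def)
next
  case (Cons a T)
  then have is_tableau: "is_tableau T" and add: "addable T a" and len: "length T \<le> M" by auto
  have IH: "planch (Suc M) T = planch M (lower_rows T) *
    (\<Prod>k\<in>{1..M}. rowc T 0 - rowc T k) / fact (count_list T 0 + M)"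
    using Cons by simp
  have ys: "rowc (a # T) k = (if k = a then rowc T a + 1 else rowc T k)" for k
    by (auto simp: rowc_def)
  show ?case
  proof (cases a)
    case 0
    have I: "{..<Suc M} - {0} = {1..M}" by auto
    define P where "P = (\<Prod>k\<in>{1..M}. rowc T 0 - rowc T k)"
    define P' where "P' = (\<Prod>k\<in>{1..M}. rowc T 0 + 1 - rowc T k)"
    have nz: "P \<noteq> 0" using rowc_inj[OF is_tableau] by (auto simp: P_def)
    have 1: "(\<Prod>k\<in>{1..M}. rowc (a # T) 0 - rowc (a # T) k) = P'"
      unfolding P'_def by (rule prod.cong) (auto simp: ys[unfolded 0] 0)
    have 2: "trans_wt (Suc M) T 0 = P' / P / real (Suc (count_list T 0 + M))"
      unfolding trans_wt_def I prod_dividef P_def P'_def by (simp add: rowc_def algebra_simps)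
    have "planch (Suc M) (a # T) = planch M (lower_rows T) * P / fact (count_list T 0 + M) * (P' / P / real (Suc (count_list T 0 + M)))"
      using IH by (simp add: 0 2 P_def)
    also have "\<dots> = planch M (lower_rows T) * P' / fact (Suc (count_list T 0 + M))"
      unfolding fact_Suc by (rule cancel_ratio[OF nz])
    finally show ?thesis unfolding 1 by (simp add: 0)
  next
    case (Suc i)
    have "\<forall>j\<in>set T. j < length T" using is_tableau_less_length[OF is_tableau] by blast
    with addable_le_length[OF add] have i: "i < M" using len Suc by simp
    have yr: "rowc (lower_rows T) k = rowc T (Suc k) + 1" for k by (simp add: rowc_def count_lower_rows)
    have e: "{..<Suc M} - {Suc i} = insert 0 (Suc ` ({..<M} - {i}))"
      unfolding lessThan_Suc_eq_insert_0 by auto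
    have trans_wt: "trans_wt (Suc M) T (Suc i) = (rowc T (Suc i) + 1 - rowc T 0) / (rowc T (Suc i) - rowc T 0) * trans_wt M (lower_rows T) i"
    proof -
      have "(\<Prod>k\<in>insert 0 (Suc ` ({..<M} - {i})). (rowc T (Suc i) + 1 - rowc T k) / (rowc T (Suc i) - rowc T k)) =
        (rowc T (Suc i) + 1 - rowc T 0) / (rowc T (Suc i) - rowc T 0) *
        (\<Prod>k\<in>{..<M} - {i}. (rowc (lower_rows T) i + 1 - rowc (lower_rows T) k) / (rowc (lower_rows T) i - rowc (lower_rows T) k))"
      proof -
        have eqs: "rowc (lower_rows T) i + 1 - rowc (lower_rows T) k = rowc T (Suc i) + 1 - rowc T (Suc k)"
          "rowc (lower_rows T) i - rowc (lower_rows T) k = rowc T (Suc i) - rowc T (Suc k)" for k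
          by (simp_all add: yr)
        show ?thesis unfolding eqs by (simp add: prod.reindex)
      qed
      moreover have "rowc T (Suc i) + real (Suc M) = rowc (lower_rows T) i + real M" by (simp add: yr)
      ultimately show ?thesis unfolding trans_wt_def e by (simp only: times_divide_eq_right)
    qed
    have "Suc i \<in> {1..M}" using i by auto
    then have P: "(\<Prod>k\<in>{1..M}. rowc U 0 - rowc U k) = (rowc U 0 - rowc U (Suc i)) * (\<Prod>k\<in>{1..M}-{Suc i}. rowc U 0 - rowc U k)" for U
      by (rule prod.remove[OF finite_atLeastAtMost])
    have Q: "(\<Prod>k\<in>{1..M}-{Suc i}. rowc (a # T) 0 - rowc (a # T) k) = (\<Prod>k\<in>{1..M}-{Suc i}. rowc T 0 - rowc T k)"
      by (rule prod.cong) (auto simp: ys[unfolded Suc] Suc)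
    have nz: "rowc T 0 - rowc T (Suc i) \<noteq> 0" using rowc_inj[OF is_tableau] by simp
    have f: "(rowc T (Suc i) + 1 - rowc T 0) / (rowc T (Suc i) - rowc T 0) * (rowc T 0 - rowc T (Suc i)) = rowc T 0 - (rowc T (Suc i) + 1)"
      using nz by (simp add: field_simps)
    define R where "R = (\<Prod>k\<in>{1..M}-{Suc i}. rowc T 0 - rowc T k)"
    have "planch (Suc M) (a # T) = planch M (lower_rows T) * ((rowc T 0 - rowc T (Suc i)) * R) / fact (count_list T 0 + M) *
       ((rowc T (Suc i) + 1 - rowc T 0) / (rowc T (Suc i) - rowc T 0) * trans_wt M (lower_rows T) i)"
      unfolding planch.simps(2) Suc trans_wt IH P R_def ..
    also have "\<dots> = planch M (lower_rows T) * trans_wt M (lower_rows T) i *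
      (((rowc T (Suc i) + 1 - rowc T 0) / (rowc T (Suc i) - rowc T 0) * (rowc T 0 - rowc T (Suc i))) * R) / fact (count_list T 0 + M)"
      by (simp only: mult_ac times_divide_eq_left times_divide_eq_right divide_divide_eq_left)
    also have "\<dots> = planch M (lower_rows T) * trans_wt M (lower_rows T) i * ((rowc T 0 - (rowc T (Suc i) + 1)) * R) / fact (count_list T 0 + M)"
      unfolding f ..
    also have "rowc T 0 - (rowc T (Suc i) + 1) = rowc (a # T) 0 - rowc (a # T) (Suc i)"
      unfolding Suc by (simp add: ys[unfolded Suc])
    finally show ?thesis unfolding P Q R_def by (simp add: Suc)
  qed
qed

lemma trans_wt_nonneg:
  assumes "is_tableau T" "addable T i" "i < N"
  shows "trans_wt N T i \<ge> 0"
  unfolding trans_wt_def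
proof (rule divide_nonneg_nonneg, rule prod_nonneg)
  fix k assume k: "k \<in> {..<N} - {i}"
  have "is_tableau (i # T)" using assms by simp
  then have i: "rowc (i # T) i \<noteq> rowc (i # T) k" using rowc_inj k by auto
  show "(rowc T i + 1 - rowc T k) / (rowc T i - rowc T k) \<ge> 0"
  proof (cases i k rule: linorder_cases)
    case less
    then show ?thesis using rowc_less[OF assms(1) less] by simp
  next
    case greater
    have "rowc (i # T) i < rowc (i # T) k" using rowc_less[OF \<open>is_tableau (i # T)\<close> greater] .
    then show ?thesis using rowc_less[OF assms(1) greater] greater
      by (simp add: rowc_def divide_nonpos_nonpos)
  qed (use k in auto)
next
  show "0 \<le> rowc T i + real N" using assms by (simp add: rowc_def)
qed

lemma planch_nonneg: "is_tableau T \<Longrightarrow> length T \<le> N \<Longrightarrow> planch N T \<ge> 0"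
proof (induction T)
  case (Cons i T)
  then have "i < N" using addable_le_length[of T i] is_tableau_less_length[of T] by fastforce
  then show ?case using Cons by (auto intro!: mult_nonneg_nonneg trans_wt_nonneg)
qed auto

lemma sum_planch: "m \<le> N \<Longrightarrow> (\<Sum>T\<in>tableaux m. planch N T) = 1"
proof (induction m)
  case (Suc m)
  then show ?case
    using sum_tableaux_Suc_trans_wt[of m N "\<lambda>_. 1"] trans_wt_moments(1)[of _ m N] by simp
qed (simp add: tableaux_0)

text \<open>Row lengths are non-negative, so \<open>rowc T 0 - rowc T k\<close> is at most
  \<lambda>_1 + k for the first row length \<lambda>_1. The product of these bounds is (\<lambda>_1
  + M)! / \<lambda>_1!.\<close>

lemma planch_le:
  assumes "is_tableau T" "length T \<le> Suc M"
  shows "planch (Suc M) T \<le> planch M (lower_rows T) / fact (count_list T 0)"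
proof (cases "T = []")
  case False
  then have "count_list T (hd T) \<noteq> 0" by (simp add: count_list_0_iff)
  then have "count_list T 0 \<noteq> 0" using is_tableau_antimono_le[OF assms(1), of 0 "hd T"] by simp
  then have len: "length (lower_rows T) \<le> M" using assms length_lower_rows[of T] by simp
  have "(\<Prod>k\<in>{1..M}. rowc T 0 - rowc T k) \<le> (\<Prod>k\<in>{1..M}. real (count_list T 0 + k))"
    by (rule prod_mono) (use rowc_less[OF assms(1), of 0] in \<open>auto simp: rowc_def less_imp_le\<close>)
  also have "\<dots> = fact (count_list T 0 + M) / fact (count_list T 0)"
    by (induction M) (auto simp: field_simps)
  finally have "(\<Prod>k\<in>{1..M}. rowc T 0 - rowc T k) / fact (count_list T 0 + M) \<le> 1 / fact (count_list T 0)"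
    by (simp add: field_simps)
  from mult_left_mono[OF this planch_nonneg[OF is_tableau_lower_rows[OF assms(1)] len]]
  show ?thesis using planch_lower_rows[OF assms] by simp
qed simp

section \<open>Grouping tableaux by the times of the steps below the first row\<close>

lemma bools_lower_rows_inj: "map (\<lambda>i. i \<noteq> 0) T = map (\<lambda>i. i \<noteq> 0) U \<Longrightarrow> lower_rows T = lower_rows U \<Longrightarrow> T = U"
proof (induction T arbitrary: U)
  case (Cons a T)
  then obtain b U' where U: "U = b # U'" by (cases U) auto
  then show ?case using Cons by (cases a; cases b) auto
qed auto

lemma length_lower_rows_bools: "length (lower_rows T) = count_list (map (\<lambda>i. i \<noteq> 0) T) True"
proof (induction T)
  case (Cons a T)
  then show ?case by (cases a) auto
qed auto

lemma count_bools_False: "count_list T 0 = count_list (map (\<lambda>i. i \<noteq> 0) T) False"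
  by (induction T) auto

definition bool_lists :: "nat \<Rightarrow> bool list set" where "bool_lists n = {bs. length bs = n}"

lemma finite_bool_lists: "finite (bool_lists n)"
  unfolding bool_lists_def using finite_lists_length_eq[of "UNIV :: bool set" n] by simp

text \<open>A tableau is determined by its pattern and its lower rows. For a fixed pattern the bound
  of \<open>planch_le\<close> is summed over all tableaux of the size of the lower rows, and their
  weights add up to 1.\<close>

lemma sum_planch_le_sum_bools:
  fixes G :: "nat list \<Rightarrow> real" and u :: "bool list \<Rightarrow> real"
  assumes G: "\<And>T. T \<in> tableaux n \<Longrightarrow> G T \<le> u (map (\<lambda>i. i \<noteq> 0) T)"
    and u: "\<And>bs. u bs \<ge> 0"
  shows "(\<Sum>T\<in>tableaux n. planch (Suc n) T * G T) \<le> (\<Sum>bs\<in>bool_lists n. u bs / fact (count_list bs False))"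
proof -
  let ?b = "map (\<lambda>i::nat. i \<noteq> 0)"
  let ?h = "\<lambda>(bs, T'). planch n T' * (u bs / fact (count_list bs False))"
  let ?S = "SIGMA bs:bool_lists n. tableaux (count_list bs True)"
  have cl: "count_list bs True \<le> n" if "bs \<in> bool_lists n" for bs
    using that count_le_length[of bs True] by (simp add: bool_lists_def)
  have "(\<Sum>T\<in>tableaux n. planch (Suc n) T * G T) \<le> (\<Sum>T\<in>tableaux n. ?h (?b T, lower_rows T))"
  proof (rule sum_mono)
    fix T assume T: "T \<in> tableaux n"
    then have y: "is_tableau T" "length T = n" by (auto simp: tableaux_def)
    have "planch (Suc n) T * G T \<le> planch (Suc n) T * u (?b T)"
      using G[OF T] planch_nonneg[OF y(1), of "Suc n"] y by (intro mult_left_mono) auto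
    also have "\<dots> \<le> planch n (lower_rows T) / fact (count_list T 0) * u (?b T)"
      using planch_le[OF y(1), of n] y u by (intro mult_right_mono) auto
    finally show "planch (Suc n) T * G T \<le> ?h (?b T, lower_rows T)" by (simp add: count_bools_False)
  qed
  also have "\<dots> = (\<Sum>z\<in>(\<lambda>T. (?b T, lower_rows T)) ` tableaux n. ?h z)"
    by (subst sum.reindex) (auto simp: inj_on_def intro: bools_lower_rows_inj)
  also have "\<dots> \<le> (\<Sum>z\<in>?S. ?h z)"
  proof (rule sum_mono2)
    show "finite ?S" using finite_bool_lists finite_tableaux by auto
    show "(\<lambda>T. (?b T, lower_rows T)) ` tableaux n \<subseteq> ?S"
      by (auto simp: tableaux_def bool_lists_def is_tableau_lower_rows length_lower_rows_bools)
    fix z assume "z \<in> ?S - (\<lambda>T. (?b T, lower_rows T)) ` tableaux n"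
    then obtain bs T' where z: "z = (bs, T')" "bs \<in> bool_lists n" "T' \<in> tableaux (count_list bs True)" by auto
    then have "planch n T' \<ge> 0" using cl[of bs] by (intro planch_nonneg) (auto simp: tableaux_def)
    then show "0 \<le> ?h z" using z u by simp
  qed
  also have "\<dots> = (\<Sum>bs\<in>bool_lists n. \<Sum>T'\<in>tableaux (count_list bs True). ?h (bs, T'))"
    using finite_bool_lists finite_tableaux by (subst sum.Sigma) (auto simp: split_def)
  also have "\<dots> = (\<Sum>bs\<in>bool_lists n. u bs / fact (count_list bs False))"
    using sum_planch[OF cl] by (intro sum.cong) (auto simp: sum_distrib_right[symmetric] sum_divide_distrib[symmetric])
  finally show ?thesis .
qed

section \<open>Spectral law of the Jucys--Murphy elements\<close>

text \<open>\<open>repr n x f\<close>: \<open>x\<close> is a polynomial in \<open>J\<^sub>1, \<dots>, J\<^sub>n\<close> and \<open>f\<close> is the same polynomial as a function of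
  the values of \<open>J\<^sub>n, \<dots>, J\<^sub>1\<close>, in this order.\<close>

inductive repr :: "nat \<Rightarrow> galg \<Rightarrow> (real list \<Rightarrow> real) \<Rightarrow> bool" where
  repr_const: "repr n (scal c) (\<lambda>_. c)"
| repr_lift: "repr n x f \<Longrightarrow> repr (Suc n) x (\<lambda>cs. f (tl cs))"
| repr_jm: "repr (Suc n) (jm (Suc n)) hd"
| repr_add: "repr n x f \<Longrightarrow> repr n y h \<Longrightarrow> repr n (x + y) (\<lambda>cs. f cs + h cs)"
| repr_mult: "repr n x f \<Longrightarrow> repr n y h \<Longrightarrow> repr n (x * y) (\<lambda>cs. f cs * h cs)"
| repr_cong: "repr n x f \<Longrightarrow> (\<And>cs. length cs = n \<Longrightarrow> f cs = h cs) \<Longrightarrow> repr n x h"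

lemma repr_supported: "repr n x f \<Longrightarrow> x \<in> supported n"
  by (induction rule: repr.induct) (auto intro: supported_scal jm_supported supported_add supported_mult supported_mono[rotated])

lemma repr_0: "repr n x f \<Longrightarrow> n = 0 \<Longrightarrow> x = scal (f [])"
  by (induction rule: repr.induct) (auto simp: scal_add scal_mult)

lemma repr_power: "repr n x f \<Longrightarrow> repr n (x ^ k) (\<lambda>cs. f cs ^ k)"
proof (induction k)
  case 0
  then show ?case using repr_const[of n 1] by simp
next
  case (Suc k)
  then show ?case using repr_mult[of n x f "x ^ k" "\<lambda>cs. f cs ^ k"] by simp
qed

lemma repr_scale: "repr n x f \<Longrightarrow> repr n (scal c * x) (\<lambda>cs. c * f cs)"
  by (rule repr_mult[OF repr_const])

lemma repr_diff: "repr n x f \<Longrightarrow> repr n y h \<Longrightarrow> repr n (x - y) (\<lambda>cs. f cs - h cs)"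
proof -
  assume a: "repr n x f" "repr n y h"
  have "x + scal (-1) * y = x - y"
    unfolding scal_def by (simp add: single_uminus)
  then show "repr n (x - y) (\<lambda>cs. f cs - h cs)"
    using repr_add[OF a(1) repr_scale[OF a(2), of "-1"]] by simp
qed

lemma repr_sum:
  assumes "finite I" "\<And>i. i \<in> I \<Longrightarrow> \<exists>x. repr n x (f i)"
  shows "\<exists>x. repr n x (\<lambda>cs. \<Sum>i\<in>I. f i cs)"
  using assms
proof (induction I rule: finite_induct)
  case empty
  then show ?case using repr_const[of n 0] by auto
next
  case (insert i I)
  then obtain x y where "repr n x (f i)" "repr n y (\<lambda>cs. \<Sum>i\<in>I. f i cs)" by blast
  from repr_add[OF this] show ?case using insert by auto
qed

lemma repr_prod:
  assumes "finite I" "\<And>i. i \<in> I \<Longrightarrow> \<exists>x. repr n x (f i)"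
  shows "\<exists>x. repr n x (\<lambda>cs. \<Prod>i\<in>I. f i cs)"
  using assms
proof (induction I rule: finite_induct)
  case empty
  then show ?case using repr_const[of n 1] by auto
next
  case (insert i I)
  then obtain x y where "repr n x (f i)" "repr n y (\<lambda>cs. \<Prod>i\<in>I. f i cs)" by blast
  from repr_mult[OF this] show ?case using insert by auto
qed

text \<open>Sums of y J_(n+1)^i with y a polynomial in the earlier elements. On such a term the
  conditional expectation takes y out, so only pure powers of J_(n+1) have to be averaged.\<close>

inductive normform :: "nat \<Rightarrow> galg \<Rightarrow> (real list \<Rightarrow> real) \<Rightarrow> bool" for n where
  normform_mono: "repr n y f \<Longrightarrow> normform n (y * jm (Suc n) ^ i) (\<lambda>cs. f (tl cs) * hd cs ^ i)"
| normform_add: "normform n x f \<Longrightarrow> normform n y h \<Longrightarrow> normform n (x + y) (\<lambda>cs. f cs + h cs)"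
| normform_cong: "normform n x f \<Longrightarrow> (\<And>cs. length cs = Suc n \<Longrightarrow> f cs = h cs) \<Longrightarrow> normform n x h"

lemma normform_mult_mono:
  assumes "normform n z h" "repr n y f"
  shows "normform n (z * (y * jm (Suc n) ^ i)) (\<lambda>cs. h cs * (f (tl cs) * hd cs ^ i))"
  using assms(1)
proof (induction rule: normform.induct)
  case (normform_mono x p j)
  have "jm (Suc n) ^ j * y = y * jm (Suc n) ^ j"
    using jm_comm[OF repr_supported[OF assms(2)]] by (metis power_commuting_commutes)
  then have "x * jm (Suc n) ^ j * (y * jm (Suc n) ^ i) = (x * y) * jm (Suc n) ^ (j + i)"
    by (simp add: power_add mult.assoc[symmetric]) (simp add: mult.assoc)
  then show ?case
    using normform.normform_mono[OF repr_mult[OF normform_mono assms(2)], of "j + i"] by (simp add: power_add mult_ac)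
next
  case (normform_add x f' y' h')
  then show ?case using normform.normform_add by (simp add: distrib_right)
next
  case (normform_cong x f' h')
  show ?case by (rule normform.normform_cong[OF normform_cong.IH]) (simp add: normform_cong.hyps)
qed

lemma normform_mult:
  assumes "normform n z h" "normform n y f"
  shows "normform n (z * y) (\<lambda>cs. h cs * f cs)"
  using assms(2)
proof (induction rule: normform.induct)
  case (normform_mono y f i)
  then show ?case by (rule normform_mult_mono[OF assms(1)])
next
  case (normform_add x f' y' h')
  then show ?case using normform.normform_add by (simp add: distrib_left)
next
  case (normform_cong x f' h')
  show ?case by (rule normform.normform_cong[OF normform_cong.IH]) (simp add: normform_cong.hyps)
qed

lemma repr_normform: "repr m z h \<Longrightarrow> m = Suc n \<Longrightarrow> normform n z h"
proof (induction rule: repr.induct)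
  case (repr_const m c)
  then show ?case using normform_mono[OF repr.repr_const[of n c], of 0] by simp
next
  case (repr_lift m x f)
  then show ?case using normform_mono[of n x f 0] by simp
next
  case (repr_jm m)
  then show ?case using normform_mono[OF repr.repr_const[of n 1], of 1] by simp
next
  case (repr_cong m x f h)
  then show ?case using normform.normform_cong by blast
qed (auto intro: normform_add normform_mult)

text \<open>The expansion of \<open>E\<^sub>n\<close> in powers of \<open>1 / z\<close>, as a function of the values of \<open>J\<^sub>n, \<dots>, J\<^sub>1\<close>.\<close>

fun moment :: "nat \<Rightarrow> real list \<Rightarrow> real" where
  "moment 0 cs = 1"
| "moment (Suc 0) cs = 0"
| "moment (Suc (Suc k)) [] = 0"
| "moment (Suc (Suc k)) (c # cs) = 2 * moment (Suc k) (c # cs) * c - moment k (c # cs) * (c * c - 1)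
     + moment (Suc (Suc k)) cs - 2 * (moment (Suc k) cs * c) + moment k cs * (c * c)"

text \<open>The expectation of \<open>hecke_identity\<close>: terms with a single s vanish by
  \<open>restr_swap_zero\<close>, and those with s on both sides of a power drop to the previous
  level by \<open>restr_swap_conj\<close>.\<close>

lemma restr_jm_power_recursion:
  fixes n k :: nat
  defines "a \<equiv> jm (Suc n)" and "b \<equiv> jm (Suc (Suc n))"
  shows "restr (Suc n) (b ^ Suc (Suc k)) = 2 * restr (Suc n) (b ^ Suc k) * a - restr (Suc n) (b ^ k) * (a * a - 1)
     + restr n (a ^ Suc (Suc k)) - 2 * (restr n (a ^ Suc k) * a) + restr n (a ^ k) * (a * a)"
proof -
  let ?E = "restr (Suc n)"
  define s where "s = perm_elt (tswap (Suc n) (Suc (Suc n)))"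
  have a: "a \<in> supported (Suc n)" unfolding a_def by (rule jm_supported)
  have aa: "a * a \<in> supported (Suc n)" "a * a - 1 \<in> supported (Suc n)"
    using a by (auto intro: supported_mult supported_diff supported_one)
  have z: "?E (u * s * v) = 0" if "u \<in> supported (Suc n)" "v \<in> supported (Suc n)" for u v
    unfolding s_def using restr_swap_zero[OF that] by simp
  have c: "?E (s * a ^ j * s) = restr n (a ^ j)" for j
    unfolding s_def by (rule restr_swap_conj[OF supported_power[OF a]])
  have two: "?E (2 * x) = 2 * ?E x" for x by (simp add: mult_2 restr_add)
  have "b ^ (k+2) - 2 * b ^ (k+1) * a + b ^ k * (a * a - 1) =
    s * a ^ (k+2) * s - 2 * (s * a ^ (k+1) * s * a) + s * a ^ k * s * (a * a)
     + a ^ (k+1) * s - a ^ k * s * a"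
  proof (rule hecke_identity)
    show "b * s = s * a + 1" unfolding a_def b_def s_def by (rule jm_Suc_swap) simp
    show "s * s = 1" by (simp add: s_def perm_elt_mult)
    show "a * b = b * a" unfolding b_def by (rule jm_comm[OF a])
  qed
  then have "?E (b ^ (k+2) - 2 * b ^ (k+1) * a + b ^ k * (a * a - 1)) =
    ?E (s * a ^ (k+2) * s - 2 * (s * a ^ (k+1) * s * a) + s * a ^ k * s * (a * a)
     + a ^ (k+1) * s - a ^ k * s * a)" by simp
  also have "\<dots> = restr n (a ^ (k+2)) - 2 * (restr n (a ^ (k+1)) * a) + restr n (a ^ k) * (a * a)"
    using z[OF supported_power[OF a] supported_one, of "k+1"] z[OF supported_power[OF a] a, of k]
    by (simp add: restr_add restr_diff two c restr_mult_right[OF a] restr_mult_right[OF aa(1)] del: power_Suc)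
  finally have "?E (b ^ (k+2)) - 2 * ?E (b ^ (k+1)) * a + ?E (b ^ k) * (a * a - 1) =
    restr n (a ^ (k+2)) - 2 * (restr n (a ^ (k+1)) * a) + restr n (a ^ k) * (a * a)"
    by (simp only: restr_add restr_diff mult.assoc[of 2] two restr_mult_right[OF a] restr_mult_right[OF aa(2)])
  then show ?thesis by (simp add: algebra_simps del: power_Suc)
qed

lemma restr_jm: "restr n (jm (Suc n)) = 0"
proof -
  have nt: "tswap i (Suc n) \<notin> perms_le n" if "i < Suc n" for i
    using perms_le_fix[of "tswap i (Suc n)" n "Suc n"] that by (auto simp: tswap.rep_eq)
  have "restr n (sum (\<lambda>i. perm_elt (tswap i (Suc n))) A) = 0" if "A \<subseteq> {1..<Suc n}" for A
    using finite_subset[OF that finite_atLeastLessThan] that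
    by (induction A rule: finite_induct) (auto simp: restr_add perm_elt_def restr_sg nt)
  then show ?thesis unfolding jm_def by blast
qed

text \<open>Induction on n and, inside it, on k, because the recursion refers to lower powers at the
  same level and to powers one level below that are not lower.\<close>

lemma repr_moment: "repr n (restr n (jm (Suc n) ^ k)) (moment k)"
proof (induction n arbitrary: k)
  case 0
  have "jm (Suc 0) = 0" by (simp add: jm_def)
  then have "restr 0 (jm (Suc 0) ^ k) = scal (moment k [])"
    by (cases "(k, [] :: real list)" rule: moment.cases) (auto simp: restr_id supported_one)
  then show ?case using repr_const[of 0 "moment k []"]
    by (auto intro: repr_cong)
next
  case (Suc n)
  show ?case
  proof (induction k rule: less_induct)
    case (less k)
    consider "k = 0" | "k = 1" | j where "k = Suc (Suc j)" by (metis One_nat_def not0_implies_Suc)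
    then show ?case
    proof cases
      case 1
      then show ?thesis using repr_const[of "Suc n" 1]
        by (auto simp: restr_id supported_one intro: repr_cong)
    next
      case 2
      then show ?thesis using repr_const[of "Suc n" 0]
        by (auto simp: restr_jm intro: repr_cong)
    next
      case 3
      let ?a = "jm (Suc n)" and ?b = "jm (Suc (Suc n))"
      have two: "(2 :: galg) = scal 2" by (simp add: scal_def)
      have 1: "repr (Suc n) 1 (\<lambda>_. 1)" using repr_const[of _ 1] by simp
      have jm: "repr (Suc n) ?a hd" by (rule repr_jm)
      have JJ: "repr (Suc n) (?a * ?a) (\<lambda>cs. hd cs * hd cs)" by (rule repr_mult[OF jm jm])
      have M: "repr (Suc n) (restr (Suc n) (?b ^ i)) (moment i)" if "i < k" for i using less that by blast
      have M': "repr (Suc n) (restr n (?a ^ i)) (\<lambda>cs. moment i (tl cs))" for i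
        using repr_lift[OF Suc] .
      have "repr (Suc n) (restr (Suc n) (?b ^ Suc (Suc j)))
        (\<lambda>cs. 2 * moment (Suc j) cs * hd cs - moment j cs * (hd cs * hd cs - 1) + moment (Suc (Suc j)) (tl cs)
          - 2 * (moment (Suc j) (tl cs) * hd cs) + moment j (tl cs) * (hd cs * hd cs))"
        unfolding restr_jm_power_recursion two
        by (intro repr_add repr_diff repr_mult M M' JJ jm 1 repr_const) (auto simp: 3)
      then show ?thesis unfolding 3
        by (rule repr_cong) (auto simp: length_Suc_conv)
    qed
  qed
qed

section \<open>Identification of the spectral law with Plancherel growth\<close>

primrec contents :: "nat list \<Rightarrow> real list" where
  "contents [] = []"
| "contents (i # T) = rowc T i # contents T"

lemma length_contents [simp]: "length (contents T) = length T" by (induction T) auto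

text \<open>The conditional moments of J_(n+1) are the moments of the next content. By
  \<open>trans_wt_Cons_recursion\<close> the right side obeys the recursion of
  \<open>moment\<close>, and the values for k = 0 and k = 1 agree by
  \<open>trans_wt_moments\<close>.\<close>

lemma moment_contents:
  assumes "T \<in> tableaux n" "n < N"
  shows "moment k (contents T) = (\<Sum>i<N. trans_wt N T i * rowc T i ^ k)"
  using assms
proof (induction n arbitrary: k T)
  case 0
  then have T: "T = []" by (simp add: tableaux_0)
  have z: "(\<Sum>i<N. trans_wt N [] i * rowc [] i ^ Suc k) = 0" for k
    using trans_wt_not_addable[of "[]" _ N] by (intro sum.neutral) (auto simp: addable_def rowc_def)
  show ?case
  proof (cases k)
    case 0
    then show ?thesis using trans_wt_moments(1)[OF \<open>T \<in> tableaux 0\<close>, of N] assms T by (simp add: 0 \<open>0 < N\<close>)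
  next
    case (Suc j)
    then show ?thesis using z[of j] T by (cases j) auto
  qed
next
  case (Suc n)
  then obtain r U where T: "T = r # U" "U \<in> tableaux n" "addable U r" "is_tableau U" "r \<le> n"
    unfolding tableaux_Suc by (auto simp: tableaux_def)
  define c where "c = rowc U r"
  let ?M = "\<lambda>k. \<Sum>i<N. trans_wt N T i * rowc T i ^ k"
  have U: "moment k (contents U) = (\<Sum>i<N. trans_wt N U i * rowc U i ^ k)" for k
    using Suc T by simp
  have recM: "?M (Suc (Suc k)) - 2 * c * ?M (Suc k) + (c * c - 1) * ?M k
    = moment (Suc (Suc k)) (contents U) - 2 * c * moment (Suc k) (contents U) + c * c * moment k (contents U)" for k
  proof -
    have "?M (Suc (Suc k)) - 2 * c * ?M (Suc k) + (c * c - 1) * ?M k =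
      (\<Sum>i<N. trans_wt N T i * ((rowc T i - c)\<^sup>2 - 1) * rowc T i ^ k)"
      unfolding sum_distrib_left sum_subtractf[symmetric] sum.distrib[symmetric]
      by (rule sum.cong) (auto simp: algebra_simps power2_eq_square)
    also have "\<dots> = (\<Sum>i<N. trans_wt N U i * (rowc U i - c)\<^sup>2 * rowc U i ^ k)"
      unfolding T(1) c_def using T Suc.prems by (intro sum.cong trans_wt_Cons_recursion) auto
    also have "\<dots> = moment (Suc (Suc k)) (contents U) - 2 * c * moment (Suc k) (contents U) + c * c * moment k (contents U)"
      unfolding U sum_distrib_left sum_subtractf[symmetric] sum.distrib[symmetric]
      by (rule sum.cong) (auto simp: algebra_simps power2_eq_square)
    finally show ?thesis .
  qed
  have ctT: "contents T = c # contents U" by (simp add: T c_def)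
  show ?case
  proof (induction k rule: less_induct)
    case (less k)
    consider "k = 0" | "k = 1" | j where "k = Suc (Suc j)" by (metis One_nat_def not0_implies_Suc)
    then show ?case
    proof cases
      case 3
      have "moment (Suc j) (contents T) = ?M (Suc j)" "moment j (contents T) = ?M j" using less 3 by auto
      then show ?thesis using recM[of j] unfolding 3 ctT by (simp add: algebra_simps)
    qed (use trans_wt_moments[OF Suc.prems] in simp_all)
  qed
qed

text \<open>The coefficient at the identity is the trace, which \<open>restr\<close> preserves. In a
  normal form only a power of the last element is averaged, and its conditional moment is one step
  of the growth.\<close>

lemma repr_law:
  assumes "repr n x f" "n \<le> N"
  shows "coef x 0 = (\<Sum>T\<in>tableaux n. planch N T * f (contents T))"
  using assms
proof (induction n arbitrary: x f)
  case 0
  then show ?case using repr_0[OF 0(1)] by (simp add: tableaux_0 scal_def)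
next
  case (Suc n)
  have "normform n x f" using repr_normform[OF Suc.prems(1)] by simp
  then show ?case
  proof (induction rule: normform.induct)
    case (normform_mono y f i)
    let ?b = "jm (Suc n)"
    have "y * ?b ^ i = ?b ^ i * y"
      using jm_comm[OF repr_supported[OF normform_mono]] by (metis power_commuting_commutes)
    then have "coef (y * ?b ^ i) 0 = coef (restr n (?b ^ i * y)) 0" by (simp add: restr.rep_eq perms_le_zero)
    also have "\<dots> = coef (restr n (?b ^ i) * y) 0" by (simp add: restr_mult_right[OF repr_supported[OF normform_mono]])
    also have "\<dots> = (\<Sum>T\<in>tableaux n. planch N T * (moment i (contents T) * f (contents T)))"
      using Suc.IH[OF repr_mult[OF repr_moment normform_mono]] Suc.prems by simp
    also have "\<dots> = (\<Sum>T\<in>tableaux n. planch N T * (\<Sum>r<N. trans_wt N T r * (f (tl (contents (r # T))) * hd (contents (r # T)) ^ i)))"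
      using Suc.prems by (intro sum.cong) (auto simp: moment_contents[of _ n N] sum_distrib_left sum_distrib_right mult_ac)
    also have "\<dots> = (\<Sum>U\<in>tableaux (Suc n). planch N U * (f (tl (contents U)) * hd (contents U) ^ i))"
      using sum_tableaux_Suc_trans_wt[of n N "\<lambda>U. f (tl (contents U)) * hd (contents U) ^ i"] Suc.prems by simp
    finally show ?case .
  next
    case (normform_add x f y h)
    then show ?case by (simp add: lookup_add distrib_left sum.distrib)
  next
    case (normform_cong x f h)
    have "(\<Sum>T\<in>tableaux (Suc n). planch N T * f (contents T)) = (\<Sum>T\<in>tableaux (Suc n). planch N T * h (contents T))"
      by (rule sum.cong) (auto simp: normform_cong.hyps tableaux_def)
    then show ?case using normform_cong.IH by simp
  qed
qed

section \<open>The sign twist and symmetry under transposition\<close>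

lift_definition sign_twist :: "galg \<Rightarrow> galg" is "\<lambda>x p. of_int (sign (perm_fun p)) * x p"
  by (erule rev_finite_subset) auto

lemma sign_twist_add: "sign_twist (x + y) = sign_twist x + sign_twist y"
  by (rule poly_mapping_eqI) (simp add: sign_twist.rep_eq lookup_add algebra_simps)
lemma sign_twist_zero [simp]: "sign_twist 0 = 0"
  by (rule poly_mapping_eqI) (simp add: sign_twist.rep_eq)
lemma sign_twist_sg: "sign_twist (sg p c) = sg p (of_int (sign (perm_fun p)) * c)"
  by (rule poly_mapping_eqI) (auto simp: sign_twist.rep_eq lookup_single when_def)

lemma permutation_perm_fun: "permutation (perm_fun p)"
  using perm_fun[of p] by (auto simp: permutation_permutes intro: finite_atMost)

lemma sign_twist_mult: "sign_twist (x * y) = sign_twist x * sign_twist y"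
proof (induction x rule: galg_induct)
  case (sg p c)
  show ?case
    by (induction y rule: galg_induct)
      (auto simp: sign_twist_sg mult_single sign_twist_add distrib_left plus_nperm.rep_eq sign_compose permutation_perm_fun mult_ac)
qed (auto simp: sign_twist_add distrib_right)

lemma sign_twist_scal: "sign_twist (scal c) = scal c"
  by (simp add: scal_def sign_twist_sg zero_nperm.rep_eq)

lemma sign_twist_jm: "sign_twist (jm n) = scal (-1) * jm n"
proof -
  have "sign_twist (sum (\<lambda>i. perm_elt (tswap i n)) A) = scal (-1) * sum (\<lambda>i. perm_elt (tswap i n)) A" if "A \<subseteq> {1..<n}" for A
    using finite_subset[OF that finite_atLeastLessThan] that
    by (induction A rule: finite_induct)
      (auto simp: sign_twist_add perm_elt_def sign_twist_sg scal_def mult_single distrib_left tswap.rep_eq sign_swap_id)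
  then show ?thesis unfolding jm_def by blast
qed

lemma repr_sign_twist: "repr n x f \<Longrightarrow> repr n (sign_twist x) (\<lambda>cs. f (map uminus cs))"
proof (induction rule: repr.induct)
  case (repr_jm n)
  show ?case unfolding sign_twist_jm
    by (rule repr_cong[OF repr_scale[OF repr.repr_jm]]) (auto simp: length_Suc_conv)
next
  case (repr_lift n x f)
  from repr.repr_lift[OF this(2)] show ?case by (simp add: map_tl)
next
  case (repr_cong n x f h)
  show ?case by (rule repr.repr_cong[OF repr_cong(3)]) (simp add: repr_cong.hyps)
qed (auto simp: sign_twist_scal sign_twist_add sign_twist_mult intro: repr.intros(1,4,5))

text \<open>\<open>repr_law\<close> speaks of polynomials, while positive parts and indicators are
  not polynomial. On a finite grid every function agrees with one: Lagrange basis polynomials in the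
  newest value are multiplied by interpolants in the older values.\<close>

lemma repr_all_functions:
  fixes V :: "real set"
  assumes "finite V"
  shows "\<exists>x f'. repr n x f' \<and> (\<forall>cs. length cs = n \<and> set cs \<subseteq> V \<longrightarrow> f' cs = f cs)"
proof (induction n arbitrary: f)
  case 0
  show ?case using repr_const[of 0 "f []"] by auto
next
  case (Suc n)
  have "\<forall>v. \<exists>f'. (\<exists>x. repr n x f') \<and> (\<forall>cs. length cs = n \<and> set cs \<subseteq> V \<longrightarrow> f' cs = f (v # cs))"
    using Suc[of "\<lambda>cs. f (_ # cs)"] by blast
  then obtain F where F: "\<And>v. \<exists>x. repr n x (F v)"
    "\<And>v cs. length cs = n \<Longrightarrow> set cs \<subseteq> V \<Longrightarrow> F v cs = f (v # cs)" by metis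
  define L where "L v cs = (\<Prod>w\<in>V - {v}. (hd cs - w) * (1 / (v - w)))" for v and cs :: "real list"
  have "\<exists>x. repr (Suc n) x (L v)" for v
    unfolding L_def
  proof (rule repr_prod)
    fix w
    show "\<exists>x. repr (Suc n) x (\<lambda>cs. (hd cs - w) * (1 / (v - w)))"
      by (rule exI, rule repr_mult[OF repr_diff[OF repr_jm repr_const] repr_const])
  qed (use assms in auto)
  then have "\<exists>x. repr (Suc n) x (\<lambda>cs. L v cs * F v (tl cs))" for v
    using F(1)[of v] repr_mult[OF _ repr_lift] by blast
  then have "\<exists>x. repr (Suc n) x (\<lambda>cs. \<Sum>v\<in>V. L v cs * F v (tl cs))" by (intro repr_sum assms)
  then obtain x where x: "repr (Suc n) x (\<lambda>cs. \<Sum>v\<in>V. L v cs * F v (tl cs))" ..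
  have "(\<Sum>v\<in>V. L v cs * F v (tl cs)) = f cs" if cs: "length cs = Suc n" "set cs \<subseteq> V" for cs
  proof -
    obtain c ds where c: "cs = c # ds" using cs by (cases cs) auto
    have L: "L v cs = (if v = c then 1 else 0)" if "v \<in> V" for v
      unfolding L_def using cs c assms by (auto intro!: prod_zero prod.neutral bexI[of _ c])
    have "(\<Sum>v\<in>V. L v cs * F v (tl cs)) = (\<Sum>v\<in>V. if v = c then F v ds else 0)"
      by (rule sum.cong) (auto simp: L[unfolded c] c)
    then show ?thesis using assms cs c F(2)[of ds c] by auto
  qed
  then show ?case using x by blast
qed

lemma contents_range: "T \<in> tableaux n \<Longrightarrow> set (contents T) \<subseteq> real_of_int ` {- int n..int n}"
proof (induction n arbitrary: T)
  case (Suc n)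
  then obtain r U where T: "T = r # U" "U \<in> tableaux n" "r \<le> n"
    unfolding tableaux_Suc by auto
  have "rowc U r = real_of_int (int (count_list U r) - int r)" by (simp add: rowc_def)
  moreover have "count_list U r \<le> n" using count_le_length[of U r] T by (simp add: tableaux_def)
  ultimately have "rowc U r \<in> real_of_int ` {- int (Suc n)..int (Suc n)}"
    using T by (simp only:) (rule imageI, simp)
  moreover have "real_of_int ` {- int n..int n} \<subseteq> real_of_int ` {- int (Suc n)..int (Suc n)}" by auto
  ultimately show ?case using T Suc.IH[OF T(2)] by auto
qed (simp add: tableaux_0)

text \<open>Invariance under transposition of tableaux, obtained from the algebra: the sign twist
  fixes the coefficient at the identity and negates every Jucys--Murphy element.\<close>

lemma law_symmetric:
  assumes "n \<le> N"
  shows "(\<Sum>T\<in>tableaux n. planch N T * f (map uminus (contents T))) = (\<Sum>T\<in>tableaux n. planch N T * f (contents T))"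
proof -
  \<comment> \<open>The grid is symmetric about 0, so the interpolating \<open>f'\<close> equals
    \<open>f\<close> at the contents and at their negatives.\<close>
  let ?V = "real_of_int ` {- int n..int n}"
  obtain x f' where x: "repr n x f'" "\<And>cs. length cs = n \<Longrightarrow> set cs \<subseteq> ?V \<Longrightarrow> f' cs = f cs"
    using repr_all_functions[of ?V n f] by auto
  have V: "set (contents T) \<subseteq> ?V" "set (map uminus (contents T)) \<subseteq> ?V" "length (contents T) = n" if "T \<in> tableaux n" for T
  proof -
    show "set (contents T) \<subseteq> ?V" using contents_range that by blast
    moreover have "uminus ` ?V \<subseteq> ?V"
    proof
      fix x assume "x \<in> uminus ` ?V"
      then obtain i where "x = real_of_int (- i)" "i \<in> {- int n..int n}" by auto
      then show "x \<in> ?V" by (intro image_eqI[of _ _ "- i"]) auto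
    qed
    ultimately show "set (map uminus (contents T)) \<subseteq> ?V"
      unfolding list.set_map by (meson image_mono order_trans)
    show "length (contents T) = n" using that by (simp add: tableaux_def)
  qed
  have "(\<Sum>T\<in>tableaux n. planch N T * f (map uminus (contents T))) = (\<Sum>T\<in>tableaux n. planch N T * f' (map uminus (contents T)))"
    by (rule sum.cong) (use V x in auto)
  also have "\<dots> = coef (sign_twist x) 0" using repr_law[OF repr_sign_twist[OF x(1)] assms] by simp
  also have "\<dots> = coef x 0" by (simp add: sign_twist.rep_eq zero_nperm.rep_eq)
  also have "\<dots> = (\<Sum>T\<in>tableaux n. planch N T * f' (contents T))" by (rule repr_law[OF x(1) assms])
  also have "\<dots> = (\<Sum>T\<in>tableaux n. planch N T * f (contents T))"
    by (rule sum.cong) (use V x in auto)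
  finally show ?thesis .
qed

section \<open>The shuffle in the group algebra\<close>

text \<open>The identity is the transposition (j j), so the summand 1 supplies the choice i =
  j.\<close>

lemma jm_plus_one: "j \<ge> 1 \<Longrightarrow> 1 + jm j = (\<Sum>i\<in>{1..j}. perm_elt (tswap j i))"
proof -
  assume "j \<ge> 1"
  then have "{1..j} = insert j {1..<j}" by auto
  moreover have "tswap j i = tswap i j" for i by transfer (rule transpose_commute)
  ultimately show ?thesis by (simp add: jm_def)
qed

primrec star_perm :: "nat \<Rightarrow> nat list \<Rightarrow> nperm" where
  "star_perm j [] = 0"
| "star_perm j (i # is) = star_perm j is + tswap j i"

lemma perm_fun_star_perm: "perm_fun (star_perm j is) = star_word j is"
  by (induction "is") (simp_all add: zero_nperm.rep_eq plus_nperm.rep_eq tswap.rep_eq)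

definition star_lists :: "nat \<Rightarrow> nat \<Rightarrow> nat list set" where "star_lists j k = {is. set is \<subseteq> {1..j} \<and> length is = k}"

lemma finite_star_lists: "finite (star_lists j k)"
  unfolding star_lists_def by (rule finite_lists_length_eq) simp

lemma star_power:
  assumes "j \<ge> 1"
  shows "(1 + jm j) ^ k = (\<Sum>is\<in>star_lists j k. perm_elt (star_perm j is))"
proof (induction k)
  case 0
  have "star_lists j 0 = {[]}" by (auto simp: star_lists_def)
  then show ?case by simp
next
  case (Suc k)
  have "(1 + jm j) ^ Suc k = (\<Sum>is\<in>star_lists j k. \<Sum>i\<in>{1..j}. perm_elt (star_perm j (i # is)))"
    unfolding power_Suc2 Suc by (subst jm_plus_one[OF assms]) (simp add: sum_product perm_elt_mult)
  also have "\<dots> = (\<Sum>(is, i)\<in>star_lists j k \<times> {1..j}. perm_elt (star_perm j (i # is)))"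
    by (rule sum.cartesian_product)
  also have "\<dots> = (\<Sum>is\<in>(\<lambda>(is, i). i # is) ` (star_lists j k \<times> {1..j}). perm_elt (star_perm j is))"
    by (subst sum.reindex) (auto simp: inj_on_def split_def)
  also have "(\<lambda>(is, i). i # is) ` (star_lists j k \<times> {1..j}) = star_lists j (Suc k)"
    unfolding star_lists_def lists_length_Suc_eq ..
  finally show ?case .
qed

definition shuffle_elt :: "nat \<Rightarrow> nat \<Rightarrow> galg" where
  "shuffle_elt n k = scal (1 / real n) * (\<Sum>j\<in>{1..n}. (scal (1 / real j) * (1 + jm j)) ^ k)"

lemma coef_scal_mult: "coef (scal c * x) p = c * coef x p"
  by (induction x rule: galg_induct) (auto simp: scal_def mult_single lookup_single when_def distrib_left lookup_add)

lemma scal_power: "(scal c * x) ^ k = scal (c ^ k) * x ^ k"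
proof (induction k)
  case (Suc k)
  have "scal c * x * (scal (c ^ k) * x ^ k) = scal c * scal (c ^ k) * (x * x ^ k)"
    by (metis mult.assoc scal_comm)
  then show ?case by (simp add: Suc scal_mult)
qed simp

lemma coef_shuffle_elt: "coef (shuffle_elt n k) p = shuffle_prob n k (perm_fun p)"
proof -
  have 1: "coef (\<Sum>is\<in>star_lists j k. perm_elt (star_perm j is)) p = (\<Sum>is\<in>{is\<in>star_lists j k. star_word j is = perm_fun p}. 1)" for j
    unfolding lookup_sum
    by (rule sum.mono_neutral_cong_right) (auto simp: finite_star_lists perm_elt_def lookup_single when_def perm_fun_star_perm[symmetric] perm_fun_inject')
  have "coef (shuffle_elt n k) p = (\<Sum>j\<in>{1..n}. 1 / (real n * real j ^ k) * coef ((1 + jm j) ^ k) p)"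
    unfolding shuffle_elt_def coef_scal_mult lookup_sum scal_power by (simp add: sum_distrib_left power_one_over)
  also have "\<dots> = (\<Sum>j\<in>{1..n}. \<Sum>is\<in>{is\<in>star_lists j k. star_word j is = perm_fun p}. 1 / (real n * real j ^ k))"
    by (rule sum.cong) (auto simp: star_power 1 simp del: sum_constant simp: sum_distrib_left)
  also have "\<dots> = (\<Sum>(j, is)\<in>(SIGMA j:{1..n}. {is\<in>star_lists j k. star_word j is = perm_fun p}). 1 / (real n * real j ^ k))"
    by (rule sum.Sigma) (auto simp: finite_star_lists)
  also have "(SIGMA j:{1..n}. {is\<in>star_lists j k. star_word j is = perm_fun p}) =
     {(j, is). j \<in> {1..n} \<and> length is = k \<and> set is \<subseteq> {1..j} \<and> star_word j is = perm_fun p}"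
    by (auto simp: star_lists_def)
  finally show ?thesis unfolding shuffle_prob_def .
qed

lemma shuffle_elt_supported: "shuffle_elt n k \<in> supported n"
  unfolding shuffle_elt_def
  by (intro supported_mult supported_scal supported_sum supported_power supported_add supported_one) (auto intro: supported_mono[OF _ jm_supported])

lemma coef_mult_supported:
  assumes "x \<in> supported n"
  shows "coef (x * y) p = (\<Sum>q\<in>perms_le n. coef x q * coef y (- q + p))"
proof -
  have s: "coef (sg q c * y) p = c * coef y (- q + p)" for q c
  proof (induction y rule: galg_induct)
    case (sg r d)
    have "q + r = p \<longleftrightarrow> r = - q + p" by (metis add.assoc add.left_neutral left_minus right_minus)
    then show ?case by (auto simp: mult_single lookup_single when_def)
  qed (auto simp: distrib_left lookup_add)
  have "x * y = (\<Sum>q\<in>perms_le n. sg q (coef x q) * y)"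
    by (subst supported_expand[OF assms]) (simp add: sum_distrib_right)
  then show ?thesis by (simp add: lookup_sum s)
qed

lemma Nperm_inverse': "y \<in> Sym n \<Longrightarrow> perm_fun (Nperm y) = y"
proof -
  assume "y \<in> Sym n"
  then have "y permutes {..n}" by (auto intro: permutes_subset)
  then show ?thesis by (intro Nperm_inverse) auto
qed

lemma perms_le_Nperm: "y \<in> Sym n \<Longrightarrow> Nperm y \<in> perms_le n"
  unfolding perms_le_def using Nperm_inverse'[of y n] by simp

lemma sum_Sym: "(\<Sum>y\<in>Sym n. f y) = (\<Sum>q\<in>perms_le n. f (perm_fun q))"
  by (rule sum.reindex_bij_witness[where i = perm_fun and j = Nperm])
    (simp_all add: Nperm_inverse' perms_le_Nperm perm_fun_inverse perms_le_def)

lemma shuffle_steps_coef: "y \<in> Sym n \<Longrightarrow> shuffle_steps n k t id y = coef (shuffle_elt n k ^ t) (Nperm y)"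
proof (induction t arbitrary: y)
  case 0
  have "id = y \<longleftrightarrow> Nperm y = 0"
    by (metis "0" Nperm_inverse' perm_fun_inverse zero_nperm.rep_eq)
  then show ?case unfolding shuffle_steps.simps power_0 lookup_one when_def by (simp only:)
next
  case (Suc t)
  have "shuffle_steps n k (Suc t) id y = (\<Sum>q\<in>perms_le n. coef (shuffle_elt n k ^ t) q * shuffle_prob n k (inv (perm_fun q) \<circ> y))"
    unfolding shuffle_steps.simps shuffle_kernel_def
    by (subst sum_Sym, rule sum.cong) (auto simp: perms_le_def Suc.IH perm_fun_inverse)
  also have "\<dots> = (\<Sum>q\<in>perms_le n. coef (shuffle_elt n k ^ t) q * coef (shuffle_elt n k) (- q + Nperm y))"
    by (simp add: coef_shuffle_elt plus_nperm.rep_eq uminus_nperm.rep_eq Nperm_inverse'[OF Suc.prems])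
  also have "\<dots> = coef (shuffle_elt n k ^ Suc t) (Nperm y)"
    unfolding power_Suc2 by (rule coef_mult_supported[OF supported_power[OF shuffle_elt_supported], symmetric])
  finally show ?case .
qed

section \<open>Reversibility, total mass and the trace formula\<close>

lift_definition antipode :: "galg \<Rightarrow> galg" is "\<lambda>(x :: nperm \<Rightarrow> real) p. x (- p)"
proof -
  fix x :: "nperm \<Rightarrow> real" assume "finite {p. x p \<noteq> 0}"
  moreover have "{p. x (- p) \<noteq> 0} = uminus ` {p. x p \<noteq> 0}"
    by (auto simp: image_iff) (metis minus_minus)
  ultimately show "finite {p. x (- p) \<noteq> 0}" by simp
qed

lemma antipode_add: "antipode (x + y) = antipode x + antipode y"
  by (rule poly_mapping_eqI) (simp add: antipode.rep_eq lookup_add)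
lemma antipode_zero [simp]: "antipode 0 = 0"
  by (rule poly_mapping_eqI) (simp add: antipode.rep_eq)
lemma antipode_sum: "antipode (sum f A) = (\<Sum>i\<in>A. antipode (f i))"
  by (induction A rule: infinite_finite_induct) (simp_all add: antipode_add)
lemma antipode_sg: "antipode (sg p c) = sg (- p) c"
  by (rule poly_mapping_eqI) (auto simp: antipode.rep_eq lookup_single when_def)
lemma antipode_mult: "antipode (x * y) = antipode y * antipode x"
proof (induction x rule: galg_induct)
  case (sg p c)
  show ?case
    by (induction y rule: galg_induct)
      (auto simp: antipode_sg mult_single antipode_add distrib_left distrib_right minus_add mult_ac)
qed (auto simp: antipode_add distrib_left distrib_right)
lemma antipode_scal: "antipode (scal c) = scal c" by (simp add: scal_def antipode_sg)
lemma antipode_one: "antipode 1 = 1" using antipode_scal[of 1] by simp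
lemma antipode_power: "antipode (x ^ k) = antipode x ^ k"
  by (induction k) (simp_all add: antipode_one antipode_mult power_commutes)
lemma antipode_perm_elt: "antipode (perm_elt p) = perm_elt (- p)" by (simp add: perm_elt_def antipode_sg)
lemma uminus_tswap: "- tswap i j = tswap i j"
  by (metis minus_unique tswap_tswap)
lemma antipode_jm: "antipode (jm n) = jm n"
  by (simp add: jm_def antipode_sum antipode_perm_elt uminus_tswap)
lemma antipode_shuffle_elt: "antipode (shuffle_elt n k) = shuffle_elt n k"
  by (simp add: shuffle_elt_def antipode_mult antipode_scal antipode_sum antipode_power antipode_add antipode_one antipode_jm scal_comm[symmetric])

text \<open>The shuffle element is fixed by the antipode, so its powers have equal coefficients at q
  and at \<open>- q\<close>; the sum of squares is then the identity coefficient of a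
  product.\<close>

lemma sum_squares_coef:
  "(\<Sum>q\<in>perms_le n. (coef (shuffle_elt n k ^ t) q)\<^sup>2) = coef (shuffle_elt n k ^ (2 * t)) 0"
proof -
  have "coef (shuffle_elt n k ^ t) (- q) = coef (shuffle_elt n k ^ t) q" for q
    by (metis antipode.rep_eq antipode_shuffle_elt antipode_power)
  then show ?thesis
    unfolding mult_2 power_add coef_mult_supported[OF supported_power[OF shuffle_elt_supported]] by (simp add: power2_eq_square)
qed

text \<open>The trivial representation of S_n, which returns the total mass of the walk.\<close>

definition augm :: "nat \<Rightarrow> galg \<Rightarrow> real" where "augm n x = (\<Sum>q\<in>perms_le n. coef x q)"

lemma augm_add: "augm n (x + y) = augm n x + augm n y"
  by (simp add: augm_def lookup_add sum.distrib)
lemma augm_zero [simp]: "augm n 0 = 0" by (simp add: augm_def)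
lemma augm_sum: "augm n (sum f A) = (\<Sum>i\<in>A. augm n (f i))"
  by (induction A rule: infinite_finite_induct) (simp_all add: augm_add)
lemma augm_sg: "p \<in> perms_le n \<Longrightarrow> augm n (sg p c) = c"
  by (simp add: augm_def lookup_single when_def finite_perms_le)
lemma augm_mult: "x \<in> supported n \<Longrightarrow> y \<in> supported n \<Longrightarrow> augm n (x * y) = augm n x * augm n y"
proof (induction x rule: supported_induct)
  case (sg p c)
  from sg(2) show ?case
    by (induction y rule: supported_induct)
      (use sg(1) in \<open>auto simp: mult_single distrib_left augm_add augm_sg perms_le_plus\<close>)
qed (auto simp: distrib_right augm_add)
lemma augm_scal: "augm n (scal c) = c" unfolding scal_def by (rule augm_sg[OF perms_le_zero])
lemma augm_one: "augm n 1 = 1" using augm_scal[of n 1] by simp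
lemma augm_power: "x \<in> supported n \<Longrightarrow> augm n (x ^ k) = augm n x ^ k"
  by (induction k) (simp_all add: augm_one augm_mult supported_power)

lemma augm_shuffle_elt:
  assumes "n \<ge> 1"
  shows "augm n (shuffle_elt n k ^ t) = 1"
proof -
  have j: "augm n ((scal (1 / real j) * (1 + jm j)) ^ k) = 1" if "j \<in> {1..n}" for j
  proof -
    have s: "1 + jm j \<in> supported n" using that by (intro supported_add supported_one supported_mono[OF _ jm_supported]) auto
    have "augm n (1 + jm j) = real j"
      using that by (subst jm_plus_one) (auto simp: augm_sum perm_elt_def augm_sg perms_le_tswap)
    then show ?thesis
      using that s by (simp add: augm_power supported_mult supported_scal augm_mult augm_scal)
  qed
  have s: "(\<Sum>j\<in>{1..n}. (scal (1 / real j) * (1 + jm j)) ^ k) \<in> supported n"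
    by (intro supported_sum supported_power supported_mult supported_scal supported_add supported_one supported_mono[OF _ jm_supported]) auto
  have "augm n (shuffle_elt n k) = 1"
    unfolding shuffle_elt_def augm_mult[OF supported_scal s] augm_scal augm_sum using j assms by simp
  then show ?thesis by (simp add: augm_power shuffle_elt_supported)
qed

text \<open>The eigenvalue times n. The head of a list of length j is the content of box number j,
  hence the denominator \<open>Suc (length cs)\<close>.\<close>

primrec eig_sum :: "nat \<Rightarrow> real list \<Rightarrow> real" where
  "eig_sum k [] = 0"
| "eig_sum k (c # cs) = ((1 + c) / real (Suc (length cs))) ^ k + eig_sum k cs"

lemma repr_eig_sum: "repr n (\<Sum>j\<in>{1..n}. (scal (1 / real j) * (1 + jm j)) ^ k) (eig_sum k)"
proof (induction n)
  case 0
  show ?case using repr_const[of 0 0] by (auto intro: repr_cong)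
next
  case (Suc n)
  have 1: "repr (Suc n) 1 (\<lambda>_. 1)" using repr_const[of _ 1] by simp
  have "repr (Suc n) ((\<Sum>j\<in>{1..n}. (scal (1 / real j) * (1 + jm j)) ^ k) + (scal (1 / real (Suc n)) * (1 + jm (Suc n))) ^ k)
     (\<lambda>cs. eig_sum k (tl cs) + (1 / real (Suc n) * (1 + hd cs)) ^ k)"
    by (intro repr_add repr_lift Suc repr_power repr_scale 1 repr_jm)
  then show ?case
    by (simp, elim repr_cong) (auto simp: length_Suc_conv)
qed

text \<open>Expanding the square leaves n! times the sum of squares, minus twice the total mass 1,
  plus 1.\<close>

lemma l2_dist_formula:
  assumes "n \<ge> 1"
  shows "(l2_dist n (shuffle_steps n k t id) (uniform n))\<^sup>2 =
    fact n * (\<Sum>T\<in>tableaux n. planch (Suc n) T * (eig_sum k (contents T) / real n) ^ (2 * t)) - 1"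
proof -
  define f where "f q = coef (shuffle_elt n k ^ t) q" for q
  have F: "(fact n :: real) > 0" by simp
  have "(l2_dist n (shuffle_steps n k t id) (uniform n))\<^sup>2 =
    (\<Sum>y\<in>Sym n. \<bar>shuffle_steps n k t id y / uniform n y - 1\<bar>\<^sup>2 * uniform n y)"
    unfolding l2_dist_def by (rule real_sqrt_pow2) (auto intro!: sum_nonneg simp: uniform_def)
  also have "\<dots> = (\<Sum>q\<in>perms_le n. \<bar>shuffle_steps n k t id (perm_fun q) / uniform n (perm_fun q) - 1\<bar>\<^sup>2 * uniform n (perm_fun q))"
    by (rule sum_Sym)
  also have "\<dots> = (\<Sum>q\<in>perms_le n. fact n * (f q)\<^sup>2 - 2 * f q + 1 / fact n)"
  proof (rule sum.cong)
    fix q assume "q \<in> perms_le n"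
    then have s: "shuffle_steps n k t id (perm_fun q) = f q"
      by (subst shuffle_steps_coef) (auto simp: perms_le_def f_def perm_fun_inverse)
    show "\<bar>shuffle_steps n k t id (perm_fun q) / uniform n (perm_fun q) - 1\<bar>\<^sup>2 * uniform n (perm_fun q) =
      fact n * (f q)\<^sup>2 - 2 * f q + 1 / fact n"
      unfolding s uniform_def using F by (simp add: power2_eq_square field_simps)
  qed simp
  also have "\<dots> = fact n * (\<Sum>q\<in>perms_le n. (f q)\<^sup>2) - 2 * (\<Sum>q\<in>perms_le n. f q) + real (card (perms_le n)) / fact n"
    by (simp add: sum.distrib sum_subtractf sum_distrib_left)
  also have "real (card (perms_le n)) = fact n"
  proof -
    have "real (card (perms_le n)) = real (card (Sym n))" using sum_Sym[of "\<lambda>_. 1 :: real" n] by simp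
    also have "\<dots> = fact n" using card_permutations[of "{1..n}" n] by simp
    finally show ?thesis .
  qed
  also have "(\<Sum>q\<in>perms_le n. f q) = 1" using augm_shuffle_elt[OF assms, of k t] by (simp add: augm_def f_def)
  also have "(\<Sum>q\<in>perms_le n. (f q)\<^sup>2) = coef (shuffle_elt n k ^ (2 * t)) 0" unfolding f_def by (rule sum_squares_coef)
  also have "\<dots> = (\<Sum>T\<in>tableaux n. planch (Suc n) T * (1 / real n * eig_sum k (contents T)) ^ (2 * t))"
    unfolding shuffle_elt_def by (rule repr_law[OF repr_power[OF repr_scale[OF repr_eig_sum]]]) simp
  also have "\<dots> = (\<Sum>T\<in>tableaux n. planch (Suc n) T * (eig_sum k (contents T) / real n) ^ (2 * t))" by simp
  finally have "(l2_dist n (shuffle_steps n k t id) (uniform n))\<^sup>2 =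
    fact n * (\<Sum>T\<in>tableaux n. planch (Suc n) T * (eig_sum k (contents T) / real n) ^ (2 * t)) - 2 * 1 + fact n / fact n" .
  moreover have "fact n / fact n = (1 :: real)" using F by simp
  ultimately show ?thesis by linarith
qed

lemma tv_le_l2: "4 * (tv_dist n \<mu> (uniform n))\<^sup>2 \<le> (l2_dist n \<mu> (uniform n))\<^sup>2"
proof -
  have F: "(fact n :: real) > 0" by simp
  have c: "real (card (Sym n)) = fact n" using card_permutations[of "{1..n}" n] by simp
  let ?d = "\<lambda>y. \<bar>\<mu> y - uniform n y\<bar>"
  have "4 * (tv_dist n \<mu> (uniform n))\<^sup>2 = (\<Sum>y\<in>Sym n. ?d y * 1)\<^sup>2"
    by (simp add: tv_dist_def power2_eq_square)
  also have "\<dots> \<le> (\<Sum>y\<in>Sym n. (?d y)\<^sup>2) * (\<Sum>y\<in>Sym n. 1\<^sup>2)"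
    by (rule Cauchy_Schwarz_ineq_sum)
  also have "\<dots> = (\<Sum>y\<in>Sym n. \<bar>\<mu> y / uniform n y - 1\<bar>\<^sup>2 * uniform n y)"
  proof -
    have "(\<Sum>y\<in>Sym n. 1\<^sup>2) = (fact n :: real)" using c by simp
    moreover have "(?d y)\<^sup>2 * fact n = \<bar>\<mu> y / uniform n y - 1\<bar>\<^sup>2 * uniform n y" for y
      using F by (simp add: uniform_def power2_eq_square field_simps)
    ultimately show ?thesis by (simp only: sum_distrib_right)
  qed
  also have "\<dots> = (l2_dist n \<mu> (uniform n))\<^sup>2"
    unfolding l2_dist_def by (rule real_sqrt_pow2[symmetric]) (auto intro!: sum_nonneg simp: uniform_def)
  finally show ?thesis .
qed

section \<open>Eigenvalue bounds\<close>

text \<open>For odd k the contents c \<le> -1 contribute non-positive terms, so dropping them bounds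
  the eigenvalue from above.\<close>

primrec pos_sum :: "nat \<Rightarrow> real list \<Rightarrow> real" where
  "pos_sum k [] = 0"
| "pos_sum k (c # cs) = (if c \<ge> 0 then ((1 + c) / real (Suc (length cs))) ^ k else 0) + pos_sum k cs"

primrec abs_sum :: "nat \<Rightarrow> real list \<Rightarrow> real" where
  "abs_sum k [] = 0"
| "abs_sum k (c # cs) = ((1 + \<bar>c\<bar>) / real (Suc (length cs))) ^ k + abs_sum k cs"

lemma pos_sum_nonneg: "pos_sum k cs \<ge> 0"
  by (induction cs) auto

lemma abs_sum_nonneg: "abs_sum k cs \<ge> 0"
  by (induction cs) auto

lemma abs_sum_uminus: "abs_sum k (map uminus cs) = abs_sum k cs"
  by (induction cs) auto

lemma contents_props:
  "is_tableau T \<Longrightarrow> list_all (\<lambda>c. c \<ge> 0 \<or> c \<le> -1) (contents T)"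
proof (induction T)
  case (Cons i T)
  have "rowc T i \<ge> 0 \<or> rowc T i \<le> -1" by (auto simp: rowc_def)
  then show ?case using Cons by simp
qed simp

lemma abs_rowc_le:
  assumes "is_tableau T" "addable T i"
  shows "\<bar>rowc T i\<bar> \<le> real (length T)"
proof -
  have "i \<le> length T" using addable_le_length[OF assms(2)] is_tableau_less_length[OF assms(1)] by blast
  then show ?thesis using count_le_length[of T i] by (simp add: rowc_def abs_if)
qed

lemma eig_sum_le_pos_sum:
  assumes "odd k" "list_all (\<lambda>c. c \<ge> 0 \<or> c \<le> -1) cs"
  shows "eig_sum k cs \<le> pos_sum k cs"
  using assms(2)
proof (induction cs)
  case (Cons c cs)
  have "((1 + c) / real (Suc (length cs))) ^ k \<le> 0" if "\<not> c \<ge> 0"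
    using that Cons assms(1) by (simp add: power_le_zero_eq divide_nonpos_pos odd_pos)
  then show ?case using Cons by auto
qed simp

text \<open>For odd k and c \<le> 0, -(1 + c)^k = (-1 - c)^k \<le> (1 - c)^k, which is the term of
  the transposed tableau. For c > 0 the term -(1 + c)^k is negative.\<close>

lemma minus_eig_sum_le_pos_sum:
  assumes "odd k"
  shows "- eig_sum k cs \<le> pos_sum k (map uminus cs)"
proof (induction cs)
  case (Cons c cs)
  let ?j = "real (Suc (length cs))"
  have "- (((1 + c) / ?j) ^ k) \<le> (if - c \<ge> 0 then ((1 + - c) / ?j) ^ k else 0)"
  proof (cases "- c \<ge> 0")
    case True
    have "- (((1 + c) / ?j) ^ k) = ((- 1 - c) / ?j) ^ k"
      using assms by (metis (no_types, opaque_lifting) minus_add_distrib minus_divide_left power_minus_odd uminus_add_conv_diff add.commute)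
    also have "\<dots> \<le> ((1 + - c) / ?j) ^ k"
      using assms by (intro power_mono_odd divide_right_mono) auto
    finally show ?thesis using True by simp
  next
    case False
    then have "((1 + c) / ?j) ^ k \<ge> 0" by simp
    then show ?thesis using False by simp
  qed
  from add_mono[OF this Cons.IH] show ?case
    by (simp only: eig_sum.simps pos_sum.simps list.map length_map minus_add_distrib)
qed simp

lemma unit_interval_power: "0 \<le> x \<Longrightarrow> x \<le> 1 \<Longrightarrow> a \<le> b \<Longrightarrow> x ^ b \<le> (x :: real) ^ a"
  by (rule power_decreasing)

text \<open>Box number j has |c| \<le> j - 1, so each ratio (1 + |c|) / j is at most 1 and the
  exponent may be lowered.\<close>

lemma abs_eig_sum_le_abs_sum:
  assumes "is_tableau T" "a \<le> k"
  shows "\<bar>eig_sum k (contents T)\<bar> \<le> abs_sum a (contents T)"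
  using assms(1)
proof (induction T)
  case (Cons i T)
  let ?x = "(1 + \<bar>rowc T i\<bar>) / real (Suc (length T))"
  have x: "0 \<le> ?x" "?x \<le> 1" using abs_rowc_le[of T i] Cons.prems by (auto simp: divide_simps)
  have "\<bar>((1 + rowc T i) / real (Suc (length T))) ^ k\<bar> \<le> ?x ^ k"
    unfolding power_abs by (intro power_mono) (auto simp: divide_simps)
  also have "\<dots> \<le> ?x ^ a" by (rule unit_interval_power[OF x assms(2)])
  finally show ?case using Cons by (simp add: abs_le_iff)
qed simp

lemma pos_sum_le_abs_sum:
  assumes "is_tableau T" "a \<le> k"
  shows "pos_sum k (contents T) \<le> abs_sum a (contents T)"
  using assms(1)
proof (induction T)
  case (Cons i T)
  let ?x = "(1 + \<bar>rowc T i\<bar>) / real (Suc (length T))"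
  have x: "0 \<le> ?x" "?x \<le> 1" using abs_rowc_le[of T i] Cons.prems by (auto simp: divide_simps)
  have "?x ^ k \<le> ?x ^ a" by (rule unit_interval_power[OF x assms(2)])
  then have "(if rowc T i \<ge> 0 then ((1 + rowc T i) / real (Suc (length T))) ^ k else 0) \<le> ?x ^ a"
    using x(1) by (cases "rowc T i \<ge> 0") (simp_all del: of_nat_Suc)
  from add_mono[OF this Cons.IH] show ?case
    using Cons.prems by (simp only: contents.simps pos_sum.simps abs_sum.simps length_contents is_tableau.simps)
qed simp

lemma count_0_pos: "is_tableau T \<Longrightarrow> T \<noteq> [] \<Longrightarrow> count_list T 0 \<ge> 1"
proof -
  assume y: "is_tableau T" and ne: "T \<noteq> []"
  then have "count_list T (hd T) \<noteq> 0" by (simp add: count_list_0_iff)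
  then show ?thesis using is_tableau_antimono_le[OF y, of 0 "hd T"] by simp
qed

text \<open>With q boxes in the first row, s below it and n = q + s, a first-row step has ratio 1 -
  s / (n + 1). A lower step has |content| \<le> s + 1 and thus ratio at most 1 - (q - 1) / (n + 1).
  These losses are exactly the increments of the numerator s (q - 1), and a growing denominator only
  weakens the earlier loss.\<close>

lemma abs_sum_1_bound:
  assumes "is_tableau T"
  shows "abs_sum 1 (contents T) \<le> real (length T) - real (length (lower_rows T)) * (real (count_list T 0) - 1) / real (length T)"
  using assms
proof (induction T)
  case (Cons i U)
  then have U: "is_tableau U" and add: "addable U i" by auto
  define n where "n = real (length U)"
  define s where "s = real (length (lower_rows U))"
  define q where "q = real (count_list U 0)"
  have nqs: "n = q + s" using length_lower_rows[of U] by (simp add: n_def s_def q_def)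
  have nn: "n \<ge> 0" "s \<ge> 0" "q \<ge> 0" by (auto simp: n_def s_def q_def)
  have q1: "q \<ge> 1 \<or> n = 0" using count_0_pos[OF U] by (auto simp: q_def n_def)
  have IH: "abs_sum 1 (contents U) \<le> n - s * (q - 1) / n" using Cons by (simp add: n_def s_def q_def)
  have dec: "s * (q - 1) / (n + 1) \<le> s * (q - 1) / n"
  proof (cases "n = 0")
    case True
    then have "s = 0" using nn nqs by linarith
    then show ?thesis by simp
  next
    case False
    then show ?thesis using q1 nn by (intro divide_left_mono mult_nonneg_nonneg) auto
  qed
  show ?case
  proof (cases i)
    case 0
    have "(1 + q) / (n + 1) = 1 - s / (n + 1)" using nn by (simp add: nqs field_simps)
    moreover have "s * (q - 1) / (n + 1) + s / (n + 1) = s * q / (n + 1)"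
      by (simp add: add_divide_distrib[symmetric] algebra_simps)
    ultimately have "(1 + q) / (n + 1) + abs_sum 1 (contents U) \<le> n + 1 - s * q / (n + 1)"
      using IH dec by linarith
    moreover have "\<bar>rowc U 0\<bar> = q" by (simp add: rowc_def q_def)
    ultimately show ?thesis
      by (simp add: 0 n_def s_def q_def add.commute)
  next
    case (Suc r)
    have "addable (lower_rows U) r" using add Suc by (cases r) (auto simp: addable_def count_lower_rows)
    then have r: "r \<le> length (lower_rows U)"
      using addable_le_length is_tableau_less_length[OF is_tableau_lower_rows[OF U]] by blast
    have "count_list U (Suc r) \<le> length (lower_rows U)" using count_le_length[of "lower_rows U" r] by (simp add: count_lower_rows)
    with r have "\<bar>rowc U i\<bar> \<le> s + 1" by (simp add: rowc_def s_def Suc abs_if)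
    then have "(1 + \<bar>rowc U i\<bar>) / (n + 1) \<le> (s + 2) / (n + 1)"
      using nn by (intro divide_right_mono) auto
    also have "\<dots> = 1 - (q - 1) / (n + 1)" using nn by (simp add: nqs field_simps)
    finally have 1: "(1 + \<bar>rowc U i\<bar>) / (n + 1) \<le> 1 - (q - 1) / (n + 1)" .
    have "s * (q - 1) / (n + 1) + (q - 1) / (n + 1) = (s + 1) * (q - 1) / (n + 1)"
      by (simp add: add_divide_distrib[symmetric] algebra_simps)
    then have "(1 + \<bar>rowc U i\<bar>) / (n + 1) + abs_sum 1 (contents U) \<le> n + 1 - (s + 1) * (q - 1) / (n + 1)"
      using IH dec 1 by linarith
    then show ?thesis
      by (simp add: Suc n_def s_def q_def add.commute)
  qed
qed simp

text \<open>The head of the list is the most recent step, so \<open>True \<in> set bs\<close> refers to earlier steps.\<close>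

primrec gap :: "bool list \<Rightarrow> nat" where
  "gap [] = 0"
| "gap (b # bs) = (if \<not> b \<and> True \<in> set bs then 1 else 0) + gap bs"

abbreviation bools :: "nat list \<Rightarrow> bool list" where "bools T \<equiv> map (\<lambda>i. i \<noteq> 0) T"

lemma count_two_rows: "i \<noteq> j \<Longrightarrow> count_list T i + count_list T j \<le> length T"
  by (induction T) auto

text \<open>A step into row i > 0 requires row i - 1 to be longer, so row i holds at most half of
  the boxes, and a counted ratio is at most 1/2. A first-row step after a lower one misses at least
  one box, so its ratio is at most 1 - 1/n.\<close>

lemma pos_sum_bound:
  assumes "is_tableau T" "length T \<le> n" "n \<ge> 1"
  shows "pos_sum k (contents T) \<le> real (length (lower_rows T)) * (1 / 2) ^ k + real (count_list T 0)
    - real (gap (bools T)) * (1 - (1 - 1 / real n) ^ k)"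
  using assms(1,2)
proof (induction T)
  case (Cons i U)
  then have U: "is_tableau U" and add: "addable U i" and len: "Suc (length U) \<le> n" by auto
  let ?m = "real (Suc (length U))"
  have IH: "pos_sum k (contents U) \<le> real (length (lower_rows U)) * (1 / 2) ^ k + real (count_list U 0)
    - real (gap (bools U)) * (1 - (1 - 1 / real n) ^ k)" using Cons by auto
  show ?case
  proof (cases i)
    case 0
    have q: "rowc U 0 = real (count_list U 0)" by (simp add: rowc_def)
    have "((1 + rowc U 0) / ?m) ^ k \<le> 1 - (if True \<in> set (bools U) then 1 - (1 - 1 / real n) ^ k else 0)"
    proof (cases "True \<in> set (bools U)")
      case True
      then have "length (lower_rows U) \<ge> 1"
        unfolding length_lower_rows_bools using count_list_0_iff[of "bools U" True] by linarith
      then have "count_list U 0 + 1 \<le> length U" using length_lower_rows[of U] by linarith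
      then have "(1 + rowc U 0) / ?m \<le> (?m - 1) / ?m" unfolding q by (intro divide_right_mono) auto
      also have "\<dots> = 1 - 1 / ?m" by (simp add: field_simps)
      also have "\<dots> \<le> 1 - 1 / real n" using len by (intro diff_left_mono divide_left_mono) auto
      finally have "((1 + rowc U 0) / ?m) ^ k \<le> (1 - 1 / real n) ^ k"
        by (rule power_mono) (simp add: q)
      then show ?thesis using True by simp
    next
      case False
      have "((1 + rowc U 0) / ?m) ^ k \<le> 1"
        using count_le_length[of U 0] by (intro power_le_one) (auto simp: q divide_simps)
      then show ?thesis by (simp only: if_not_P[OF False] diff_0_right)
    qed
    moreover have "pos_sum k (contents (0 # U)) = ((1 + rowc U 0) / ?m) ^ k + pos_sum k (contents U)"
      by (simp add: q del: of_nat_Suc)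
    moreover have "real (gap (bools (0 # U))) * D = (if True \<in> set (bools U) then D else 0) + real (gap (bools U)) * D" for D
    proof -
      have "real ((if P then 1 else 0) + l) * D = (if P then D else 0) + real l * D" for P l
        by (simp add: distrib_right)
      moreover have "gap (bools (0 # U)) = (if True \<in> set (bools U) then 1 else 0) + gap (bools U)"
        by (simp only: list.map gap.simps simp_thms)
      ultimately show ?thesis by (simp only:)
    qed
    moreover have "real (count_list (0 # U) 0) = 1 + real (count_list U 0)" by simp
    ultimately show ?thesis using IH unfolding 0 by (simp only: lower_rows_simps)
  next
    case (Suc r)
    have "(if rowc U i \<ge> 0 then ((1 + rowc U i) / ?m) ^ k else 0) \<le> (1 / 2) ^ k"
    proof (cases "rowc U i \<ge> 0")
      case True
      have "count_list U i < count_list U r" using add Suc by (auto simp: addable_def)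
      then have "2 * count_list U i \<le> length U" using count_two_rows[of i r U] Suc by simp
      then have "1 + rowc U i \<le> ?m / 2" unfolding rowc_def Suc by simp
      then have "(1 + rowc U i) / ?m \<le> 1 / 2" by (simp add: divide_simps)
      then show ?thesis using True by (simp add: power_mono del: of_nat_Suc)
    qed simp
    moreover have "pos_sum k (contents (i # U)) = (if rowc U i \<ge> 0 then ((1 + rowc U i) / ?m) ^ k else 0) + pos_sum k (contents U)"
      by (simp del: of_nat_Suc)
    moreover have "real (length (lower_rows (i # U))) * D = D + real (length (lower_rows U)) * D" for D
      by (simp add: Suc algebra_simps)
    moreover have "count_list (i # U) 0 = count_list U 0" "gap (bools (i # U)) = gap (bools U)"
      by (simp_all add: Suc)
    ultimately show ?thesis using IH by (simp only:)
  qed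
qed simp

lemma contents_le_first_row: "is_tableau T \<Longrightarrow> c \<in> set (contents T) \<Longrightarrow> c \<le> real (count_list T 0) - 1"
proof (induction T)
  case (Cons i U)
  have "rowc U i \<le> real (count_list (i # U) 0) - 1"
    using is_tableau_antimono_le[of U 0 i] Cons by (cases i) (auto simp: rowc_def)
  moreover have "count_list U 0 \<le> count_list (i # U) 0" by simp
  ultimately show ?case using Cons by fastforce
qed simp

text \<open>Box j contributes at most 1, and at most (q / j)^2 for j > q. There q^2 / (j (j - 1))
  telescopes to q - q^2 / n, in addition to the q from the first boxes.\<close>

lemma abs_sum_2_cap:
  assumes "is_tableau T" "q \<ge> 1" "\<And>c. c \<in> set (contents T) \<Longrightarrow> 1 + \<bar>c\<bar> \<le> real q"
  shows "abs_sum 2 (contents T) \<le> (if length T \<le> q then real (length T) else 2 * real q - (real q)\<^sup>2 / real (length T))"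
  using assms(1,3)
proof (induction T)
  case (Cons i U)
  then have U: "is_tableau U" and add: "addable U i" and c: "1 + \<bar>rowc U i\<bar> \<le> real q" by auto
  let ?n = "real (length U)"
  have IH: "abs_sum 2 (contents U) \<le> (if length U \<le> q then ?n else 2 * real q - (real q)\<^sup>2 / ?n)"
    using Cons by auto
  let ?x = "(1 + \<bar>rowc U i\<bar>) / real (Suc (length U))"
  have x: "0 \<le> ?x" "?x \<le> 1" using abs_rowc_le[OF U add] by (auto simp: divide_simps)
  show ?case
  proof (cases "Suc (length U) \<le> q")
    case True
    then show ?thesis using IH power_le_one[OF x, of 2] by simp
  next
    case False
    then have n: "?n \<ge> real q" "?n \<ge> 1" using assms(2) by auto
    have "?x\<^sup>2 \<le> (real q / (?n + 1))\<^sup>2"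
      using c x by (intro power_mono) (auto intro: divide_right_mono simp: add.commute)
    also have "\<dots> \<le> (real q)\<^sup>2 / (?n * (?n + 1))"
      unfolding power_divide using n by (intro divide_left_mono mult_pos_pos) (auto simp: power2_eq_square)
    also have "\<dots> = (real q)\<^sup>2 / ?n - (real q)\<^sup>2 / (?n + 1)"
    proof -
      have "a / (b * (b + 1)) = a / b - a / (b + 1)" if "b \<ge> 1" for a b :: real
        using that by (simp add: field_simps)
      then show ?thesis using n(2) .
    qed
    finally have 1: "?x\<^sup>2 \<le> (real q)\<^sup>2 / ?n - (real q)\<^sup>2 / (?n + 1)" .
    have "abs_sum 2 (contents U) \<le> 2 * real q - (real q)\<^sup>2 / ?n"
    proof (cases "length U \<le> q")
      case True
      then have "length U = q" using False by simp
      then show ?thesis using IH n by (simp add: power2_eq_square)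
    qed (use IH in simp)
    then show ?thesis using 1 False by (simp add: add.commute)
  qed
qed simp

section \<open>The trivial and the sign representation\<close>

primrec row_contents :: "nat \<Rightarrow> real list" where
  "row_contents 0 = []"
| "row_contents (Suc n) = real n # row_contents n"

lemma length_row_contents [simp]: "length (row_contents n) = n" by (induction n) auto

lemma contents_row_contents: "T \<in> tableaux n \<Longrightarrow> contents T = row_contents n \<longleftrightarrow> T = replicate n 0"
proof (induction n arbitrary: T)
  case (Suc n)
  then obtain r U where T: "T = r # U" "U \<in> tableaux n" "addable U r" unfolding tableaux_Suc by auto
  have "contents U = row_contents n \<longleftrightarrow> U = replicate n 0" using Suc.IH[OF T(2)] .
  moreover have "rowc U r = real n \<Longrightarrow> r = 0"
    using count_le_length[of U r] T(2) by (auto simp: rowc_def tableaux_def)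
  moreover have "rowc (replicate n 0) 0 = real n"
    by (induction n) (simp_all add: rowc_def)
  ultimately show ?case using T by auto
qed (simp add: tableaux_0)

lemma replicate_tableaux: "replicate n 0 \<in> tableaux n"
  by (induction n) (auto simp: tableaux_def addable_def)

lemma sum_planch_trivial:
  "fact n * (\<Sum>T\<in>tableaux n. planch (Suc n) T * (if contents T = row_contents n then 1 else 0)) \<le> 1"
proof -
  let ?T = "replicate n (0 :: nat)"
  have "(\<Sum>T\<in>tableaux n. planch (Suc n) T * (if contents T = row_contents n then 1 else 0)) = (\<Sum>T\<in>tableaux n. if T = ?T then planch (Suc n) T else 0)"
    by (rule sum.cong) (auto simp: contents_row_contents)
  also have "\<dots> = planch (Suc n) ?T" using finite_tableaux replicate_tableaux by simp
  also have "\<dots> \<le> planch n (lower_rows ?T) / fact (count_list ?T 0)"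
  proof -
    have "is_tableau ?T" using replicate_tableaux[of n] by (simp add: tableaux_def)
    then show ?thesis using planch_le[of ?T n] by simp
  qed
  also have "lower_rows ?T = []" by (induction n) auto
  also have "count_list ?T 0 = n" by (induction n) auto
  finally show ?thesis by (simp add: field_simps)
qed

lemma abs_eig_sum_le_length: "is_tableau T \<Longrightarrow> \<bar>eig_sum k (contents T)\<bar> \<le> real (length T)"
proof -
  assume "is_tableau T"
  then have "\<bar>eig_sum k (contents T)\<bar> \<le> abs_sum 0 (contents T)" by (rule abs_eig_sum_le_abs_sum) simp
  also have "\<dots> = real (length T)" by (induction T) auto
  finally show ?thesis .
qed

text \<open>The second box of the column has content -1, so its factor 1 + c is 0; every other term
  has absolute value at most 1.\<close>

lemma abs_eig_sum_column:
  assumes "n \<ge> 2" "k \<ge> 1"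
  shows "\<bar>eig_sum k (map uminus (row_contents n))\<bar> \<le> real n - 1"
  using assms(1)
proof (induction n rule: dec_induct)
  case base
  then show ?case using assms(2) by (cases k) (auto simp: numeral_2_eq_2)
next
  case (step n)
  have "\<bar>((1 - real n) / real (Suc n)) ^ k\<bar> \<le> 1"
    unfolding power_abs by (intro power_le_one) (auto simp: divide_simps)
  then show ?case using step by (simp del: of_nat_Suc add: abs_le_iff) 
qed

lemma power_abs_mono:
  fixes x y :: real
  assumes "\<bar>x\<bar> \<le> y"
  shows "x ^ (2 * t) \<le> y ^ (2 * t)"
  using power_mono[OF assms, of "2 * t"] by (simp add: power_even_abs)

lemma sum_bool_lists_restrict:
  "(\<Sum>bs\<in>bool_lists n. (if True \<in> set bs then u bs else 0) / fact (count_list bs False)) =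
   (\<Sum>bs\<in>{bs\<in>bool_lists n. True \<in> set bs}. u bs / fact (count_list bs False))" for u :: "bool list \<Rightarrow> real"
  by (rule sum.mono_neutral_cong_right) (auto simp: finite_bool_lists)

text \<open>\<open>h\<close> may be charged to a tableau or to its transpose, and \<open>u\<close>
  majorises it by a function of the pattern alone. The trivial representation cancels the subtracted
  1, and the sign representation yields the last summand.\<close>

lemma l2_reduction:
  fixes h :: "real list \<Rightarrow> real" and u :: "bool list \<Rightarrow> real"
  assumes n: "n \<ge> 2" and k: "k \<ge> 1"
    and h: "\<And>T. T \<in> tableaux n \<Longrightarrow> (eig_sum k (contents T) / real n) ^ (2 * t) \<le> h (contents T) + h (map uminus (contents T))"
    and hu: "\<And>T. T \<in> tableaux n \<Longrightarrow> True \<in> set (bools T) \<Longrightarrow> h (contents T) \<le> u (bools T)"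
    and u: "\<And>bs. u bs \<ge> 0" and h0: "\<And>cs. h cs \<ge> 0"
  shows "(l2_dist n (shuffle_steps n k t id) (uniform n))\<^sup>2 \<le>
    2 * (\<Sum>bs\<in>{bs\<in>bool_lists n. True \<in> set bs}. fact n / fact (count_list bs False) * u bs) + (1 - 1 / real n) ^ (2 * t)"
proof -
  let ?W = "planch (Suc n)"
  \<comment> \<open>The pattern of the one-row tableau contains no \<open>True\<close>, so
    \<open>u\<close> gives no bound there. \<open>h\<close> is cut to 0 at that point and the
    indicator \<open>d\<close> takes over.\<close>
  define h' where "h' cs = (if cs = row_contents n then 0 else h cs)" for cs
  define d where "d cs = (if cs = row_contents n then 1 else 0 :: real)" for cs
  define c where "c = (1 - 1 / real n) ^ (2 * t)"
  have c0: "c \<ge> 0" using n by (simp add: c_def)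
  have W: "?W T \<ge> 0" if "T \<in> tableaux n" for T using that by (intro planch_nonneg) (auto simp: tableaux_def)
  have pt: "(eig_sum k (contents T) / real n) ^ (2 * t) \<le> d (contents T) + d (map uminus (contents T)) * c + h' (contents T) + h' (map uminus (contents T))"
    if T: "T \<in> tableaux n" for T
  proof (cases "contents T = row_contents n \<or> map uminus (contents T) = row_contents n")
    case True
    have nn: "h' cs \<ge> 0" "d cs \<ge> 0" for cs using h0 by (auto simp: h'_def d_def)
    show ?thesis
    proof (cases "contents T = row_contents n")
      case True
      have "\<bar>eig_sum k (contents T) / real n\<bar> \<le> 1"
        using abs_eig_sum_le_length[of T k] T n by (auto simp: tableaux_def divide_simps)
      from power_abs_mono[OF this, of t] have "(eig_sum k (contents T) / real n) ^ (2 * t) \<le> d (contents T)"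
        using True by (simp add: d_def)
      then show ?thesis using nn[of "contents T"] nn[of "map uminus (contents T)"] c0 mult_nonneg_nonneg[OF nn(2) c0, of "map uminus (contents T)"] by linarith
    next
      case False
      with True have z: "map uminus (contents T) = row_contents n" by simp
      have "map uminus (map uminus (contents T)) = map uminus (row_contents n)" using z by simp
      then have e: "contents T = map uminus (row_contents n)" by (simp add: o_def)
      have "\<bar>eig_sum k (contents T) / real n\<bar> \<le> 1 - 1 / real n"
        using abs_eig_sum_column[OF n k] n unfolding e abs_divide by (simp add: divide_simps)
      from power_abs_mono[OF this, of t] have "(eig_sum k (contents T) / real n) ^ (2 * t) \<le> d (map uminus (contents T)) * c"
        using z by (simp add: d_def c_def)
      then show ?thesis using nn[of "contents T"] nn[of "map uminus (contents T)"] by linarith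
    qed
  next
    case False
    then show ?thesis using h[OF T] by (simp add: h'_def d_def)
  qed
  have "(\<Sum>T\<in>tableaux n. ?W T * (eig_sum k (contents T) / real n) ^ (2 * t)) \<le>
    (\<Sum>T\<in>tableaux n. ?W T * (d (contents T) + d (map uminus (contents T)) * c + h' (contents T) + h' (map uminus (contents T))))"
    by (intro sum_mono mult_left_mono pt W)
  also have "\<dots> = (\<Sum>T\<in>tableaux n. ?W T * d (contents T)) + (\<Sum>T\<in>tableaux n. ?W T * d (map uminus (contents T))) * c
     + (\<Sum>T\<in>tableaux n. ?W T * h' (contents T)) + (\<Sum>T\<in>tableaux n. ?W T * h' (map uminus (contents T)))"
    by (simp add: sum.distrib sum_distrib_left sum_distrib_right algebra_simps)
  also have "\<dots> = (\<Sum>T\<in>tableaux n. ?W T * d (contents T)) * (1 + c) + 2 * (\<Sum>T\<in>tableaux n. ?W T * h' (contents T))"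
    using law_symmetric[of n "Suc n" d] law_symmetric[of n "Suc n" h'] by (simp add: algebra_simps)
  finally have "fact n * (\<Sum>T\<in>tableaux n. ?W T * (eig_sum k (contents T) / real n) ^ (2 * t)) \<le>
     fact n * (\<Sum>T\<in>tableaux n. ?W T * d (contents T)) * (1 + c) + 2 * (fact n * (\<Sum>T\<in>tableaux n. ?W T * h' (contents T)))"
    by (simp add: algebra_simps flip: distrib_left)
  also have "fact n * (\<Sum>T\<in>tableaux n. ?W T * d (contents T)) * (1 + c) \<le> 1 * (1 + c)"
    using sum_planch_trivial[of n] c0 unfolding d_def by (intro mult_right_mono) auto
  also have "(\<Sum>T\<in>tableaux n. ?W T * h' (contents T)) \<le> (\<Sum>bs\<in>bool_lists n. (if True \<in> set bs then u bs else 0) / fact (count_list bs False))"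
  proof (rule sum_planch_le_sum_bools)
    fix T assume T: "T \<in> tableaux n"
    show "h' (contents T) \<le> (if True \<in> set (bools T) then u (bools T) else 0)"
    proof (cases "True \<in> set (bools T)")
      case True
      then show ?thesis using hu[OF T True] u[of "bools T"] by (simp add: h'_def)
    next
      case False
      then have "T = replicate n 0" using T by (auto simp: tableaux_def intro!: replicate_eqI)
      then show ?thesis using False contents_row_contents[OF T] by (simp add: h'_def)
    qed
  qed (use u in auto)
  finally have "fact n * (\<Sum>T\<in>tableaux n. ?W T * (eig_sum k (contents T) / real n) ^ (2 * t)) \<le>
     1 + c + 2 * (fact n * (\<Sum>bs\<in>{bs\<in>bool_lists n. True \<in> set bs}. u bs / fact (count_list bs False)))"
    unfolding sum_bool_lists_restrict by simp
  then show ?thesis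
    using l2_dist_formula[of n k t] n by (simp add: c_def sum_distrib_left)
qed

text \<open>The first bound is sharp for \<open>m = o(n)\<close>, but tends back to \<open>1\<close> as \<open>m\<close> approaches \<open>n\<close>, where
  it has to be replaced by the second one.\<close>

definition rate :: "nat \<Rightarrow> nat \<Rightarrow> real" where
  "rate n m = (if 2 * m + 2 \<le> n then 1 - real m * (real n - real m - 1) / (real n)\<^sup>2
     else 1 - real m * (real n - 1) / (2 * (real n)\<^sup>2))"

lemma rate_nonneg: "m \<le> n \<Longrightarrow> n \<ge> 1 \<Longrightarrow> rate n m \<ge> 0"
proof -
  assume m: "m \<le> n" "n \<ge> 1"
  have "real m * (real n - real m - 1) \<le> real n * real n"
  proof (cases "real n - real m - 1 \<ge> 0")
    case True
    then show ?thesis using m by (intro mult_mono) auto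
  next
    case False
    then have "real m * (real n - real m - 1) \<le> 0" by (intro mult_nonneg_nonpos) auto
    then show ?thesis using mult_nonneg_nonneg[of "real n" "real n"] by linarith
  qed
  moreover have "real m * (real n - 1) \<le> 2 * (real n * real n)"
  proof -
    have "real m * (real n - 1) \<le> real n * real n" using m by (intro mult_mono) auto
    then show ?thesis using mult_nonneg_nonneg[of "real n" "real n"] by linarith
  qed
  ultimately show ?thesis using m by (auto simp: rate_def divide_simps power2_eq_square)
qed

lemma rate_bound:
  fixes x :: real
  assumes "n = q + m" "n \<ge> 1" "x \<le> real n - real m * (real q - 1) / real n"
    "2 * m + 2 > n \<Longrightarrow> x \<le> real n - real m * (real n - 1) / (2 * real n)"
  shows "x / real n \<le> rate n m"
proof (cases "2 * m + 2 \<le> n")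
  case True
  have "x / real n \<le> (real n - real m * (real q - 1) / real n) / real n"
    using assms by (intro divide_right_mono) auto
  also have "\<dots> = rate n m"
  proof -
    have "real q - 1 = real n - real m - 1" using assms(1) by simp
    then show ?thesis using True assms(2) by (simp add: rate_def diff_divide_distrib power2_eq_square)
  qed
  finally show ?thesis .
next
  case False
  have "x / real n \<le> (real n - real m * (real n - 1) / (2 * real n)) / real n"
    using assms False by (intro divide_right_mono) auto
  also have "\<dots> = rate n m"
    using False assms(2) by (simp add: rate_def diff_divide_distrib power2_eq_square)
  finally show ?thesis .
qed

lemma pos_sum_rate:
  assumes "T \<in> tableaux n" "n \<ge> 1" "k \<ge> 1"
  shows "pos_sum k (contents T) / real n \<le> rate n (count_list (bools T) True)"
proof -
  have y: "is_tableau T" "length T = n" using assms by (auto simp: tableaux_def)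
  define m where "m = count_list (bools T) True"
  define q where "q = count_list T 0"
  have m: "length (lower_rows T) = m" by (simp add: m_def length_lower_rows_bools)
  have n: "n = q + m" using length_lower_rows[of T] y m by (simp add: q_def)
  show ?thesis unfolding m_def[symmetric]
  proof (rule rate_bound[OF n assms(2)])
    show "pos_sum k (contents T) \<le> real n - real m * (real q - 1) / real n"
      using pos_sum_le_abs_sum[OF y(1) assms(3)] abs_sum_1_bound[OF y(1)] by (simp add: y m q_def)
    have "pos_sum k (contents T) \<le> real m * (1 / 2) ^ k + real q - real (gap (bools T)) * (1 - (1 - 1 / real n) ^ k)"
      using pos_sum_bound[OF y(1), of n k] assms by (simp add: y m q_def)
    also have "\<dots> \<le> real m * (1 / 2) ^ k + real q"
      using assms(2) by (simp add: power_le_one)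
    also have "\<dots> \<le> real m * (1 / 2) + real q"
      using power_decreasing[OF assms(3), of "1 / 2 :: real"] by (intro add_right_mono mult_left_mono) auto
    also have "\<dots> \<le> real n - real m * (real n - 1) / (2 * real n)"
      using assms(2) n by (simp add: field_simps)
    finally show "pos_sum k (contents T) \<le> real n - real m * (real n - 1) / (2 * real n)" .
  qed
qed

text \<open>For the contents of a tableau: the first column is not longer than the first row.\<close>

definition row_dominant :: "real list \<Rightarrow> bool" where
  "row_dominant cs \<longleftrightarrow> (\<forall>c\<in>set cs. \<exists>d\<in>set cs. - c \<le> d)"

text \<open>Compare the largest content with the negative of the smallest one.\<close>

lemma row_dominant_uminus: "row_dominant cs \<or> row_dominant (map uminus cs)"
proof (rule ccontr)
  assume "\<not> ?thesis"
  then obtain c where c: "c \<in> set cs" "\<And>d. d \<in> set cs \<Longrightarrow> d < - c" "\<not> row_dominant (map uminus cs)"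
    by (auto simp: row_dominant_def not_le)
  from c(3) obtain e where e: "e \<in> set cs" "\<And>d. d \<in> set cs \<Longrightarrow> - e < d"
    by (auto simp: row_dominant_def not_le)
  show False using c(2)[OF e(1)] e(2)[OF c(1)] by simp
qed

text \<open>For m up to about n / 2 exponent 1 is enough. Beyond that, row dominance bounds every 1
  + |c| by the first row q, and \<open>abs_sum_2_cap\<close> gives n - m^2 / n, where m \<ge> (n -
  1) / 2.\<close>

lemma abs_sum_rate:
  assumes "T \<in> tableaux n" "n \<ge> 1" "row_dominant (contents T)"
  shows "abs_sum 2 (contents T) / real n \<le> rate n (count_list (bools T) True)"
proof -
  have y: "is_tableau T" "length T = n" using assms by (auto simp: tableaux_def)
  define m where "m = count_list (bools T) True"
  define q where "q = count_list T 0"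
  have m: "length (lower_rows T) = m" by (simp add: m_def length_lower_rows_bools)
  have n: "n = q + m" using length_lower_rows[of T] y m by (simp add: q_def)
  have "T \<noteq> []" using y assms(2) by auto
  then have q1: "q \<ge> 1" using count_0_pos[OF y(1)] by (simp add: q_def)
  show ?thesis unfolding m_def[symmetric]
  proof (rule rate_bound[OF n assms(2)])
    have ae12: "abs_sum 2 cs \<le> abs_sum 1 cs" if "cs = contents U" "is_tableau U" for cs U
      using that
    proof (induction U arbitrary: cs)
      case (Cons i U)
      let ?x = "(1 + \<bar>rowc U i\<bar>) / real (Suc (length U))"
      have "0 \<le> ?x" "?x \<le> 1" using abs_rowc_le[of U i] Cons.prems by (auto simp: divide_simps)
      from unit_interval_power[OF this, of 1 2] show ?case using Cons by (simp del: of_nat_Suc)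
    qed simp
    show "abs_sum 2 (contents T) \<le> real n - real m * (real q - 1) / real n"
      using ae12[OF refl y(1)] abs_sum_1_bound[OF y(1)] by (simp add: y m q_def)
    assume big: "2 * m + 2 > n"
    have "1 + \<bar>c\<bar> \<le> real q" if c: "c \<in> set (contents T)" for c
    proof -
      obtain d where "d \<in> set (contents T)" "- c \<le> d" using assms(3) c by (auto simp: row_dominant_def)
      then show ?thesis
        using contents_le_first_row[OF y(1), of c] contents_le_first_row[OF y(1), of d] c unfolding q_def by linarith
    qed
    from abs_sum_2_cap[OF y(1) q1 this] have "abs_sum 2 (contents T) \<le> 2 * real q - (real q)\<^sup>2 / real n"
      using y n by (auto simp: power2_eq_square split: if_splits)
    also have "\<dots> = real n - (real m)\<^sup>2 / real n"
      using n assms(2) by (simp add: field_simps power2_eq_square)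
    also have "\<dots> \<le> real n - real m * (real n - 1) / (2 * real n)"
    proof -
      have "real m * (real n - 1) \<le> real m * (2 * real m)" using big by (intro mult_left_mono) auto
      then have "real m * (real n - 1) / (2 * real n) \<le> real m * (2 * real m) / (2 * real n)"
        by (intro divide_right_mono) auto
      also have "\<dots> = (real m)\<^sup>2 / real n" by (simp add: power2_eq_square)
      finally show ?thesis by simp
    qed
    finally show "abs_sum 2 (contents T) \<le> real n - real m * (real n - 1) / (2 * real n)" .
  qed
qed

lemma odd_split:
  assumes "odd k" "T \<in> tableaux n"
  shows "(eig_sum k (contents T) / real n) ^ (2 * t) \<le> (pos_sum k (contents T) / real n) ^ (2 * t) + (pos_sum k (map uminus (contents T)) / real n) ^ (2 * t)"
proof -
  have "eig_sum k (contents T) \<le> pos_sum k (contents T)" "- eig_sum k (contents T) \<le> pos_sum k (map uminus (contents T))"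
    using assms contents_props by (auto intro: eig_sum_le_pos_sum minus_eig_sum_le_pos_sum simp: tableaux_def)
  then have "\<bar>eig_sum k (contents T)\<bar> \<le> pos_sum k (contents T) \<or> \<bar>eig_sum k (contents T)\<bar> \<le> pos_sum k (map uminus (contents T))" by linarith
  then show ?thesis
  proof
    assume "\<bar>eig_sum k (contents T)\<bar> \<le> pos_sum k (contents T)"
    then have "\<bar>eig_sum k (contents T) / real n\<bar> \<le> pos_sum k (contents T) / real n" by (simp add: divide_right_mono)
    from power_abs_mono[OF this, of t] show ?thesis
      using pos_sum_nonneg[of k "map uminus (contents T)"] by (simp add: add_increasing2)
  next
    assume "\<bar>eig_sum k (contents T)\<bar> \<le> pos_sum k (map uminus (contents T))"
    then have "\<bar>eig_sum k (contents T) / real n\<bar> \<le> pos_sum k (map uminus (contents T)) / real n" by (simp add: divide_right_mono)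
    from power_abs_mono[OF this, of t] show ?thesis
      using pos_sum_nonneg[of k "contents T"] by (simp add: add_increasing)
  qed
qed

section \<open>Bounding the distance by sums over patterns\<close>

lemma sum_bool_lists_count:
  fixes f :: "nat \<Rightarrow> real"
  shows "(\<Sum>bs\<in>bool_lists n. f (count_list bs True)) = (\<Sum>m\<le>n. real (n choose m) * f m)"
proof (induction n arbitrary: f)
  case (Suc n)
  have B: "bool_lists (Suc n) = (#) True ` bool_lists n \<union> (#) False ` bool_lists n"
    by (auto simp: bool_lists_def length_Suc_conv)
  have "(\<Sum>bs\<in>bool_lists (Suc n). f (count_list bs True)) =
    (\<Sum>bs\<in>bool_lists n. f (Suc (count_list bs True))) + (\<Sum>bs\<in>bool_lists n. f (count_list bs True))"
    unfolding B by (subst sum.union_disjoint) (auto simp: finite_bool_lists sum.reindex)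
  also have "\<dots> = (\<Sum>m\<le>n. real (n choose m) * f (Suc m)) + (\<Sum>m\<le>n. real (n choose m) * f m)"
    using Suc[of "\<lambda>m. f (Suc m)"] Suc[of f] by simp
  also have "(\<Sum>m\<le>n. real (n choose m) * f m) = f 0 + (\<Sum>m\<le>n. real (n choose Suc m) * f (Suc m))"
    using sum.atMost_Suc_shift[of "\<lambda>m. real (n choose m) * f m" n] by (simp add: binomial_eq_0)
  also have "(\<Sum>m\<le>n. real (n choose m) * f (Suc m)) + (f 0 + (\<Sum>m\<le>n. real (n choose Suc m) * f (Suc m)))
    = f 0 + (\<Sum>m\<le>n. real (Suc n choose Suc m) * f (Suc m))"
    by (simp add: sum.distrib[symmetric] algebra_simps)
  also have "\<dots> = (\<Sum>m\<le>Suc n. real (Suc n choose m) * f m)"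
    unfolding sum.atMost_Suc_shift by simp
  finally show ?case .
qed (simp add: bool_lists_def)

lemma count_True_False: "count_list bs True + count_list bs False = length bs"
proof (induction bs)
  case (Cons b bs)
  then show ?case by (cases b) auto
qed simp

text \<open>For odd k the bound is \<open>odd_split\<close>. For even k the exponent is lowered to
  2, where \<open>abs_sum\<close> agrees on a tableau and its transpose, so the bound can be charged
  to the row-dominant one. There are n choose m patterns with m lower boxes.\<close>

lemma l2_bound_general:
  assumes n: "n \<ge> 2" and k: "k \<ge> 1"
  shows "(l2_dist n (shuffle_steps n k t id) (uniform n))\<^sup>2 \<le>
    2 * (\<Sum>m\<in>{1..n}. real (n choose m) * (fact n / fact (n - m)) * rate n m ^ (2 * t)) + (1 - 1 / real n) ^ (2 * t)"
proof -
  let ?u = "\<lambda>bs. (rate n (count_list bs True)) ^ (2 * t)"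
  have "(l2_dist n (shuffle_steps n k t id) (uniform n))\<^sup>2 \<le>
    2 * (\<Sum>bs\<in>{bs\<in>bool_lists n. True \<in> set bs}. fact n / fact (count_list bs False) * ?u bs) + (1 - 1 / real n) ^ (2 * t)"
  proof (cases "odd k")
    case True
    show ?thesis
    proof (rule l2_reduction[OF n k odd_split[OF True]])
      fix T assume "T \<in> tableaux n"
      then show "(pos_sum k (contents T) / real n) ^ (2 * t) \<le> ?u (bools T)"
        using n k pos_sum_nonneg[of k "contents T"] by (intro power_mono pos_sum_rate) auto
    qed (auto simp: pos_sum_nonneg)
  next
    case False
    then have k2: "k \<ge> 2" using k by (cases "k = 1") auto
    let ?h = "\<lambda>cs. if row_dominant cs then (abs_sum 2 cs / real n) ^ (2 * t) else 0"
    show ?thesis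
    proof (rule l2_reduction[OF n k, where h = ?h])
      fix T assume T: "T \<in> tableaux n"
      have "\<bar>eig_sum k (contents T) / real n\<bar> \<le> abs_sum 2 (contents T) / real n"
        using T k2 abs_eig_sum_le_abs_sum[of T 2 k] by (simp add: tableaux_def divide_right_mono)
      from power_abs_mono[OF this, of t]
      show "(eig_sum k (contents T) / real n) ^ (2 * t) \<le> ?h (contents T) + ?h (map uminus (contents T))"
        using row_dominant_uminus[of "contents T"] abs_sum_nonneg[of 2 "contents T"]
        by (auto simp: abs_sum_uminus add_increasing add_increasing2)
      show "?h (contents T) \<le> ?u (bools T)"
      proof (cases "row_dominant (contents T)")
        case True
        then show ?thesis using T n abs_sum_nonneg[of 2 "contents T"]
          by (simp only: if_True, intro power_mono abs_sum_rate) auto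
      next
        case False
        have "rate n (count_list (bools T) True) ^ (2 * t) \<ge> 0" by simp
        then show ?thesis using False by simp
      qed
    qed (auto simp: abs_sum_nonneg)
  qed
  also have "(\<Sum>bs\<in>{bs\<in>bool_lists n. True \<in> set bs}. fact n / fact (count_list bs False) * ?u bs) =
    (\<Sum>bs\<in>bool_lists n. if count_list bs True = 0 then 0 else fact n / fact (n - count_list bs True) * ?u bs)"
  proof (rule sum.mono_neutral_cong_left)
    fix bs assume "bs \<in> {bs\<in>bool_lists n. True \<in> set bs}"
    then have "n - count_list bs True = count_list bs False" "count_list bs True \<noteq> 0"
      using count_True_False[of bs] by (auto simp: bool_lists_def count_list_0_iff)
    then show "fact n / fact (count_list bs False) * ?u bs =
      (if count_list bs True = 0 then 0 else fact n / fact (n - count_list bs True) * ?u bs)" by simp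
  qed (auto simp: finite_bool_lists count_list_0_iff)
  also have "\<dots> = (\<Sum>m\<le>n. real (n choose m) * (if m = 0 then 0 else fact n / fact (n - m) * rate n m ^ (2 * t)))"
    by (rule sum_bool_lists_count)
  also have "\<dots> = (\<Sum>m\<in>{1..n}. real (n choose m) * (fact n / fact (n - m)) * rate n m ^ (2 * t))"
    by (rule sum.mono_neutral_cong_right) auto
  finally show ?thesis .
qed

text \<open>Split off the newest letter: \<open>True\<close> contributes v y^(m - 1) and
  \<open>False\<close> contributes Q y^m. As v + Q y = y, the bound y^m reproduces itself; y is v
  times the geometric series over the length of a gap.\<close>

lemma sum_gap_bound:
  fixes v Q y :: real
  assumes "v = y * (1 - Q)" "v \<ge> 0" "Q \<ge> 0" "y \<ge> 0"
  shows "(\<Sum>bs\<in>{bs\<in>bool_lists n. count_list bs True = m}. v ^ m * Q ^ gap bs) \<le> y ^ m"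
proof (induction n arbitrary: m)
  case 0
  have "{bs\<in>bool_lists 0. count_list bs True = m} = (if m = 0 then {[]} else {})" by (auto simp: bool_lists_def)
  then show ?case using assms by simp
next
  case (Suc n)
  let ?B = "\<lambda>n m. {bs\<in>bool_lists n. count_list bs True = m}"
  show ?case
  proof (cases m)
    case 0
    have "?B (Suc n) 0 \<subseteq> {replicate (Suc n) False}"
      by (auto simp: bool_lists_def count_list_0_iff intro!: replicate_eqI simp del: replicate_Suc)
    moreover have "gap (replicate n False) = 0" for n by (induction n) auto
    then have "gap (replicate (Suc n) False) = 0" .
    ultimately have "(\<Sum>bs\<in>?B (Suc n) 0. v ^ 0 * Q ^ gap bs) \<le> (\<Sum>bs\<in>{replicate (Suc n) False}. v ^ 0 * Q ^ gap bs)"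
      using assms by (intro sum_mono2) auto
    also have "\<dots> = 1" using \<open>gap (replicate (Suc n) False) = 0\<close> by simp
    finally show ?thesis using 0 by simp
  next
    case (Suc l)
    have B: "?B (Suc n) (Suc l) = (#) True ` ?B n l \<union> (#) False ` ?B n (Suc l)"
    proof (rule set_eqI)
      fix bs
      show "bs \<in> ?B (Suc n) (Suc l) \<longleftrightarrow> bs \<in> (#) True ` ?B n l \<union> (#) False ` ?B n (Suc l)"
        by (cases bs; cases "hd bs") (auto simp: bool_lists_def)
    qed
    have t: "True \<in> set bs" if "bs \<in> ?B n (Suc l)" for bs
      using that count_list_0_iff[of bs True] by auto
    have "(\<Sum>bs\<in>?B (Suc n) (Suc l). v ^ Suc l * Q ^ gap bs) =
      (\<Sum>bs\<in>?B n l. v ^ Suc l * Q ^ gap bs) + (\<Sum>bs\<in>?B n (Suc l). v ^ Suc l * Q ^ Suc (gap bs))"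
      unfolding B using t by (subst sum.union_disjoint) (auto simp: finite_bool_lists sum.reindex)
    also have "\<dots> = v * (\<Sum>bs\<in>?B n l. v ^ l * Q ^ gap bs) + Q * (\<Sum>bs\<in>?B n (Suc l). v ^ Suc l * Q ^ gap bs)"
      by (simp add: sum_distrib_left mult_ac)
    also have "\<dots> \<le> v * y ^ l + Q * y ^ Suc l"
      using assms(2,3) by (intro add_mono mult_left_mono Suc.IH)
    also have "\<dots> = (v + Q * y) * y ^ l" by (simp add: distrib_right)
    also have "v + Q * y = y" using assms(1) by (simp add: algebra_simps)
    also have "y * y ^ l = y ^ Suc l" by simp
    finally show ?thesis unfolding \<open>m = Suc l\<close> .
  qed
qed

lemma fact_ratio_le_power: "m \<le> n \<Longrightarrow> fact n / fact (n - m) \<le> (real n) ^ m"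
proof (induction m)
  case (Suc m)
  then have e: "n - m = Suc (n - Suc m)" by simp
  have "fact n / fact (n - Suc m) = fact n / fact (n - m) * real (n - m)"
    unfolding e fact_Suc by simp
  also have "\<dots> \<le> real n ^ m * real n" using Suc by (intro mult_mono) auto
  finally show ?case by (simp add: mult.commute)
qed simp

lemma one_minus_power_le_exp:
  fixes x :: real
  assumes "x \<le> 1"
  shows "(1 - x) ^ m \<le> exp (- (real m * x))"
proof -
  have "(1 - x) ^ m \<le> exp (- x) ^ m"
    using assms exp_ge_add_one_self[of "- x"] by (intro power_mono) auto
  then show ?thesis by (simp add: exp_of_nat_mult[symmetric])
qed

text \<open>By \<open>pos_sum_bound\<close> and 1 - x \<le> exp(-x), each lower box costs
  exp(-\<tau> p) and each gap costs Q. With n! / (n - m)! \<le> n^m a pattern weighs at most v^m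
  Q^gap, and \<open>sum_gap_bound\<close> leaves a geometric series in y.\<close>

lemma l2_bound_odd:
  fixes \<tau> :: real
  assumes n: "n \<ge> 2" and k: "odd k"
    and \<tau>: "\<tau> = 2 * real t / real n"
    and y: "real n * exp (- \<tau> * (1 - (1 / 2) ^ k)) = y * (1 - exp (- \<tau> * (1 - (1 - 1 / real n) ^ k)))"
    and y01: "0 \<le> y" "y < 1"
  shows "(l2_dist n (shuffle_steps n k t id) (uniform n))\<^sup>2 \<le> 2 * (y / (1 - y)) + (1 - 1 / real n) ^ (2 * t)"
proof -
  have k1: "k \<ge> 1" using k by (cases k) auto
  define w where "w = 1 - (1 - 1 / real n) ^ k"
  define p where "p = 1 - (1 / 2 :: real) ^ k"
  define Q where "Q = exp (- \<tau> * w)"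
  define v where "v = real n * exp (- \<tau> * p)"
  let ?u = "\<lambda>bs. exp (- \<tau> * p) ^ count_list bs True * Q ^ gap bs"
  let ?B = "{bs\<in>bool_lists n. True \<in> set bs}"
  have "(l2_dist n (shuffle_steps n k t id) (uniform n))\<^sup>2 \<le>
    2 * (\<Sum>bs\<in>?B. fact n / fact (count_list bs False) * ?u bs) + (1 - 1 / real n) ^ (2 * t)"
  proof (rule l2_reduction[OF n k1 odd_split[OF k]])
    fix T assume T: "T \<in> tableaux n"
    define m where "m = count_list (bools T) True"
    define e where "e = real m * p + real (gap (bools T)) * w"
    have "pos_sum k (contents T) \<le> real m * (1 / 2) ^ k + real (count_list T 0) - real (gap (bools T)) * w"
      using pos_sum_bound[of T n k] T n by (simp add: tableaux_def m_def length_lower_rows_bools w_def)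
    moreover have "real (count_list T 0) = real n - real m"
      using length_lower_rows[of T] T by (simp add: tableaux_def m_def length_lower_rows_bools)
    ultimately have pos_sum: "pos_sum k (contents T) \<le> real n - e" by (simp add: e_def p_def algebra_simps)
    then have pe': "pos_sum k (contents T) / real n \<le> 1 - e / real n"
      using n by (simp add: field_simps)
    have "0 \<le> 1 - e / real n" using pe' pos_sum_nonneg[of k "contents T"] by (meson divide_nonneg_nonneg of_nat_0_le_iff order_trans)
    have "(pos_sum k (contents T) / real n) ^ (2 * t) \<le> (1 - e / real n) ^ (2 * t)"
      using pe' pos_sum_nonneg[of k "contents T"] by (intro power_mono) auto
    also have "\<dots> \<le> exp (- (real (2 * t) * (e / real n)))"
      using \<open>0 \<le> 1 - e / real n\<close> by (intro one_minus_power_le_exp) auto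
    also have "\<dots> = exp (- \<tau> * e)" by (simp add: \<tau>)
    also have "\<dots> = ?u (bools T)"
      by (simp add: e_def Q_def m_def exp_add[symmetric] exp_of_nat_mult[symmetric] algebra_simps)
    finally show "(pos_sum k (contents T) / real n) ^ (2 * t) \<le> ?u (bools T)" .
  qed (auto simp: pos_sum_nonneg Q_def)
  also have "(\<Sum>bs\<in>?B. fact n / fact (count_list bs False) * ?u bs) \<le> (\<Sum>bs\<in>?B. v ^ count_list bs True * Q ^ gap bs)"
  proof (rule sum_mono)
    fix bs assume bs: "bs \<in> ?B"
    have "count_list bs True \<le> n" "count_list bs False = n - count_list bs True"
      using bs count_True_False[of bs] by (auto simp: bool_lists_def)
    then have "fact n / fact (count_list bs False) \<le> real n ^ count_list bs True"
      using fact_ratio_le_power[of "count_list bs True" n] by simp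
    then have "fact n / fact (count_list bs False) * ?u bs \<le> real n ^ count_list bs True * ?u bs"
      by (intro mult_right_mono) (auto simp: Q_def)
    also have "\<dots> = v ^ count_list bs True * Q ^ gap bs"
      unfolding v_def by (simp add: power_mult_distrib)
    finally show "fact n / fact (count_list bs False) * ?u bs \<le> v ^ count_list bs True * Q ^ gap bs" .
  qed
  also have "\<dots> = (\<Sum>m\<in>{1..n}. \<Sum>bs\<in>{bs\<in>?B. count_list bs True = m}. v ^ count_list bs True * Q ^ gap bs)"
  proof (rule sum.group[symmetric])
    show "(\<lambda>bs. count_list bs True) ` ?B \<subseteq> {1..n}"
      using count_le_length count_list_0_iff by (force simp: bool_lists_def Suc_le_eq)
  qed (auto simp: finite_bool_lists)
  also have "\<dots> \<le> (\<Sum>m\<in>{1..n}. y ^ m)"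
  proof (rule sum_mono)
    fix m assume m: "m \<in> {1..n}"
    have "True \<in> set bs" if "count_list bs True = m" for bs
      using that m count_notin[of True bs] by (cases "True \<in> set bs") auto
    then have e: "{bs\<in>?B. count_list bs True = m} = {bs\<in>bool_lists n. count_list bs True = m}"
      by auto
    have "(\<Sum>bs\<in>{bs\<in>bool_lists n. count_list bs True = m}. v ^ m * Q ^ gap bs) \<le> y ^ m"
    proof (rule sum_gap_bound)
      show "v = y * (1 - Q)" using y by (simp add: v_def Q_def p_def w_def)
      show "v \<ge> 0" by (simp add: v_def)
      show "Q \<ge> 0" by (simp add: Q_def)
    qed (rule y01(1))
    then show "(\<Sum>bs\<in>{bs\<in>?B. count_list bs True = m}. v ^ count_list bs True * Q ^ gap bs) \<le> y ^ m"
      unfolding e by simp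
  qed
  also have "\<dots> = y * (\<Sum>m<n. y ^ m)"
    unfolding sum_distrib_left by (rule sum.reindex_bij_witness[where i = Suc and j = "\<lambda>m. m - 1"]) (auto simp: power_eq_if)
  also have "\<dots> \<le> y * (1 / (1 - y))"
  proof (rule mult_left_mono)
    have "(\<Sum>m<n. y ^ m) = (1 - y ^ n) / (1 - y)"
      using y01 by (subst sum_gp_strict) auto
    also have "\<dots> \<le> 1 / (1 - y)" using y01 by (intro divide_right_mono) auto
    finally show "(\<Sum>m<n. y ^ m) \<le> 1 / (1 - y)" .
  qed (use y01 in auto)
  also have "y * (1 / (1 - y)) = y / (1 - y)" by simp
  finally show ?thesis by linarith+
qed

section \<open>Asymptotics\<close>

text \<open>The second-order term is the gain on which \<open>large_term_bound\<close> rests. The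
  difference of the two sides has derivative -x^2 / (1 - x).\<close>

lemma ln_one_minus_quadratic:
  fixes u :: real
  assumes "0 \<le> u" "u < 1"
  shows "ln (1 - u) \<le> - u - u\<^sup>2 / 2"
proof -
  have "ln (1 - u) + u + u\<^sup>2 / 2 \<le> ln (1 - 0) + 0 + 0\<^sup>2 / (2 :: real)"
  proof (rule DERIV_nonpos_imp_nonincreasing[OF assms(1)])
    fix x assume x: "0 \<le> x" "x \<le> u"
    have "((\<lambda>x. ln (1 - x) + x + x\<^sup>2 / 2) has_real_derivative (- 1 / (1 - x) + 1 + x)) (at x)"
      using x assms by (auto intro!: derivative_eq_intros simp: field_simps)
    moreover have "- 1 / (1 - x) + 1 + x = - x\<^sup>2 / (1 - x)"
      using x assms by (simp add: field_simps power2_eq_square)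
    moreover have "- x\<^sup>2 / (1 - x) \<le> 0" using x assms by (simp add: divide_nonpos_pos)
    ultimately show "\<exists>d. ((\<lambda>x. ln (1 - x) + x + x\<^sup>2 / 2) has_real_derivative d) (at x) \<and> d \<le> 0"
      by auto
  qed
  then show ?thesis by simp
qed

lemma one_minus_power_le_exp_quadratic:
  fixes u :: real
  assumes "0 \<le> u" "u \<le> 1"
  shows "(1 - u) ^ m \<le> exp (- (real m * (u + u\<^sup>2 / 2)))"
proof (cases "u = 1")
  case True
  then show ?thesis by (cases m) auto
next
  case False
  have "exp (ln (1 - u)) \<le> exp (- u - u\<^sup>2 / 2)"
    using ln_one_minus_quadratic[of u] assms False by (subst exp_le_cancel_iff) simp
  then have "1 - u \<le> exp (- u - u\<^sup>2 / 2)" using assms False by simp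
  then have "(1 - u) ^ m \<le> exp (- u - u\<^sup>2 / 2) ^ m" using assms by (intro power_mono) auto
  then show ?thesis by (simp add: exp_of_nat_mult[symmetric] algebra_simps)
qed

section \<open>Estimates of the terms at time n log n + c n\<close>

lemma sum_inverse_fact_le: "(\<Sum>m\<in>A. 1 / fact m) \<le> exp (1 :: real)" if "finite A"
proof -
  have "summable (\<lambda>m. 1 / fact m :: real)"
    using summable_exp[of "1 :: real"] by (simp add: inverse_eq_divide)
  then have "(\<Sum>m\<in>A. 1 / fact m) \<le> suminf (\<lambda>m. 1 / fact m :: real)"
    using that by (intro sum_le_suminf) auto
  then show ?thesis by (simp add: exp_def inverse_eq_divide)
qed

lemma inverse_fact_le:
  assumes "m \<ge> 1"
  shows "1 / fact m \<le> exp (real m - real m * ln (real m))"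
proof -
  have "real m ^ m / fact m \<le> exp (real m)"
  proof -
    have s: "summable (\<lambda>i. real m ^ i / fact i)"
      using summable_exp[of "real m"] by (simp add: divide_inverse mult.commute)
    have "(\<Sum>i\<in>{m}. real m ^ i / fact i) \<le> suminf (\<lambda>i. real m ^ i / fact i)"
      by (rule sum_le_suminf[OF s]) auto
    then show ?thesis by (simp add: exp_def divide_inverse mult.commute)
  qed
  moreover have "real m ^ m = exp (real m * ln (real m))"
    using assms by (simp add: exp_of_nat_mult)
  ultimately have "exp (real m * ln (real m)) / fact m \<le> exp (real m)" by simp
  then show ?thesis by (simp add: exp_diff field_simps)
qed

lemma binomial_le_power_fact: "m \<le> n \<Longrightarrow> real (n choose m) \<le> real n ^ m / fact m"
proof -
  assume m: "m \<le> n"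
  have "real (n choose m) = fact n / fact (n - m) / fact m"
    using binomial_fact[OF m, where 'a = real] by (simp add: field_simps)
  then show ?thesis using divide_right_mono[OF fact_ratio_le_power[OF m], of "fact m"] by simp
qed

lemma binomial_le_two_power: "real (n choose m) \<le> 2 ^ n"
proof -
  have "n choose m \<le> 2 ^ n"
  proof (cases "m \<le> n")
    case True
    then have "n choose m \<le> (\<Sum>i\<le>n. n choose i)" by (intro member_le_sum) auto
    then show ?thesis by (simp add: choose_row_sum)
  qed (simp add: binomial_eq_0)
  then show ?thesis by (metis of_nat_le_iff of_nat_numeral of_nat_power)
qed

text \<open>Binomial and falling factorial together are at most exp(2 M L) / m!, and the rate
  supplies exp(-2 M L) up to the error exponent 2 L M (M + 1) / n. Because 2 m + 2 \<le> n, the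
  coefficient of c is still at least 1.\<close>

lemma small_term_bound:
  fixes c :: real
  assumes m: "1 \<le> m" "2 * m + 2 \<le> n" and c: "c > 0"
    and t: "real t \<ge> real n * ln (real n) + c * real n"
  shows "real (n choose m) * (fact n / fact (n - m)) * rate n m ^ (2 * t) \<le>
    exp (- c) * (1 / fact m * exp (2 * ln (real n) * real m * (real m + 1) / real n))"
proof -
  define N where "N = real n"
  define M where "M = real m"
  define L where "L = ln N"
  have N: "N \<ge> 4" using m by (simp add: N_def)
  have L: "L \<ge> 0" using N by (simp add: L_def)
  have M: "M \<ge> 1" "2 * M + 2 \<le> N" using m by (simp_all add: M_def N_def)
  define u where "u = M * (N - M - 1) / N\<^sup>2"
  have u0: "u \<ge> 0" using M N by (simp add: u_def)
  have rate: "rate n m = 1 - u" using m by (simp add: rate_def u_def M_def N_def)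
  have "rate n m ^ (2 * t) \<le> exp (- (real (2 * t) * u))"
    unfolding rate using rate_nonneg[of m n] m rate by (intro one_minus_power_le_exp) auto
  also have "\<dots> \<le> exp (- (2 * (N * L + c * N) * u))"
    using t u0 by (simp add: N_def L_def mult_right_mono)
  also have "2 * (N * L + c * N) * u = 2 * (L + c) * M * ((N - M - 1) / N)"
    using N by (simp add: u_def field_simps power2_eq_square)
  also have "\<dots> = 2 * M * L - 2 * L * M * (M + 1) / N + c * (2 * M * ((N - M - 1) / N))"
    using N by (simp add: field_simps)
  finally have 1: "rate n m ^ (2 * t) \<le> exp (- (2 * M * L - 2 * L * M * (M + 1) / N + c * (2 * M * ((N - M - 1) / N))))" .
  have "(N - M - 1) / N \<ge> 1 / 2" using M N by (simp add: field_simps)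
  then have "2 * M * ((N - M - 1) / N) \<ge> 2 * 1 * (1 / 2)" using M by (intro mult_mono) auto
  then have "c * (2 * M * ((N - M - 1) / N)) \<ge> c * 1" using c by (intro mult_left_mono) auto
  then have "exp (- (2 * M * L - 2 * L * M * (M + 1) / N + c * (2 * M * ((N - M - 1) / N)))) \<le>
     exp (- c - 2 * M * L + 2 * L * M * (M + 1) / N)" by simp
  with 1 have 2: "rate n m ^ (2 * t) \<le> exp (- c - 2 * M * L + 2 * L * M * (M + 1) / N)" by linarith
  have "real (n choose m) * (fact n / fact (n - m)) \<le> N ^ m / fact m * N ^ m"
    unfolding N_def using m by (intro mult_mono binomial_le_power_fact fact_ratio_le_power) auto
  also have "N ^ m = exp (M * L)" using N by (simp add: M_def L_def exp_of_nat_mult)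
  finally have "real (n choose m) * (fact n / fact (n - m)) \<le> exp (2 * M * L) / fact m"
  proof -
    have "exp (2 * M * L) = exp (M * L) * exp (M * L)" by (simp add: exp_add[symmetric])
    moreover assume "real (n choose m) * (fact n / fact (n - m)) \<le> exp (M * L) / fact m * exp (M * L)"
    ultimately show ?thesis by simp
  qed
  then have "real (n choose m) * (fact n / fact (n - m)) * rate n m ^ (2 * t) \<le>
    exp (2 * M * L) / fact m * exp (- c - 2 * M * L + 2 * L * M * (M + 1) / N)"
    using 2 rate_nonneg[of m n] m by (intro mult_mono) auto
  also have "\<dots> = exp (- c) * (1 / fact m * exp (2 * L * M * (M + 1) / N))"
    by (simp add: exp_add[symmetric] field_simps exp_diff exp_minus)
  finally show ?thesis by (simp add: N_def M_def L_def)
qed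

text \<open>Here the binomial is bounded by 2^n \<le> exp(n), and in the worst case the linear
  estimate of log(1 - u) does no better than balance n^m. The quadratic term gives a relative gain
  of 1/128, which in the first regime is m / n \<ge> 1/32 times 1/4, the square of y \<ge>
  1/2.\<close>

lemma large_term_bound:
  fixes c :: real
  assumes m: "1 \<le> m" "m \<le> n" "16 * (m + 1) > n" and n: "n \<ge> 100" and c: "c > 0"
    and L: "ln (real n) \<ge> 8192"
    and t: "real t \<ge> real n * ln (real n) + c * real n"
  shows "real (n choose m) * (fact n / fact (n - m)) * rate n m ^ (2 * t) \<le> exp (- c) * exp (- real n)"
proof -
  define N where "N = real n"
  define M where "M = real m"
  define L where "L = ln N"
  have N: "N \<ge> 100" using n by (simp add: N_def)
  have M: "M \<ge> 1" "M \<le> N" "16 * (M + 1) > N" using m by (simp_all add: M_def N_def flip: of_nat_Suc)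
  have x: "M / N \<ge> 1 / 32" using M N by (simp add: field_simps)
  define u where "u = 1 - rate n m"
  have u: "u \<ge> 0 \<and> u \<le> 1 \<and> 2 * N * (u + u\<^sup>2 / 2) \<ge> M * (1 + 1 / 128)"
  proof (intro conjI)
    show "u \<le> 1" using rate_nonneg[of m n] m n by (simp add: u_def)
    show "u \<ge> 0" using M N by (simp add: u_def rate_def M_def N_def)
    show "2 * N * (u + u\<^sup>2 / 2) \<ge> M * (1 + 1 / 128)"
    proof (cases "2 * m + 2 \<le> n")
      case True
      define y where "y = (N - M - 1) / N"
      have "2 * M + 2 \<le> N" using True by (simp add: M_def N_def)
      then have y: "y \<ge> 1 / 2" using N by (simp add: y_def field_simps)
      have "u = M / N * y" using True by (simp add: u_def rate_def y_def M_def N_def power2_eq_square)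
      moreover have "2 * N * (M / N * y + (M / N * y)\<^sup>2 / 2) = M * (2 * y + M / N * (y * y))"
        using N by (simp add: field_simps power2_eq_square)
      ultimately have "2 * N * (u + u\<^sup>2 / 2) = M * (2 * y + M / N * (y * y))" by (simp only:)
      moreover have "M / N * (y * y) \<ge> 1 / 32 * (1 / 2 * (1 / 2))"
        using x y M N by (intro mult_mono) auto
      then have "2 * y + M / N * (y * y) \<ge> 1 + 1 / 128" using y by simp
      ultimately show ?thesis using M by simp
    next
      case False
      define y where "y = 1 - 1 / N"
      have y: "y \<ge> 99 / 100" using N by (simp add: y_def field_simps)
      have M4: "M / N \<ge> 1 / 4" using False N by (simp add: M_def N_def field_simps)
      have "u = M / N * y / 2" using False N
        by (simp add: u_def rate_def y_def M_def N_def power2_eq_square field_simps)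
      moreover have "2 * N * (M / N * y / 2 + (M / N * y / 2)\<^sup>2 / 2) = M * (y + M / N * (y * y) / 4)"
        using N by (simp add: field_simps power2_eq_square)
      ultimately have eq: "2 * N * (u + u\<^sup>2 / 2) = M * (y + M / N * (y * y) / 4)" by (simp only:)
      have "M / N * (y * y) \<ge> 1 / 4 * (99 / 100 * (99 / 100))"
        using M4 y M N by (intro mult_mono) auto
      moreover have "y + a / 4 \<ge> 1 + 1 / 128" if "a \<ge> 1 / 4 * (99 / 100 * (99 / 100))" for a
        using y that by simp
      ultimately have "y + M / N * (y * y) / 4 \<ge> 1 + 1 / 128" by blast
      with eq show ?thesis using M by simp
    qed
  qed
  have "rate n m ^ (2 * t) = (1 - u) ^ (2 * t)" by (simp add: u_def)
  also have "\<dots> \<le> exp (- (real (2 * t) * (u + u\<^sup>2 / 2)))"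
    using u by (intro one_minus_power_le_exp_quadratic) auto
  also have "\<dots> \<le> exp (- ((L + c) * (M * (1 + 1 / 128))))"
  proof -
    have "(L + c) * (M * (1 + 1 / 128)) \<le> (L + c) * (2 * N * (u + u\<^sup>2 / 2))"
      using u L c by (intro mult_left_mono) (auto simp: L_def N_def)
    also have "\<dots> = 2 * (N * L + c * N) * (u + u\<^sup>2 / 2)" by (simp add: algebra_simps)
    also have "\<dots> \<le> real (2 * t) * (u + u\<^sup>2 / 2)"
      using t u by (intro mult_right_mono) (auto simp: N_def L_def)
    finally show ?thesis by simp
  qed
  finally have r: "rate n m ^ (2 * t) \<le> exp (- ((L + c) * (M * (1 + 1 / 128))))" .
  have "real (n choose m) * (fact n / fact (n - m)) \<le> 2 ^ n * N ^ m"
    unfolding N_def using m by (intro mult_mono binomial_le_two_power fact_ratio_le_power) auto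
  also have "N ^ m = exp (M * L)" using N by (simp add: M_def L_def exp_of_nat_mult)
  also have "(2 :: real) ^ n \<le> exp 1 ^ n"
    using exp_ge_add_one_self[of "1 :: real"] by (intro power_mono) auto
  also have "exp 1 ^ n = exp N" by (simp add: N_def exp_of_nat_mult[symmetric])
  finally have "real (n choose m) * (fact n / fact (n - m)) \<le> exp N * exp (M * L)" by simp
  then have "real (n choose m) * (fact n / fact (n - m)) * rate n m ^ (2 * t) \<le>
    exp N * exp (M * L) * exp (- ((L + c) * (M * (1 + 1 / 128))))"
    by (rule mult_mono[OF _ r]) (use rate_nonneg[of m n] m in auto)
  also have "\<dots> = exp (N + M * L - (L + c) * (M * (1 + 1 / 128)))"
    by (simp add: exp_add[symmetric])
  also have "\<dots> \<le> exp (- c - N)"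
  proof -
    \<comment> \<open>As 8192 = 2 * 32 * 128, the gain M L / 128 is at least 2 N: one N cancels
      exp(N), the other remains as exp(-N).\<close>
    have "M * L \<ge> N / 32 * 8192"
      using x L N by (intro mult_mono) (auto simp: L_def N_def field_simps)
    moreover have "c * (M * (1 + 1 / 128)) \<ge> c * 1"
    proof (rule mult_left_mono)
      show "1 \<le> M * (1 + 1 / 128)" using M by simp
    qed (use c in simp)
    moreover have "N + M * L - (L + c) * (M * (1 + 1 / 128)) = N - M * L / 128 - c * (M * (1 + 1 / 128))"
      by (simp add: algebra_simps)
    ultimately show ?thesis by simp
  qed
  also have "\<dots> = exp (- c) * exp (- N)" by (simp add: exp_add[symmetric])
  finally show ?thesis by (simp add: N_def)
qed

lemma ln_fourth_root:
  assumes "m ^ 4 > n" "n \<ge> 1"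
  shows "ln (real m) \<ge> ln (real n) / 4"
proof -
  have "m \<ge> 1" using assms by (cases m) auto
  have "real n \<le> real m ^ 4" using assms by (metis less_imp_le of_nat_le_iff of_nat_power)
  then have "ln (real n) \<le> ln (real m ^ 4)" using assms \<open>m \<ge> 1\<close> by simp
  then show ?thesis using \<open>m \<ge> 1\<close> by (simp add: ln_realpow)
qed

text \<open>While 16 (m + 1) \<le> n there are two ranges. For m^4 \<le> n the error exponent of
  \<open>small_term_bound\<close> is at most 4 log n / sqrt n \<le> 1. For m^4 > n, log m \<ge> (log
  n) / 4 lets 1 / m! absorb an error of at most m (log n) / 8. The rest is
  \<open>large_term_bound\<close>.\<close>

lemma term_bound:
  fixes c :: real
  assumes m: "1 \<le> m" "m \<le> n" and n: "n \<ge> 100" and c: "c > 0"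
    and L: "ln (real n) \<ge> 8192" and Ls: "4 * ln (real n) \<le> sqrt (real n)"
    and t: "real t \<ge> real n * ln (real n) + c * real n"
  shows "real (n choose m) * (fact n / fact (n - m)) * rate n m ^ (2 * t) \<le>
    exp (- c) * (exp 1 * (1 / fact m) + (1 / 2) ^ m + exp (- real n))"
proof -
  let ?e = "exp (2 * ln (real n) * real m * (real m + 1) / real n)"
  consider "16 * (m + 1) > n" | "16 * (m + 1) \<le> n" "m ^ 4 \<le> n" | "16 * (m + 1) \<le> n" "m ^ 4 > n" by linarith
  then show ?thesis
  proof cases
    case 1
    have "exp (- c) * exp (- real n) \<le> exp (- c) * (exp 1 * (1 / fact m) + (1 / 2) ^ m + exp (- real n))"
      by (intro mult_left_mono) auto
    then show ?thesis using large_term_bound[OF m 1 n c L t] by linarith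
  next
    case 2
    have small: "2 * m + 2 \<le> n" using 2(1) by presburger
    have "real m ^ 4 \<le> real n" using 2(2) by (metis of_nat_le_iff of_nat_power)
    then have "(real m ^ 2) ^ 2 \<le> real n" by simp
    then have "real m ^ 2 \<le> sqrt (real n)" by (rule real_le_rsqrt)
    have "2 * ln (real n) * real m * (real m + 1) \<le> 2 * ln (real n) * real m * (2 * real m)"
      using m L by (intro mult_left_mono) auto
    also have "\<dots> = 4 * ln (real n) * real m ^ 2" by (simp add: power2_eq_square)
    also have "\<dots> \<le> sqrt (real n) * sqrt (real n)"
      using Ls L \<open>real m ^ 2 \<le> sqrt (real n)\<close> by (intro mult_mono) auto
    also have "\<dots> = real n" by simp
    finally have "?e \<le> exp 1" using n by simp
    then have "1 / fact m * ?e \<le> 1 / fact m * exp 1" by (intro mult_left_mono) auto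
    also have "\<dots> \<le> exp 1 * (1 / fact m) + (1 / 2) ^ m + exp (- real n)" by simp
    finally have "exp (- c) * (1 / fact m * ?e) \<le> exp (- c) * (exp 1 * (1 / fact m) + (1 / 2) ^ m + exp (- real n))"
      by (intro mult_left_mono) auto
    then show ?thesis using small_term_bound[OF m(1) small c t] by linarith
  next
    case 3
    have small: "2 * m + 2 \<le> n" using 3(1) by presburger
    define l where "l = ln (real n)"
    have e: "2 * l * real m * (real m + 1) / real n \<le> real m * l / 8"
    proof -
      have "real (16 * (m + 1)) \<le> real n" using 3(1) by (simp only: of_nat_le_iff)
      then have "16 * (real m + 1) \<le> real n" by simp
      then have "2 * l * real m * (16 * (real m + 1)) \<le> 2 * l * real m * real n"
        using L by (intro mult_left_mono) (auto simp: l_def)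
      then show ?thesis using n by (simp add: field_simps)
    qed
    have "1 / fact m * exp (2 * l * real m * (real m + 1) / real n) \<le>
      exp (real m - real m * ln (real m)) * exp (real m * l / 8)"
      using e m inverse_fact_le[of m] by (intro mult_mono) auto
    also have "\<dots> \<le> exp (real m - real m * (l / 4)) * exp (real m * l / 8)"
    proof -
      have "real m * (l / 4) \<le> real m * ln (real m)"
        using ln_fourth_root[OF 3(2)] n by (intro mult_left_mono) (auto simp: l_def)
      then show ?thesis by (intro mult_right_mono) auto
    qed
    also have "\<dots> = exp (real m * (1 - l / 8))" by (simp add: exp_add[symmetric] algebra_simps)
    also have "\<dots> \<le> exp (real m * (- 1))"
      unfolding exp_le_cancel_iff by (rule mult_left_mono) (use L in \<open>simp_all add: l_def\<close>)
    also have "\<dots> = exp (- 1) ^ m" by (simp only: exp_of_nat_mult)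
    also have "\<dots> \<le> (1 / 2) ^ m"
    proof (rule power_mono)
      have "exp (1 :: real) \<ge> 2" using exp_ge_add_one_self[of "1 :: real"] by simp
      then show "exp (- 1) \<le> (1 / 2 :: real)" by (simp add: exp_minus field_simps)
    qed simp
    finally have "1 / fact m * ?e \<le> exp 1 * (1 / fact m) + (1 / 2) ^ m + exp (- real n)"
      unfolding l_def[symmetric] by (simp add: add_increasing add_increasing2)
    then have "exp (- c) * (1 / fact m * ?e) \<le> exp (- c) * (exp 1 * (1 / fact m) + (1 / 2) ^ m + exp (- real n))"
      by (intro mult_left_mono) auto
    then show ?thesis using small_term_bound[OF m(1) small c t] by linarith
  qed
qed

text \<open>The three sums from \<open>term_bound\<close> give at most 3 * 3 + 1 + 1 = 11, which is
  doubled; the sign representation adds less than 1, and 23 is rounded up.\<close>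

lemma l2_upper_bound:
  fixes c :: real
  assumes n: "n \<ge> 100" and c: "c > 0" and k: "k \<ge> 1"
    and L: "ln (real n) \<ge> 8192" and Ls: "4 * ln (real n) \<le> sqrt (real n)"
    and t: "real t \<ge> real n * ln (real n) + c * real n"
  shows "(l2_dist n (shuffle_steps n k t id) (uniform n))\<^sup>2 < 24 * exp (- c)"
proof -
  have e3: "exp (1 :: real) \<le> 3" by (rule exp_le)
  have "(\<Sum>m\<in>{1..n}. real (n choose m) * (fact n / fact (n - m)) * rate n m ^ (2 * t)) \<le>
    (\<Sum>m\<in>{1..n}. exp (- c) * (exp 1 * (1 / fact m) + (1 / 2) ^ m + exp (- real n)))"
    by (intro sum_mono term_bound n c L Ls t) auto
  also have "\<dots> = exp (- c) * (exp 1 * (\<Sum>m\<in>{1..n}. 1 / fact m) + (\<Sum>m\<in>{1..n}. (1 / 2) ^ m) + real n * exp (- real n))"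
    by (simp add: sum_distrib_left sum.distrib distrib_left)
  also have "\<dots> \<le> exp (- c) * (3 * 3 + 1 + 1)"
  proof (intro mult_left_mono add_mono)
    have "(\<Sum>m\<in>{1..n}. 1 / fact m) \<le> (3 :: real)" using sum_inverse_fact_le[of "{1..n}"] e3 by simp
    then show "exp 1 * (\<Sum>m\<in>{1..n}. 1 / fact m) \<le> (3 * 3 :: real)" using e3
      by (intro mult_mono) (auto intro!: sum_nonneg)
    have "(\<Sum>m\<in>{1..n}. (1 / 2 :: real) ^ m) = 1 - (1 / 2) ^ n"
      by (induction n) (auto simp: field_simps)
    then show "(\<Sum>m\<in>{1..n}. (1 / 2 :: real) ^ m) \<le> 1" by simp
    have "real n \<le> exp (real n)" using exp_ge_add_one_self[of "real n"] by linarith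
    then show "real n * exp (- real n) \<le> 1" by (simp add: exp_minus field_simps)
  qed auto
  finally have 1: "(\<Sum>m\<in>{1..n}. real (n choose m) * (fact n / fact (n - m)) * rate n m ^ (2 * t)) \<le> 11 * exp (- c)"
    by simp
  have "(1 - 1 / real n) ^ (2 * t) \<le> exp (- (real (2 * t) * (1 / real n)))"
    using n by (intro one_minus_power_le_exp) auto
  also have "\<dots> < exp (- c)"
  proof -
    have "c * real n < 2 * (real n * ln (real n) + c * real n)"
      using n c L by (simp add: add_pos_pos)
    also have "\<dots> \<le> 2 * real t" using t by simp
    finally show ?thesis using n by (simp add: field_simps)
  qed
  finally have 2: "(1 - 1 / real n) ^ (2 * t) < exp (- c)" .
  have "n \<ge> 2" using n by simp
  from l2_bound_general[OF this k, of t] 1 2 exp_gt_zero[of "- c"] show ?thesis by linarith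
qed

lemma eventually_conditions:
  "eventually (\<lambda>n. n \<ge> 100 \<and> ln (real n) \<ge> 8192 \<and> 4 * ln (real n) \<le> sqrt (real n)) sequentially"
proof -
  have "eventually (\<lambda>n::nat. ln (real n) \<ge> 8192) sequentially" by real_asymp
  moreover have "eventually (\<lambda>n::nat. 4 * ln (real n) \<le> sqrt (real n)) sequentially" by real_asymp
  ultimately show ?thesis using eventually_ge_at_top[of 100] by eventually_elim auto
qed

section \<open>Growing k\<close>

lemma one_minus_exp_ge: "x \<ge> 0 \<Longrightarrow> 1 - exp (- x) \<ge> x / (1 + x)" for x :: real
  using exp_ge_add_one_self[of x] by (simp add: exp_minus field_simps)

text \<open>At this time v = n exp(-\<tau> p) is at most of order n^(\<gamma> - 1). A gap has
  exponent \<tau> w \<ge> \<tau> k / (2 n), and k / n is the same power of n, so it cancels in y = v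
  / (1 - Q). Counting patterns without their gaps would leave n v instead, bounded only by order
  n^\<gamma>.\<close>

lemma l2_upper_bound_growing:
  fixes c \<gamma> :: real
  assumes \<gamma>: "0 < \<gamma>" "\<gamma> < 1" and c: "c > 3" and n: "n \<ge> 2" and k: "odd k" "real k = real n powr \<gamma>"
    and e1: "real n powr (\<gamma> - 1) \<le> 1 / 6" and e2: "ln (real n) \<ge> 12"
    and e3: "((2 - \<gamma>) * ln (real n) + 2 * c) * real n powr (- \<gamma>) \<le> 1"
    and t: "real t \<ge> (1 - \<gamma> / 2) * real n * ln (real n) + c * real n"
  shows "(l2_dist n (shuffle_steps n k t id) (uniform n))\<^sup>2 < 10 * exp (- c)"
proof -
  define N where "N = real n"
  define L where "L = ln N"
  define \<tau> where "\<tau> = 2 * real t / N"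
  define \<tau>0 where "\<tau>0 = (2 - \<gamma>) * L + 2 * c"
  define p where "p = 1 - (1 / 2 :: real) ^ k"
  define w where "w = 1 - (1 - 1 / N) ^ k"
  define y where "y = N * exp (- \<tau> * p) / (1 - exp (- \<tau> * w))"
  have N: "N \<ge> 2" using n by (simp add: N_def)
  have L: "L \<ge> 12" using e2 by (simp add: L_def N_def)
  have k1: "k \<ge> 1" using k(1) by (cases k) auto
  have kN: "real k = N powr \<gamma>" using k by (simp add: N_def)
  have "N powr \<gamma> \<le> N powr 1" using \<gamma> N by (intro powr_mono) auto
  then have kleN: "real k \<le> N" using kN N by simp
  have "1 * 12 \<le> (2 - \<gamma>) * L" using \<gamma> L by (intro mult_mono) auto
  then have \<tau>0: "\<tau>0 \<ge> 12" using c by (simp add: \<tau>0_def)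
  have \<tau>: "\<tau> \<ge> \<tau>0"
  proof -
    have "\<tau>0 * N = 2 * ((1 - \<gamma> / 2) * real n * ln (real n) + c * real n)"
      by (simp add: \<tau>0_def L_def N_def algebra_simps)
    also have "\<dots> \<le> 2 * real t" using t by simp
    finally show ?thesis using N by (simp add: \<tau>_def field_simps)
  qed
  have p: "0 \<le> p" "p \<ge> 1 - 1 / real k"
  proof -
    have "real k \<le> 2 ^ k" using of_nat_less_two_power[of k, where 'a = real] by simp
    then have "(1 / 2) ^ k \<le> 1 / real k" using k1 by (simp add: power_one_over field_simps)
    then show "p \<ge> 1 - 1 / real k" by (simp add: p_def)
    show "0 \<le> p" by (simp add: p_def power_le_one)
  qed
  \<comment> \<open>Replacing p by 1 - 1/k costs exp(\<open>\<tau>0\<close> / k), which is at most 3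
    because k = n^\<gamma> dominates the logarithm in \<open>\<tau>0\<close> by
    \<open>e3\<close>.\<close>
  have num: "N * exp (- \<tau> * p) \<le> 3 * N powr (\<gamma> - 1) * exp (- 2 * c)"
  proof -
    have "exp (- \<tau> * p) \<le> exp (- \<tau>0 * p)" using \<tau> p by (simp add: mult_right_mono)
    also have "\<dots> \<le> exp (- \<tau>0 * (1 - 1 / real k))" using \<tau>0 p by simp
    also have "\<dots> = exp (- \<tau>0) * exp (\<tau>0 / real k)" by (simp add: exp_add[symmetric] algebra_simps)
    also have "\<dots> \<le> exp (- \<tau>0) * 3"
    proof (rule mult_left_mono)
      have "\<tau>0 / real k \<le> 1"
        using e3 by (simp add: kN \<tau>0_def L_def N_def powr_minus divide_inverse)
      then have "exp (\<tau>0 / real k) \<le> exp 1" by simp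
      then show "exp (\<tau>0 / real k) \<le> 3" using exp_le by linarith
    qed simp
    finally have "N * exp (- \<tau> * p) \<le> N * (exp (- \<tau>0) * 3)" using N by (intro mult_left_mono) auto
    also have "N * (exp (- \<tau>0) * 3) = 3 * (exp L * exp (- \<tau>0))" using N by (simp add: L_def)
    also have "exp L * exp (- \<tau>0) = exp ((\<gamma> - 1) * L) * exp (- 2 * c)"
      by (simp add: \<tau>0_def exp_add[symmetric] algebra_simps)
    also have "exp ((\<gamma> - 1) * L) = N powr (\<gamma> - 1)" using N by (simp add: powr_def L_def)
    finally show ?thesis by (simp add: mult.assoc)
  qed
  have w: "w \<ge> real k / (2 * N)"
  proof -
    define x where "x = real k / N"
    have x: "0 \<le> x" "x \<le> 1" using kleN N by (auto simp: x_def)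
    have "(1 - 1 / N) ^ k \<le> exp (- (real k * (1 / N)))"
      using N by (intro one_minus_power_le_exp) auto
    then have "w \<ge> 1 - exp (- x)" by (simp add: w_def x_def)
    moreover have "x / (1 + x) \<ge> x / 2" using x by (intro divide_left_mono) auto
    ultimately have "w \<ge> x / 2" using one_minus_exp_ge[OF x(1)] by linarith
    then show ?thesis by (simp add: x_def)
  qed
  define z where "z = \<tau>0 * (real k / (2 * N))"
  have z0: "z > 0" using \<tau>0 k1 N by (simp add: z_def)
  have "z \<le> \<tau> * w" unfolding z_def using \<tau> \<tau>0 w N by (intro mult_mono) auto
  then have den: "1 - exp (- \<tau> * w) \<ge> z / (1 + z)"
    using one_minus_exp_ge[of z] z0 by (smt (verit) exp_le_cancel_iff mult_minus_left)
  have zp: "z / (1 + z) > 0" using z0 by simp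
  have y0: "y \<ge> 0" proof -
    have "1 - exp (- \<tau> * w) \<ge> 0" using den zp by linarith
    then show ?thesis unfolding y_def using N by (intro divide_nonneg_nonneg mult_nonneg_nonneg) auto
  qed
  have "y \<le> 3 * N powr (\<gamma> - 1) * exp (- 2 * c) / (z / (1 + z))"
    unfolding y_def using num den zp by (intro frac_le) auto
  also have "\<dots> = 3 * exp (- 2 * c) * (N powr (\<gamma> - 1) + N powr (\<gamma> - 1) / z)"
    using z0 by (simp add: field_simps)
  \<comment> \<open>Here k = n^\<gamma> cancels the power of n. With \<open>\<tau>0 \<ge> 12\<close>
    both summands are at most 1/6, which offsets the factor 3.\<close>
  also have "N powr (\<gamma> - 1) / z = 2 / \<tau>0"
  proof -
    have "N powr (\<gamma> - 1) * N = N powr \<gamma>" using N by (simp add: powr_diff)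
    then show ?thesis using \<tau>0 N k1 kN[symmetric] by (simp add: z_def field_simps)
  qed
  also have "3 * exp (- 2 * c) * (N powr (\<gamma> - 1) + 2 / \<tau>0) \<le> 3 * exp (- 2 * c) * (1 / 6 + 1 / 6)"
    using e1 \<tau>0 by (intro mult_left_mono add_mono) (auto simp: N_def field_simps)
  also have "\<dots> = exp (- 2 * c)" by simp
  finally have y2: "y \<le> exp (- 2 * c)" .
  \<comment> \<open>This keeps 1 - y above 1/2; the two contributions then add up to at most 2 * 2 +
    1 = 5 times exp(-c).\<close>
  have "exp c \<ge> 4" using exp_ge_add_one_self[of c] c by linarith
  then have ec: "exp (- c) \<le> 1 / 4" by (simp add: exp_minus field_simps)
  have yc: "y \<le> exp (- c)" using y2 c by (smt (verit) exp_le_cancel_iff)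
  have "(l2_dist n (shuffle_steps n k t id) (uniform n))\<^sup>2 \<le> 2 * (y / (1 - y)) + (1 - 1 / real n) ^ (2 * t)"
  proof (rule l2_bound_odd[OF n k(1)])
    show "\<tau> = 2 * real t / real n" by (simp add: \<tau>_def N_def)
    show "real n * exp (- \<tau> * (1 - (1 / 2) ^ k)) = y * (1 - exp (- \<tau> * (1 - (1 - 1 / real n) ^ k)))"
    proof -
      have "1 - exp (- \<tau> * w) \<noteq> 0" using den zp by linarith
      then have "N * exp (- \<tau> * p) = y * (1 - exp (- \<tau> * w))"
        unfolding y_def by (metis nonzero_eq_divide_eq)
      then show ?thesis unfolding p_def w_def N_def .
    qed
    show "0 \<le> y" by (rule y0)
    show "y < 1" using yc ec by linarith
  qed
  moreover have "y / (1 - y) \<le> 2 * exp (- c)"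
  proof -
    have "y / (1 - y) \<le> y / (1 / 2)" using yc ec y0 by (intro divide_left_mono) auto
    then show ?thesis using yc by simp
  qed
  moreover have "(1 - 1 / real n) ^ (2 * t) \<le> exp (- c)"
  proof -
    have "(1 - 1 / real n) ^ (2 * t) \<le> exp (- (real (2 * t) * (1 / real n)))"
      using n by (intro one_minus_power_le_exp) auto
    also have "\<dots> = exp (- \<tau>)" by (simp add: \<tau>_def N_def)
    also have "\<dots> \<le> exp (- c)"
    proof -
      have "(2 - \<gamma>) * L \<ge> 0" using \<gamma> L by simp
      then have "\<tau>0 \<ge> c" using c by (simp add: \<tau>0_def)
      then show ?thesis using \<tau> by simp
    qed
    finally show ?thesis .
  qed
  moreover have "exp (- c) > 0" by simp
  ultimately show ?thesis by linarith
qed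

lemma eventually_growing:
  fixes c \<gamma> :: real
  assumes "0 < \<gamma>" "\<gamma> < 1"
  shows "eventually (\<lambda>n. n \<ge> 2 \<and> real n powr (\<gamma> - 1) \<le> 1 / 6 \<and> ln (real n) \<ge> 12 \<and>
    ((2 - \<gamma>) * ln (real n) + 2 * c) * real n powr (- \<gamma>) \<le> 1) sequentially"
proof -
  have "((\<lambda>n. real n powr (\<gamma> - 1)) \<longlongrightarrow> 0) sequentially" using assms by real_asymp
  then have "eventually (\<lambda>n. real n powr (\<gamma> - 1) < 1 / 6) sequentially" by (rule order_tendstoD) simp
  moreover have "((\<lambda>n. ((2 - \<gamma>) * ln (real n) + 2 * c) * real n powr (- \<gamma>)) \<longlongrightarrow> 0) sequentially"
    using assms by real_asymp
  then have "eventually (\<lambda>n. ((2 - \<gamma>) * ln (real n) + 2 * c) * real n powr (- \<gamma>) < 1) sequentially"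
    by (rule order_tendstoD) simp
  moreover have "eventually (\<lambda>n::nat. ln (real n) \<ge> 12) sequentially" by real_asymp
  ultimately show ?thesis using eventually_ge_at_top[of 2] by eventually_elim auto
qed

lemma le_nat_ceiling: "x \<le> real (nat \<lceil>x\<rceil>)"
  by (meson le_of_int_ceiling of_nat_ceiling)

theorem theorem2:
  shows
    "(\<exists>A::real. \<forall>(k::nat) (c::real). odd k \<and> k \<ge> 1 \<and> c > 0 \<longrightarrow>
        (\<forall>\<^sub>F n::nat in sequentially.
          let t = nat \<lceil>real n * ln (real n) + c * real n\<rceil> in
            4 * (tv_dist n (shuffle_steps n k t id) (uniform n))\<^sup>2
              \<le> (l2_dist n (shuffle_steps n k t id) (uniform n))\<^sup>2 \<and>
            (l2_dist n (shuffle_steps n k t id) (uniform n))\<^sup>2 < A * exp (- c)))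
   \<and> (\<exists>B::real. \<forall>(k::nat) (c::real). even k \<and> k \<ge> 4 \<and> c > 1 \<longrightarrow>
        (\<forall>\<^sub>F n::nat in sequentially.
          let t = nat \<lceil>real n * ln (real n) + c * real n\<rceil> in
            4 * (tv_dist n (shuffle_steps n k t id) (uniform n))\<^sup>2
              \<le> (l2_dist n (shuffle_steps n k t id) (uniform n))\<^sup>2 \<and>
            (l2_dist n (shuffle_steps n k t id) (uniform n))\<^sup>2 < B * exp (- c)))
   \<and> (\<exists>C::real. \<forall>c::real. c > 1 \<longrightarrow>
        (\<forall>\<^sub>F n::nat in sequentially.
          let t = nat \<lceil>3 / 2 * real n * ln (real n) + c * real n\<rceil> in
            4 * (tv_dist n (shuffle_steps n 2 t id) (uniform n))\<^sup>2
              \<le> (l2_dist n (shuffle_steps n 2 t id) (uniform n))\<^sup>2 \<and>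
            (l2_dist n (shuffle_steps n 2 t id) (uniform n))\<^sup>2 < C * exp (- c)))
   \<and> (\<forall>(\<gamma>::real) (c::real). 0 < \<gamma> \<and> \<gamma> < 1 \<and> c > 3 \<longrightarrow>
        (\<forall>\<^sub>F n::nat in sequentially.
          \<forall>k::nat. odd k \<and> real k = real n powr \<gamma> \<longrightarrow>
          (let t = nat \<lceil>(1 - \<gamma> / 2) * real n * ln (real n) + c * real n\<rceil> in
            4 * (tv_dist n (shuffle_steps n k t id) (uniform n))\<^sup>2
              \<le> (l2_dist n (shuffle_steps n k t id) (uniform n))\<^sup>2 \<and>
            (l2_dist n (shuffle_steps n k t id) (uniform n))\<^sup>2 < 10 * exp (- c))))"
proof -
  have main: "\<forall>\<^sub>F n::nat in sequentially. let t = nat \<lceil>real n * ln (real n) + c * real n\<rceil> in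
            4 * (tv_dist n (shuffle_steps n k t id) (uniform n))\<^sup>2
              \<le> (l2_dist n (shuffle_steps n k t id) (uniform n))\<^sup>2 \<and>
            (l2_dist n (shuffle_steps n k t id) (uniform n))\<^sup>2 < 24 * exp (- c)"
    if "k \<ge> 1" "c > 0" for k :: nat and c :: real
    using eventually_conditions
  proof eventually_elim
    case (elim n)
    then show ?case
      unfolding Let_def using that by (intro conjI tv_le_l2 l2_upper_bound le_nat_ceiling) auto
  qed
  have main2: "\<forall>\<^sub>F n::nat in sequentially. let t = nat \<lceil>3 / 2 * real n * ln (real n) + c * real n\<rceil> in
            4 * (tv_dist n (shuffle_steps n 2 t id) (uniform n))\<^sup>2
              \<le> (l2_dist n (shuffle_steps n 2 t id) (uniform n))\<^sup>2 \<and>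
            (l2_dist n (shuffle_steps n 2 t id) (uniform n))\<^sup>2 < 24 * exp (- c)"
    if "c > 1" for c :: real
    using eventually_conditions
  proof eventually_elim
    case (elim n)
    \<comment> \<open>\<open>l2_upper_bound\<close> holds for every time from n log n + c n on and
      for k = 2 too, so it suffices that the time given here is later.\<close>
    have "real n * ln (real n) \<le> 3 / 2 * real n * ln (real n)" using elim by simp
    with le_nat_ceiling[of "3 / 2 * real n * ln (real n) + c * real n"]
    have "real n * ln (real n) + c * real n \<le> real (nat \<lceil>3 / 2 * real n * ln (real n) + c * real n\<rceil>)" by linarith
    then show ?case
      unfolding Let_def using that elim by (intro conjI tv_le_l2 l2_upper_bound) auto
  qed
  have main3: "\<forall>\<^sub>F n::nat in sequentially. \<forall>k::nat. odd k \<and> real k = real n powr \<gamma> \<longrightarrow>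
          (let t = nat \<lceil>(1 - \<gamma> / 2) * real n * ln (real n) + c * real n\<rceil> in
            4 * (tv_dist n (shuffle_steps n k t id) (uniform n))\<^sup>2
              \<le> (l2_dist n (shuffle_steps n k t id) (uniform n))\<^sup>2 \<and>
            (l2_dist n (shuffle_steps n k t id) (uniform n))\<^sup>2 < 10 * exp (- c))"
    if "0 < \<gamma>" "\<gamma> < 1" "c > 3" for \<gamma> c :: real
    using eventually_growing[OF that(1,2), of c]
  proof eventually_elim
    case (elim n)
    then show ?case
      unfolding Let_def
      by (intro allI impI conjI tv_le_l2 l2_upper_bound_growing[OF that] le_nat_ceiling) auto
  qed
  show ?thesis
  proof (intro conjI)
    show "\<exists>A::real. \<forall>(k::nat) (c::real). odd k \<and> k \<ge> 1 \<and> c > 0 \<longrightarrow>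
        (\<forall>\<^sub>F n::nat in sequentially.
          let t = nat \<lceil>real n * ln (real n) + c * real n\<rceil> in
            4 * (tv_dist n (shuffle_steps n k t id) (uniform n))\<^sup>2
              \<le> (l2_dist n (shuffle_steps n k t id) (uniform n))\<^sup>2 \<and>
            (l2_dist n (shuffle_steps n k t id) (uniform n))\<^sup>2 < A * exp (- c))"
      using main by blast
    show "\<exists>B::real. \<forall>(k::nat) (c::real). even k \<and> k \<ge> 4 \<and> c > 1 \<longrightarrow>
        (\<forall>\<^sub>F n::nat in sequentially.
          let t = nat \<lceil>real n * ln (real n) + c * real n\<rceil> in
            4 * (tv_dist n (shuffle_steps n k t id) (uniform n))\<^sup>2
              \<le> (l2_dist n (shuffle_steps n k t id) (uniform n))\<^sup>2 \<and>
            (l2_dist n (shuffle_steps n k t id) (uniform n))\<^sup>2 < B * exp (- c))"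
      by (rule exI[of _ 24], intro allI impI main) auto
  qed (use main2 main3 in blast)+
qed

end
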